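(* Let $\mathcal{C}$ be a covering of the plane by complete folding curves which satisfies the local isomorphism property. Then each (nonempty) bounded set of curves $\mathcal{B}<\mathcal{C}$ has a density $d>0$ in $\mathcal{C}$.
   Context: Curves and coverings. Identify $\mathbb{R}^2$ with $\mathbb{C}$ and $\mathbb{Z}^2$ with $\mathbb{Z}+i\mathbb{Z}$. To a sequence $(a_k)_{1\le k\le n-1}$, $(a_k)_{k\in\mathbb{N}^*}$ or $(a_k)_{k\in\mathbb{Z}}$ with all $a_k=\pm1$ are associated the curves $(C_k)_{1\le k\le n}$, $(C_k)_{k\in\mathbb{N}^*}$, $(C_k)_{k\in\mathbb{Z}}$ whose segments are oriented intervals $C_k=[x_k,x_k+\varepsilon_k]$ with $x_k\in\mathbb{Z}+i\mathbb{Z}$, $\varepsilon_k\in\{1,-1,i,-i\}$, and, whenever $C_k,C_{k+1}$ exist, $x_k+\varepsilon_k=x_{k+1}$ and $\varepsilon_{k+1}=i^{a_k}\varepsilon_k$. Curves are rounded at the points $x_{k+1}$ so that they do not pass through them (so curves sharing no unit interval are disjoint). Curves indexed by $\mathbb{Z}$ are called complete and are considered up to a shift of the index. A covering (of the plane) is a set of complete curves such that each nonoriented interval $[z,z+\varepsilon]$ with $z\in\mathbb{Z}+i\mathbb{Z}$, $\varepsilon\in\{1,i\}$ is the support of exactly one segment of exactly one of the curves. Orientation convention: for each $z=x+iy\in\mathbb{Z}+i\mathbb{Z}$, depending on the parity of $x+y$, the segments with endpoint $z$ are $[z,z+1],[z,z-1],[z+i,z],[z-i,z]$, or they are $[z+1,z],[z-1,z],[z,z+i],[z,z-i]$.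 Folding sequences. For a finite sequence $S=(a_1,\dots,a_m)$ put $\overline{S}=(-a_m,\dots,-a_1)$. The $0$-folding sequence is empty, and the $(n+1)$-folding sequences are the sequences $(\overline{S},\varepsilon,S)$ with $S$ an $n$-folding sequence and $\varepsilon=\pm1$. A complete folding sequence is a sequence $(a_k)_{k\in\mathbb{Z}}$ in $\{\pm1\}$ such that each finite block $(a_{k+1},\dots,a_{k+l})$ is a block of consecutive terms of an $n$-folding sequence for some $n$. A complete folding curve is a complete curve associated to such a sequence. Local isomorphism. For sets of curves $\mathcal{B},\mathcal{C}$: $\mathcal{B}\cong\mathcal{C}$ means that $\mathcal{C}$ is the image of $\mathcal{B}$ under a translation; $\mathcal{B}<\mathcal{C}$ means that $\mathcal{B}\ne\mathcal{C}$, each curve of $\mathcal{B}$ is contained in (is a subcurve of) a curve of $\mathcal{C}$, and any consecutive segments of a curve of $\mathcal{C}$ which belong to curves of $\mathcal{B}$ are consecutive in one of them. A set of curves is bounded if it has finitely many segments in total. A covering $\mathcal{C}$ satisfies the local isomorphism property if for each bounded set of curves $\mathcal{B}<\mathcal{C}$ there is $r>0$ such that every disc of radius $r$ contains some $\mathcal{B}'<\mathcal{C}$ with $\mathcal{B}'\cong\mathcal{B}$. Density. For $z\in\mathbb{C}$ and real $s>0$ let $\Sigma_s(z)=\{z+x+iy\mid x,y\in[0,s]\}$. The density of a bounded set of curves $\mathcal{B}<\mathcal{C}$ in $\mathcal{C}$ is the real number $d\ge0$ if for each real $\varepsilon>0$ there exists a real $r>0$ such that for each real $s\ge r$ and each $z\in\mathbb{C}$,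 $$s^2d(1-\varepsilon)<\bigl|\{\mathcal{F}<\mathcal{C}\mid \mathcal{F}\cong\mathcal{B}\text{ and }\mathcal{F}\subset\Sigma_s(z)\}\bigr|<s^2d(1+\varepsilon),$$ where $\mathcal{F}\subset\Sigma_s(z)$ means that all segments of curves of $\mathcal{F}$ are contained in $\Sigma_s(z)$. *)

theory Defs
  imports "HOL-Analysis.Analysis" "HOL-Library.Sublist"
begin

section \<open>Segments and curves\<close>

definition gauss_ints :: "complex set" where
  "gauss_ints = {z. Re z \<in> \<int> \<and> Im z \<in> \<int>}"

text \<open>The oriented interval \<open>[x, x + \<epsilon>]\<close> is the pair \<open>(x, x + \<epsilon>)\<close> of its endpoints.\<close>

type_synonym segment = "complex \<times> complex"

definition dir :: "segment \<Rightarrow> complex" where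
  "dir s = snd s - fst s"

definition is_segment :: "segment \<Rightarrow> bool" where
  "is_segment s \<longleftrightarrow> fst s \<in> gauss_ints \<and> dir s \<in> {1, -1, \<i>, -\<i>}"

definition support :: "segment \<Rightarrow> complex set" where
  "support s = closed_segment (fst s) (snd s)"

text \<open>
  \<open>curve_along I a \<gamma>\<close>: the family \<open>(\<gamma> k)\<close>, \<open>k \<in> I\<close>, is a curve associated to the sequence
  \<open>(a k)\<close>, \<open>k, k + 1 \<in> I\<close>. Here \<open>I\<close> is an interval of integers.
  The rounding of curves at lattice points is not represented: how the curves pass through a
  lattice point is recorded by which segments are consecutive.
\<close>

definition curve_along :: "int set \<Rightarrow> (int \<Rightarrow> int) \<Rightarrow> (int \<Rightarrow> segment) \<Rightarrow> bool" where
  "curve_along I a \<gamma> \<longleftrightarrow>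
     (\<forall>k\<in>I. is_segment (\<gamma> k)) \<and>
     (\<forall>k\<in>I. k + 1 \<in> I \<longrightarrow>
        a k \<in> {1, -1} \<and>
        snd (\<gamma> k) = fst (\<gamma> (k + 1)) \<and>
        dir (\<gamma> (k + 1)) = \<i> powi (a k) * dir (\<gamma> k))"

definition complete_curve :: "(int \<Rightarrow> segment) \<Rightarrow> bool" where
  "complete_curve \<gamma> \<longleftrightarrow> (\<exists>a. curve_along UNIV a \<gamma>)"

definition finite_curve :: "segment list \<Rightarrow> bool" where
  "finite_curve \<beta> \<longleftrightarrow>
     \<beta> \<noteq> [] \<and> (\<exists>a. curve_along {1..int (length \<beta>)} a (\<lambda>k. \<beta> ! nat (k - 1)))"

section \<open>Folding sequences and folding curves\<close>

definition seq_bar :: "int list \<Rightarrow> int list" where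
  "seq_bar S = map uminus (rev S)"

inductive folding_seq :: "nat \<Rightarrow> int list \<Rightarrow> bool" where
  folding_seq_0: "folding_seq 0 []"
| folding_seq_Suc:
    "folding_seq n S \<Longrightarrow> e \<in> {1, -1} \<Longrightarrow> folding_seq (Suc n) (seq_bar S @ [e] @ S)"

definition complete_folding_seq :: "(int \<Rightarrow> int) \<Rightarrow> bool" where
  "complete_folding_seq a \<longleftrightarrow>
     (\<forall>k. a k \<in> {1, -1}) \<and>
     (\<forall>k. \<forall>l::nat. \<exists>n S. folding_seq n S \<and> sublist (map a [k + 1..k + int l]) S)"

definition complete_folding_curve :: "(int \<Rightarrow> segment) \<Rightarrow> bool" where
  "complete_folding_curve \<gamma> \<longleftrightarrow> (\<exists>a. complete_folding_seq a \<and> curve_along UNIV a \<gamma>)"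

section \<open>Coverings\<close>

text \<open>
  Complete curves matter only up to a shift of the index. A covering is given by a set containing
  one parametrization of each of its curves; two parametrizations of the same curve are
  excluded by the uniqueness of the pair \<open>(\<gamma>, k)\<close> below.
\<close>

definition segments_of :: "(int \<Rightarrow> segment) set \<Rightarrow> segment set" where
  "segments_of C = (\<Union>\<gamma>\<in>C. range \<gamma>)"

definition orientation_convention :: "(int \<Rightarrow> segment) set \<Rightarrow> bool" where
  "orientation_convention C \<longleftrightarrow>
     (\<exists>p::int. \<forall>x y::int. let z = Complex (of_int x) (of_int y) in
        {s \<in> segments_of C. fst s = z \<or> snd s = z} =
          (if even (x + y + p)
           then {(z, z + 1), (z, z - 1), (z + \<i>, z), (z - \<i>, z)}
           else {(z + 1, z), (z - 1, z), (z, z + \<i>), (z, z - \<i>)}))"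

definition covering :: "(int \<Rightarrow> segment) set \<Rightarrow> bool" where
  "covering C \<longleftrightarrow>
     (\<forall>\<gamma>\<in>C. complete_curve \<gamma>) \<and>
     (\<forall>z\<in>gauss_ints. \<forall>e\<in>{1, \<i>}.
        \<exists>!(\<gamma>, k). \<gamma> \<in> C \<and> support (\<gamma> k) = closed_segment z (z + e)) \<and>
     orientation_convention C"

section \<open>Bounded sets of curves and local isomorphism\<close>

text \<open>
  The segments of a curve of a covering are pairwise distinct, so an infinite subcurve of it has
  infinitely many segments. Hence the curves of a bounded set \<open>B < C\<close> are finite, and bounded sets
  are modelled as sets of finite curves, a finite curve being the list of its segments.
\<close>

definition bounded_curve_set :: "segment list set \<Rightarrow> bool" where
  "bounded_curve_set B \<longleftrightarrow> (\<forall>\<beta>\<in>B. finite_curve \<beta>) \<and> finite (\<Union>\<beta>\<in>B. set \<beta>)"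

definition subcurve :: "segment list \<Rightarrow> (int \<Rightarrow> segment) \<Rightarrow> bool" where
  "subcurve \<beta> \<gamma> \<longleftrightarrow> (\<exists>k l. \<beta> = map \<gamma> [k..l])"

text \<open>
  \<open>part_of B C\<close> is the relation \<open>B < C\<close>. Its clause \<open>B \<noteq> C\<close> holds trivially here, since the curves
  of \<open>B\<close> are finite, those of \<open>C\<close> are complete, and a covering is not empty.
\<close>

definition part_of :: "segment list set \<Rightarrow> (int \<Rightarrow> segment) set \<Rightarrow> bool" where
  "part_of B C \<longleftrightarrow>
     (\<forall>\<beta>\<in>B. \<exists>\<gamma>\<in>C. subcurve \<beta> \<gamma>) \<and>
     (\<forall>\<gamma>\<in>C. \<forall>k l. k \<le> l \<and> \<gamma> ` {k..l} \<subseteq> (\<Union>\<beta>\<in>B. set \<beta>) \<longrightarrow>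
        (\<exists>\<beta>\<in>B. sublist (map \<gamma> [k..l]) \<beta>))"

definition translate :: "complex \<Rightarrow> segment \<Rightarrow> segment" where
  "translate v s = (fst s + v, snd s + v)"

definition translation_equiv :: "segment list set \<Rightarrow> segment list set \<Rightarrow> bool" where
  "translation_equiv B F \<longleftrightarrow> (\<exists>v. F = map (translate v) ` B)"

definition lies_in :: "segment list set \<Rightarrow> complex set \<Rightarrow> bool" where
  "lies_in F A \<longleftrightarrow> (\<forall>\<beta>\<in>F. \<forall>s\<in>set \<beta>. support s \<subseteq> A)"

definition local_isomorphism_property :: "(int \<Rightarrow> segment) set \<Rightarrow> bool" where
  "local_isomorphism_property C \<longleftrightarrow>
     (\<forall>B. bounded_curve_set B \<and> part_of B C \<longrightarrow>
        (\<exists>r>0. \<forall>z. \<exists>B'. part_of B' C \<and> translation_equiv B B' \<and> lies_in B' (cball z r)))"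

section \<open>Density\<close>

definition square :: "real \<Rightarrow> complex \<Rightarrow> complex set" where
  "square s z = {z + Complex x y | x y. x \<in> {0..s} \<and> y \<in> {0..s}}"

definition has_density :: "(int \<Rightarrow> segment) set \<Rightarrow> segment list set \<Rightarrow> real \<Rightarrow> bool" where
  "has_density C B d \<longleftrightarrow>
     d \<ge> 0 \<and>
     (\<forall>\<epsilon>>0. \<exists>r>0. \<forall>s\<ge>r. \<forall>z.
        let N = real (card {F. part_of F C \<and> translation_equiv B F \<and> lies_in F (square s z)})
        in s\<^sup>2 * d * (1 - \<epsilon>) < N \<and> N < s\<^sup>2 * d * (1 + \<epsilon>))"

end

theory Submission
  imports Defs
begin

text \<open>
  Proof idea. At every lattice point the two strands of a covering turn the same way, so the covering
  is given by its turning function \<open>\<sigma>\<close> on \<open>\<int>\<^sup>2\<close>. In a folding sequence every second term alternates,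
  and the remaining terms form a folding sequence again. A folding curve fills arbitrarily large
  discs: undoing one folding step multiplies by \<open>1 \<plusminus> \<i>\<close>, and this turns a filled diamond into a filled
  square and a filled square into a diamond of twice the radius; a first diamond occurs in every
  path of 128 segments folded seven times. As every pattern recurs in a filled disc, the local
  isomorphism property forces \<open>\<sigma>\<close> to alternate on one of the two parity classes of \<open>\<int>\<^sup>2\<close>, consistently
  for all curves, and the other class carries a covering of the same kind. By iteration \<open>\<sigma>\<close> is
  periodic with period \<open>2 \<cdot> 2\<^sup>m\<close> outside a coset of \<open>2\<^sup>m\<int>\<^sup>2\<close>, for each \<open>m\<close>. Hence the set of occurrences of
  a bounded pattern is, up to sets of arbitrarily small density, periodic, so that it has a uniform
  density, which is positive because the pattern occurs in every large disc.
\<close>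

section \<open>Folding sequences\<close>

text \<open>The decomposition of one folding sequence says nothing about other curves: two curves of
  the covering could alternate on different parity classes of the plane, or on the same class with
  opposite signs. Excluding this is the main obstacle. Where a single curve passes through every
  point of a region, its alternation in time is already an alternation in space, and two far apart
  points of the plane are compared by moving both into such a region at once. The growth of filled
  regions needs a positive radius to start from, since doubling radius 0 gives nothing; this is why
  a finite check of explicit words enters. Each derivation settles half of the remaining points. Two
  of them multiply by \<open>(1 + i)^2 = 2i\<close>, so after \<open>2m\<close> derivations the
  unsettled points form a coset of density \<open>4^(-m)\<close>, which bounds the error in the
  count of occurrences. Curves are only followed forwards from a chosen segment, so all sequences
  are indexed by natural numbers.\<close>

definition folds :: "(nat \<Rightarrow> int) \<Rightarrow> bool" where
  "folds a \<longleftrightarrow> (\<forall>l. \<exists>n S. folding_seq n S \<and> sublist (map a [0..<l]) S)"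

text \<open>In \<open>seq_bar S1 @ [e] @ S1\<close> the middle term has the odd index
  \<open>2 * length T + 1\<close>, so it joins the derived word, which becomes
  \<open>seq_bar T @ [e] @ T\<close>. Reversing and negating an alternating word leaves it
  alternating, and the signs of the two halves fit together across the middle.\<close>

lemma folding_seq_interleave:
  assumes "folding_seq (Suc n) S"
  shows "\<exists>\<alpha>\<in>{1, -1}. \<exists>T. folding_seq n T \<and> length S = 2 * length T + 1 \<and>
    (\<forall>k\<le>length T. S ! (2 * k) = \<alpha> * (-1) ^ k) \<and> (\<forall>k<length T. S ! (2 * k + 1) = T ! k)"
  using assms
proof (induction n arbitrary: S)
  case 0
  then obtain e where "e \<in> {1, -1}" "S = [e]"
    by (auto elim!: folding_seq.cases simp: seq_bar_def)
  then show ?case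
    by (intro bexI[of _ e] exI[of _ "[]"]) (auto intro: folding_seq.intros)
next
  case (Suc n)
  from Suc.prems obtain S1 e where S1: "folding_seq (Suc n) S1" "e \<in> {1, -1}"
    and S: "S = seq_bar S1 @ [e] @ S1"
    by (cases rule: folding_seq.cases) auto
  from Suc.IH[OF S1(1)] obtain \<alpha> T where \<alpha>: "\<alpha> \<in> {1, -1}" and T: "folding_seq n T"
    and len: "length S1 = 2 * length T + 1"
    and ev: "\<And>k. k \<le> length T \<Longrightarrow> S1 ! (2 * k) = \<alpha> * (-1) ^ k"
    and od: "\<And>k. k < length T \<Longrightarrow> S1 ! (2 * k + 1) = T ! k"
    by blast
  let ?t = "length T"
  \<comment> \<open>The first term of \<open>seq_bar S1\<close>: the negative of the last
    even-indexed term \<open>\<alpha> * (-1) ^ ?t\<close> of \<open>S1\<close>.\<close>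
  let ?\<beta> = "\<alpha> * (-1) ^ (?t + 1)"
  let ?T = "seq_bar T @ [e] @ T"
  have lT: "length ?T = 2 * ?t + 1" by (simp add: seq_bar_def)
  have lS: "length (seq_bar S1) = 2 * ?t + 1" by (simp add: seq_bar_def len)
  have bar: "seq_bar S1 ! j = - S1 ! (2 * ?t - j)" if "j \<le> 2 * ?t" for j
    using that by (simp add: seq_bar_def rev_nth len)
  have barT: "seq_bar T ! j = - T ! (?t - 1 - j)" if "j < ?t" for j
    using that by (simp add: seq_bar_def rev_nth)
  have "S ! (2 * k) = ?\<beta> * (-1) ^ k" if k: "k \<le> 2 * ?t + 1" for k
  proof (cases "k \<le> ?t")
    case True
    have "S ! (2 * k) = seq_bar S1 ! (2 * k)"
      using True lS by (simp add: S nth_append)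
    also have "\<dots> = - S1 ! (2 * (?t - k))"
      using True by (simp add: bar diff_mult_distrib2)
    also have "\<dots> = - \<alpha> * (-1) ^ (?t - k)"
      by (simp add: ev)
    also have "\<dots> = ?\<beta> * (-1) ^ k"
    proof -
      have "?t = (?t - k) + k" using True by simp
      then have "(-1::int) ^ ?t = (-1) ^ (?t - k) * (-1) ^ k"
        by (metis power_add)
      moreover have "(-1::int) ^ k * (-1) ^ k = 1"
        by (simp flip: power_mult_distrib)
      ultimately show ?thesis by simp
    qed
    finally show ?thesis .
  next
    case False
    then obtain i where i: "k = ?t + 1 + i" "i \<le> ?t"
      using k that[of "k - (?t + 1)"] by auto
    have "S ! (2 * k) = S1 ! (2 * i)"
      using lS by (simp add: S nth_append i)
    also have "\<dots> = \<alpha> * (-1) ^ i" using i by (simp add: ev)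
    also have "\<dots> = ?\<beta> * (-1) ^ k"
    proof -
      have "(-1::int) ^ (?t + 1) * (-1) ^ (?t + 1) = 1"
        by (simp flip: power_mult_distrib)
      then show ?thesis by (simp add: i power_add)
    qed
    finally show ?thesis .
  qed
  moreover have "S ! (2 * k + 1) = ?T ! k" if k: "k < 2 * ?t + 1" for k
  proof -
    consider "k < ?t" | "k = ?t" | i where "k = ?t + 1 + i" "i < ?t"
      using k that(3)[of "k - (?t + 1)"] by fastforce
    then show ?thesis
    proof cases
      case 1
      have "S ! (2 * k + 1) = seq_bar S1 ! (2 * k + 1)"
        using 1 lS by (simp add: S nth_append)
      also have "\<dots> = - S1 ! (2 * (?t - 1 - k) + 1)"
      proof -
        have "2 * ?t - (2 * k + 1) = 2 * (?t - 1 - k) + 1" using 1 by linarith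
        then show ?thesis using 1 bar[of "2 * k + 1"] by simp
      qed
      also have "\<dots> = seq_bar T ! k" using 1 od[of "?t - 1 - k"] by (simp add: barT)
      also have "\<dots> = ?T ! k" using 1 by (simp add: nth_append seq_bar_def)
      finally show ?thesis .
    next
      case 2
      then show ?thesis using lS by (simp add: S nth_append) (simp add: seq_bar_def)
    next
      case 3
      have "S ! (2 * k + 1) = S1 ! (2 * i + 1)" using lS by (simp add: S nth_append 3)
      also have "\<dots> = T ! i" using 3(2) by (rule od)
      also have "\<dots> = ?T ! k" using 3 by (simp add: nth_append seq_bar_def)
      finally show ?thesis .
    qed
  qed
  moreover have "folding_seq (Suc n) ?T" using T S1 by (intro folding_seq.intros)
  moreover have "?\<beta> \<in> {1, -1}" using \<alpha> by (cases "even ?t") auto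
  moreover have "length S = 2 * length ?T + 1" using lT lS len by (simp add: S)
  ultimately show ?case using lT
    by (intro bexI[of _ ?\<beta>] exI[of _ ?T]) (auto simp: less_Suc_eq_le)
qed

text \<open>A compactness argument. A prefix occurs somewhere inside a folding sequence, and the
  parity of its position there decides the offset \<open>q\<close>. A pair
  \<open>(q, \<alpha>)\<close> that suits a prefix suits all shorter ones, and there are only four
  pairs, so one of them suits all prefixes.\<close>

lemma folds_derive:
  assumes "folds a"
  shows "\<exists>q\<in>{0, 1}. \<exists>\<alpha>\<in>{1, -1}.
    (\<forall>k. a (q + 2 * k) = \<alpha> * (-1) ^ k) \<and> folds (\<lambda>k. a (q + 2 * k + 1))"
proof -
  define P where "P q \<alpha> l \<longleftrightarrow> (\<forall>k\<le>l. a (q + 2 * k) = \<alpha> * (-1) ^ k) \<and>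
    (\<exists>n T. folding_seq n T \<and> sublist (map (\<lambda>k. a (q + 2 * k + 1)) [0..<l]) T)"
    for q \<alpha> l
  have mono: "P q \<alpha> l" if P: "P q \<alpha> l'" and l: "l \<le> l'" for q \<alpha> l l'
  proof -
    obtain i where i: "l' = l + i" using l le_Suc_ex by blast
    have "sublist (map (\<lambda>k. a (q + 2 * k + 1)) [0..<l]) (map (\<lambda>k. a (q + 2 * k + 1)) [0..<l'])"
      unfolding i upt_add_eq_append[of 0 l i, OF le0] map_append by simp
    then show ?thesis
      using P l unfolding P_def by (meson le_trans sublist_order.order_trans)
  qed
  have ex: "\<exists>q\<in>{0, 1}. \<exists>\<alpha>\<in>{1, -1}. P q \<alpha> l" for l
  proof -
    \<comment> \<open>The largest index inspected below is \<open>q + 2 * l\<close>, which may be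
      \<open>2 * l + 1\<close>.\<close>
    obtain n S where S: "folding_seq n S" "sublist (map a [0..<2 * l + 2]) S"
      using assms unfolding folds_def by blast
    define w where "w = map a [0..<2 * l + 2]"
    have w: "length w = 2 * l + 2" "\<And>i. i < 2 * l + 2 \<Longrightarrow> w ! i = a i"
      unfolding w_def by (simp, simp del: upt_Suc)
    obtain ps ss where eq: "S = ps @ w @ ss"
      using S(2) unfolding w_def sublist_def by blast
    have nth: "S ! (length ps + i) = a i" if "i < 2 * l + 2" for i
      using that by (simp add: eq nth_append w)
    have len: "length ps + (2 * l + 2) \<le> length S" by (simp add: eq w(1))
    have "S \<noteq> []" using len by auto
    then obtain n' where n': "n = Suc n'"
      using S(1) by (auto elim: folding_seq.cases)
    obtain \<alpha> T where \<alpha>: "\<alpha> \<in> {1, -1}" and T: "folding_seq n' T"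
      and lenS: "length S = 2 * length T + 1"
      and ev: "\<And>k. k \<le> length T \<Longrightarrow> S ! (2 * k) = \<alpha> * (-1) ^ k"
      and od: "\<And>k. k < length T \<Longrightarrow> S ! (2 * k + 1) = T ! k"
      using folding_seq_interleave[of n' S] S(1) n' by blast
    \<comment> \<open>The word starts at index \<open>length ps\<close> of \<open>S\<close>. After
      \<open>q\<close> further terms the index is the even number \<open>2 * m\<close>, where
      alternating terms of \<open>S\<close> sit.\<close>
    define q where "q = length ps mod 2"
    define m where "m = (length ps + q) div 2"
    have q: "q \<in> {0, 1}" by (auto simp: q_def)
    have m: "length ps + q = 2 * m" by (simp add: q_def m_def)
    have "a (q + 2 * k) = (\<alpha> * (-1) ^ m) * (-1) ^ k" if "k \<le> l" for k
    proof -
      have "a (q + 2 * k) = S ! (length ps + (q + 2 * k))"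
        using that q by (intro nth[symmetric]) auto
      also have "length ps + (q + 2 * k) = 2 * (m + k)" using arg_cong[OF m, of "\<lambda>x. x + 2 * k"] by (simp add: algebra_simps)
      also have "S ! (2 * (m + k)) = \<alpha> * (-1) ^ (m + k)"
        using that len lenS m q by (intro ev) auto
      finally show ?thesis by (simp add: power_add)
    qed
    moreover have "sublist (map (\<lambda>k. a (q + 2 * k + 1)) [0..<l]) T"
    proof -
      have "map (\<lambda>k. a (q + 2 * k + 1)) [0..<l] = take l (drop m T)"
      proof (rule nth_equalityI)
        show 1: "length (map (\<lambda>k. a (q + 2 * k + 1)) [0..<l]) = length (take l (drop m T))"
          using len lenS m q by auto
        fix k assume "k < length (map (\<lambda>k. a (q + 2 * k + 1)) [0..<l])"
        then have k: "k < l" by simp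
        have "a (q + 2 * k + 1) = S ! (length ps + (q + 2 * k + 1))"
          using k q by (intro nth[symmetric]) auto
        also have "length ps + (q + 2 * k + 1) = 2 * (m + k) + 1" using arg_cong[OF m, of "\<lambda>x. x + 2 * k"] by (simp add: algebra_simps)
        also have "S ! (2 * (m + k) + 1) = T ! (m + k)" using k len lenS m q by (intro od) auto
        finally show "map (\<lambda>k. a (q + 2 * k + 1)) [0..<l] ! k = take l (drop m T) ! k"
          using k len lenS m q by auto
      qed
      then show ?thesis
        by (metis sublist_drop sublist_order.order_trans sublist_take)
    qed
    moreover have "\<alpha> * (-1) ^ m \<in> {1, -1}" using \<alpha> by (cases "even m") auto
    ultimately show ?thesis using q T unfolding P_def by blast
  qed
  have "\<exists>q\<in>{0, 1}. \<exists>\<alpha>\<in>{1, -1}. \<forall>l. P q \<alpha> l"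
  proof (rule ccontr)
    assume "\<not> ?thesis"
    then have "\<forall>x\<in>{0, 1} \<times> {1, -1}. \<exists>l. \<not> P (fst x) (snd x) l" by fastforce
    then obtain f where f: "\<And>x. x \<in> {0, 1} \<times> {1, -1} \<Longrightarrow> \<not> P (fst x) (snd x) (f x)"
      by metis
    \<comment> \<open>By monotonicity all four pairs fail at this common length.\<close>
    define l where "l = Max (f ` ({0, 1} \<times> {1, -1}))"
    obtain q \<alpha> where q: "q \<in> {0, 1}" "\<alpha> \<in> {1, -1}" "P q \<alpha> l" using ex by blast
    have "f (q, \<alpha>) \<le> l" unfolding l_def using q by (intro Max_ge) auto
    then show False using mono[OF q(3)] f[of "(q, \<alpha>)"] q by auto
  qed
  then obtain q \<alpha> where q: "q \<in> {0, 1}" "\<alpha> \<in> {1, -1}" and P: "\<And>l. P q \<alpha> l" by blast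
  show ?thesis
    using q P unfolding P_def folds_def by (meson order_refl)
qed

lemma folding_seq_range: "folding_seq n S \<Longrightarrow> set S \<subseteq> {1, -1}"
  by (induction rule: folding_seq.induct) (auto simp: seq_bar_def)

lemma folds_range:
  assumes "folds a"
  shows "a k \<in> {1, -1}"
proof -
  obtain n S where "folding_seq n S" "sublist (map a [0..<Suc k]) S"
    using assms unfolding folds_def by blast
  then have "set (map a [0..<Suc k]) \<subseteq> {1, -1}"
    by (meson folding_seq_range set_mono_sublist subset_trans)
  then show ?thesis by auto
qed

section \<open>Lattice paths\<close>

definition rot :: "int \<times> int \<Rightarrow> int \<times> int" where
  "rot p = (- snd p, fst p)"

text \<open>Multiplication by \<open>i\<close> for \<open>a = 1\<close>, by \<open>-i\<close>
  otherwise; being total in \<open>a\<close>, it is linear and commutes with itself for all values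
  of \<open>a\<close>.\<close>

definition turn :: "int \<Rightarrow> int \<times> int \<Rightarrow> int \<times> int" where
  "turn a d = (if a = 1 then rot d else - rot d)"

definition dirs :: "(int \<times> int) set" where
  "dirs = {(1, 0), (0, 1), (-1, 0), (0, -1)}"

definition even_pt :: "int \<times> int \<Rightarrow> bool" where
  "even_pt p \<longleftrightarrow> even (fst p + snd p)"

primrec track :: "(nat \<Rightarrow> int) \<Rightarrow> (int \<times> int) \<times> (int \<times> int) \<Rightarrow> nat \<Rightarrow> (int \<times> int) \<times> (int \<times> int)" where
  "track a s 0 = s"
| "track a s (Suc k) =
     (fst (track a s k) + snd (track a s k), turn (a k) (snd (track a s k)))"

lemma track_shift: "track (\<lambda>i. a (q + i)) (track a s q) k = track a s (q + k)"
  by (induction k) auto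

lemma turn_dirs: "d \<in> dirs \<Longrightarrow> turn a d \<in> dirs"
  by (auto simp: dirs_def turn_def rot_def)

lemma uminus_dirs: "d \<in> dirs \<Longrightarrow> - d \<in> dirs"
  by (auto simp: dirs_def)

lemma even_pt_add_dir: "d \<in> dirs \<Longrightarrow> even_pt (z + d) \<longleftrightarrow> \<not> even_pt z"
  by (auto simp: dirs_def even_pt_def)

lemma track_dirs: "snd s \<in> dirs \<Longrightarrow> snd (track a s k) \<in> dirs"
  by (induction k) (auto simp: turn_dirs)

lemma turn_add: "turn a (x + y) = turn a x + turn a y"
  by (simp add: turn_def rot_def prod_eq_iff)

lemma turn_uminus: "turn a (- x) = - turn a x"
  by (simp add: turn_def rot_def prod_eq_iff)

lemma turn_commute: "turn a (turn b x) = turn b (turn a x)"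
  by (simp add: turn_def rot_def prod_eq_iff)

lemma turn_cancel: "a \<in> {1, -1} \<Longrightarrow> turn (- a) (turn a x) = x"
  by (auto simp: turn_def rot_def prod_eq_iff)

lemma turn_cancel': "a \<in> {1, -1} \<Longrightarrow> turn a (turn (- a) x) = x"
  by (auto simp: turn_def rot_def prod_eq_iff)

text \<open>\<open>scale \<alpha>\<close> is multiplication by \<open>1 + \<alpha>\<i>\<close>.\<close>

definition scale :: "int \<Rightarrow> int \<times> int \<Rightarrow> int \<times> int" where
  "scale \<alpha> z = z + turn \<alpha> z"

definition full :: "((int \<times> int) \<times> (int \<times> int)) set \<Rightarrow> int \<times> int \<Rightarrow> bool" where
  "full E v \<longleftrightarrow> (\<forall>d\<in>dirs. (v, d) \<in> E \<or> (v + d, - d) \<in> E)"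

definition para :: "int \<times> int \<Rightarrow> int \<times> int \<Rightarrow> bool" where
  "para d e \<longleftrightarrow> e = d \<or> e = - d"

lemma para_turn:
  assumes "d \<in> dirs" "e \<in> dirs"
  shows "para d (turn a e) \<longleftrightarrow> \<not> para d e"
proof -
  have "d = (1, 0) \<or> d = (0, 1) \<or> d = (-1, 0) \<or> d = (0, -1)"
    "e = (1, 0) \<or> e = (0, 1) \<or> e = (-1, 0) \<or> e = (0, -1)"
    using assms by (simp_all add: dirs_def)
  then show ?thesis
    by (elim disjE; simp add: para_def turn_def rot_def)
qed

text \<open>Each step changes the parity of the position and each turn exchanges horizontal and
  vertical. Hence the parity of the time can be read off from a position or from a direction
  alone.\<close>

lemma track_parity:
  assumes "d0 \<in> dirs"
  shows "(even_pt (fst (track b (z0, d0) k) - z0) \<longleftrightarrow> even k) \<and>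
    (para d0 (snd (track b (z0, d0) k)) \<longleftrightarrow> even k)"
proof (induction k)
  case 0
  then show ?case by (simp add: even_pt_def para_def)
next
  case (Suc k)
  have d: "snd (track b (z0, d0) k) \<in> dirs"
    using track_dirs[of "(z0, d0)" b k] assms by simp
  have "fst (track b (z0, d0) (Suc k)) - z0 =
      (fst (track b (z0, d0) k) - z0) + snd (track b (z0, d0) k)"
    by (simp add: algebra_simps)
  then have "even_pt (fst (track b (z0, d0) (Suc k)) - z0) \<longleftrightarrow> odd k"
    using Suc by (simp only: even_pt_add_dir[OF d] simp_thms)
  then show ?case
    using Suc para_turn[OF assms d] by simp
qed

section \<open>Undoing one fold of a lattice path\<close>

text \<open>The path of \<open>b\<close> runs along diagonals: its edge \<open>k\<close> stands for
  the edges \<open>2 * k\<close> and \<open>2 * k + 1\<close> of the path of \<open>a\<close>.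
  Because the turns between these two alternate, all diagonals arise from edges of \<open>b\<close>
  by the same factor \<open>1 + \<alpha>i\<close>.\<close>

locale derived_track =
  fixes a b :: "nat \<Rightarrow> int" and \<alpha> :: int and z0 d0 :: "int \<times> int"
  assumes alpha: "\<alpha> \<in> {1, -1}"
    and alternating: "\<And>k. a (2 * k) = \<alpha> * (-1) ^ k"
    and derived: "\<And>k. b k = a (2 * k + 1)"
    and derived_range: "\<And>k. b k \<in> {1, -1}"
    and d0: "d0 \<in> dirs"
begin

definition E where "E = range (track a (z0, d0))"
definition E' where "E' = range (track b (0, d0))"

text \<open>The sides \<open>d\<close> and \<open>turn \<alpha> d\<close> over a diagonal are
  traversed in this order for even \<open>k\<close> and in the opposite order for odd
  \<open>k\<close>, so the corner lies alternately on the two sides of the diagonal.\<close>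

lemma track_even_time:
  "track a (z0, d0) (2 * k) =
    (z0 + scale \<alpha> (fst (track b (0, d0) k)),
     if even k then snd (track b (0, d0) k) else turn \<alpha> (snd (track b (0, d0) k)))"
proof (induction k)
  case 0
  then show ?case by (simp add: scale_def turn_def rot_def zero_prod_def)
next
  case (Suc k)
  obtain z d where t: "track b (0, d0) k = (z, d)" by (metis surj_pair)
  have 2: "2 * Suc k = Suc (Suc (2 * k))" by simp
  have a: "a (Suc (2 * k)) = b k" using derived by simp
  have sc: "scale \<alpha> (z + d) = scale \<alpha> z + d + turn \<alpha> d"
    by (simp add: scale_def turn_add)
  show ?case
  proof (cases "even k")
    case True
    then have "a (2 * k) = \<alpha>" using alternating by simp
    then show ?thesis
      using True unfolding 2 track.simps Suc.IH t a
      by (simp add: sc turn_commute add.assoc)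
  next
    case False
    then have "a (2 * k) = - \<alpha>" using alternating by simp
    then show ?thesis
      using False turn_cancel[OF alpha] unfolding 2 track.simps Suc.IH t a
      by (simp add: sc add.assoc add.commute[of d])
  qed
qed

lemma track_odd_time:
  "track a (z0, d0) (2 * k + 1) =
    (let (z, d) = track a (z0, d0) (2 * k) in (z + d, turn (\<alpha> * (-1) ^ k) d))"
  using alternating by (simp add: case_prod_beta)

text \<open>The derived path starts at 0, so the parity of \<open>z\<close> is that of
  \<open>k\<close> and decides which of the two sides over the edge comes first.\<close>

lemma in_E'D:
  assumes "(z, d) \<in> E'"
  shows "d \<in> dirs" "para d0 d \<longleftrightarrow> even_pt z"
    "even_pt z \<Longrightarrow> (z0 + scale \<alpha> z, d) \<in> E \<and> (z0 + scale \<alpha> z + d, turn \<alpha> d) \<in> E"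
    "\<not> even_pt z \<Longrightarrow> (z0 + scale \<alpha> z, turn \<alpha> d) \<in> E \<and> (z0 + scale \<alpha> z + turn \<alpha> d, d) \<in> E"
proof -
  obtain k where k: "track b (0, d0) k = (z, d)"
    using assms by (auto simp: E'_def)
  have par: "even_pt z \<longleftrightarrow> even k" "para d0 d \<longleftrightarrow> even k"
    using track_parity[OF d0, of b 0 k] k by auto
  show "d \<in> dirs" using track_dirs[of "(0, d0)" b k] k d0 by simp
  show "para d0 d \<longleftrightarrow> even_pt z" using par by simp
  have e: "track a (z0, d0) (2 * k) \<in> E" "track a (z0, d0) (2 * k + 1) \<in> E"
    by (auto simp: E_def simp del: track.simps)
  note t = turn_cancel[OF alpha, of d]
  show "(z0 + scale \<alpha> z, d) \<in> E \<and> (z0 + scale \<alpha> z + d, turn \<alpha> d) \<in> E" if "even_pt z"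
    using e that par unfolding track_odd_time track_even_time by (simp add: k)
  show "(z0 + scale \<alpha> z, turn \<alpha> d) \<in> E \<and> (z0 + scale \<alpha> z + turn \<alpha> d, d) \<in> E" if "\<not> even_pt z"
    using e that par unfolding track_odd_time track_even_time by (simp add: k t)
qed

lemma full_scale:
  assumes "full E' z"
  shows "full E (z0 + scale \<alpha> z)"
  unfolding full_def
proof
  fix d :: "int \<times> int" assume d: "d \<in> dirs"
  show "(z0 + scale \<alpha> z, d) \<in> E \<or> (z0 + scale \<alpha> z + d, - d) \<in> E"
  proof (cases "even_pt z")
    case True
    have 1: "(z, d) \<in> E' \<or> (z + d, - d) \<in> E'"
      using assms d by (auto simp: full_def)
    have 2: "\<not> even_pt (z + d)" using True d by (simp add: even_pt_add_dir)
    have 3: "z0 + scale \<alpha> (z + d) + turn \<alpha> (- d) = z0 + scale \<alpha> z + d"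
      by (simp add: scale_def turn_add turn_uminus)
    show ?thesis
      using 1
    proof
      assume "(z, d) \<in> E'"
      then show ?thesis using in_E'D(3) True by blast
    next
      assume "(z + d, - d) \<in> E'"
      then show ?thesis using in_E'D(4)[of "z + d" "- d"] 2 3 by metis
    qed
  next
    case False
    \<comment> \<open>At an odd point the first side over an outgoing edge \<open>e\<close> is
      \<open>turn \<alpha> e\<close>; this \<open>e\<close> makes it equal to
      \<open>d\<close>.\<close>
    define e where "e = turn (- \<alpha>) d"
    have e: "e \<in> dirs" using d by (simp add: e_def turn_dirs)
    have te: "turn \<alpha> e = d"
      using turn_cancel'[OF alpha] by (simp add: e_def)
    have 1: "(z, e) \<in> E' \<or> (z + e, - e) \<in> E'"
      using assms e by (auto simp: full_def)
    have 2: "even_pt (z + e)" using False e by (simp add: even_pt_add_dir)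
    have 3: "z0 + scale \<alpha> (z + e) + - e = z0 + scale \<alpha> z + d" "turn \<alpha> (- e) = - d"
      by (simp_all add: scale_def turn_add turn_uminus te)
    show ?thesis
      using 1
    proof
      assume "(z, e) \<in> E'"
      then show ?thesis using in_E'D(4) False te by metis
    next
      assume "(z + e, - e) \<in> E'"
      then show ?thesis using in_E'D(3)[of "z + e" "- e"] 2 3 by metis
    qed
  qed
qed

lemma scale_inj: "scale \<alpha> z = scale \<alpha> z' \<Longrightarrow> z = z'"
  using alpha by (cases z; cases z') (auto simp: scale_def turn_def rot_def)

text \<open>Injectivity of \<open>scale \<alpha>\<close> recovers the vertex of the derived path,
  whose parity is that of \<open>k\<close>. The place of an edge thus fixes the sign of the
  alternating turn at its end, whichever passage of the path is meant.\<close>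

lemma E_even_pt:
  assumes "(z0 + scale \<alpha> z, d) \<in> E"
  shows "\<exists>k. (z0 + scale \<alpha> z, d) = track a (z0, d0) (2 * k) \<and> (even k \<longleftrightarrow> even_pt z)"
proof -
  obtain n where n: "track a (z0, d0) n = (z0 + scale \<alpha> z, d)"
    using assms by (auto simp: E_def)
  have "even_pt (scale \<alpha> z)"
    using alpha by (cases z) (auto simp: even_pt_def scale_def turn_def rot_def)
  then have "even n"
    using track_parity[OF d0, of a z0 n] n by simp
  then obtain k where k: "n = 2 * k" by blast
  have "scale \<alpha> (fst (track b (0, d0) k)) = scale \<alpha> z"
    using n unfolding k track_even_time by simp
  then have "fst (track b (0, d0) k) = z" by (rule scale_inj)
  then show ?thesis
    using n k track_parity[OF d0, of b 0 k] by (intro exI[of _ k]) auto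
qed

text \<open>The counterpart for an arriving edge. Its endpoint comes from vertex
  \<open>k + 1\<close> of the derived path, hence the negated parity.\<close>

lemma E_odd_pt:
  assumes "(w, d) \<in> E" and w: "w + d = z0 + scale \<alpha> z"
  shows "\<exists>k d'. (w - d', d') = track a (z0, d0) (2 * k) \<and> (even k \<longleftrightarrow> \<not> even_pt z) \<and>
    d = turn (\<alpha> * (-1) ^ k) d'"
proof -
  obtain n where n: "track a (z0, d0) n = (w, d)"
    using assms by (auto simp: E_def)
  have "d \<in> dirs" using track_dirs[of "(z0, d0)" a n] n d0 by simp
  moreover have "even_pt (w + d - z0)"
    using alpha unfolding w by (cases z) (auto simp: even_pt_def scale_def turn_def rot_def)
  ultimately have "\<not> even_pt (w - z0)"
    using even_pt_add_dir[of d "w - z0"] by (simp add: algebra_simps)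
  then have "odd n"
    using track_parity[OF d0, of a z0 n] n by simp
  then obtain k where k: "n = 2 * k + 1" by (elim oddE)
  obtain v d' where v: "track a (z0, d0) (2 * k) = (v, d')" by (metis surj_pair)
  have wd: "w = v + d'" "d = turn (\<alpha> * (-1) ^ k) d'"
    using n unfolding k track_odd_time v by simp_all
  have "fst (track a (z0, d0) (2 * Suc k)) = w + d"
    using n unfolding k by simp
  then have "scale \<alpha> (fst (track b (0, d0) (Suc k))) = scale \<alpha> z"
    unfolding track_even_time w by simp
  then have "fst (track b (0, d0) (Suc k)) = z" by (rule scale_inj)
  then have "even (Suc k) \<longleftrightarrow> even_pt z"
    using track_parity[OF d0, of b 0 "Suc k"] by simp
  then show ?thesis
    using v wd by (intro exI[of _ k] exI[of _ d']) auto
qed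

lemma dirs_cases:
  assumes "d \<in> dirs" "e \<in> dirs" "t \<in> {1, -1}"
  shows "d \<in> {e, - e, turn t e, - turn t e}"
proof -
  have "d = (1, 0) \<or> d = (0, 1) \<or> d = (-1, 0) \<or> d = (0, -1)"
    "e = (1, 0) \<or> e = (0, 1) \<or> e = (-1, 0) \<or> e = (0, -1)"
    using assms by (simp_all add: dirs_def)
  then show ?thesis
    using assms(3) by (elim disjE; simp add: turn_def rot_def)
qed

text \<open>The two strands of the path through \<open>w\<close> turn the same way, because the parities
  of \<open>z\<close> and \<open>z'\<close> determine the sign of the alternating turn at \<open>w\<close>.\<close>

lemma full_between:
  assumes e: "e \<in> dirs"
    and z: "w + e = z0 + scale \<alpha> z" "full E (w + e)"
    and z': "w - e = z0 + scale \<alpha> z'" "full E (w - e)"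
  shows "full E w"
proof -
  \<comment> \<open>The points \<open>w + e\<close> and \<open>w - e\<close> differ by
    \<open>2e\<close>, and \<open>2e / (1 + \<alpha>i) = (1 - \<alpha>i) e\<close> is an even
    point.\<close>
  have par: "even_pt z \<longleftrightarrow> even_pt z'"
  proof -
    have "scale \<alpha> z - scale \<alpha> z' = (w + e - z0) - (w - e - z0)"
      unfolding z(1) z'(1) by simp
    also have "\<dots> = e + e" by (simp add: algebra_simps)
    finally have "fst (scale \<alpha> z) - fst (scale \<alpha> z') = 2 * fst e"
      by (metis fst_add fst_diff mult_2)
    then have "(fst z + snd z) - (fst z' + snd z') = 2 * fst e \<or>
        (fst z + snd z) - (fst z' + snd z') = 2 * (fst e + snd z - snd z')"
      using alpha by (auto simp: scale_def turn_def rot_def)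
    then show ?thesis
      unfolding even_pt_def by presburger
  qed
  have sgn: "\<alpha> * (-1) ^ k \<in> {1, -1}" for k :: nat
    using alpha by (cases "even k") auto
  have sgn_eq: "(-1::int) ^ k = (-1) ^ k'" if "even k \<longleftrightarrow> even k'" for k k' :: nat
    using that by (cases "even k") auto
  have e1: "(w + e, - e) \<in> E \<or> (w, e) \<in> E"
    using z(2) uminus_dirs[OF e] by (force simp: full_def)
  have e2: "(w - e, e) \<in> E \<or> (w, - e) \<in> E"
    using z'(2) e by (force simp: full_def)
  have para: "para d0 d \<longleftrightarrow> even_pt (v - z0)" if "(v, d) \<in> E" for v d
    using that track_parity[OF d0, of a z0] by (auto simp: E_def) (metis fst_conv snd_conv)+
  have ev: "even_pt (w + e - z0)" "even_pt (w - e - z0)"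
    using alpha unfolding z(1) z'(1)
    by (auto simp: even_pt_def scale_def turn_def rot_def)
  then have od: "\<not> even_pt (w - z0)"
    using even_pt_add_dir[OF e, of "w - z0"] by (simp add: algebra_simps)
  have para_uminus: "para d0 (- e) = para d0 e"
    by (auto simp: para_def minus_equation_iff[of e])
  show ?thesis
  \<comment> \<open>Edges leaving \<open>w\<close> occur at odd times and are not parallel to
    \<open>d0\<close>. So the two known edges at \<open>w\<close> both arrive if \<open>e\<close> is
    parallel to \<open>d0\<close>, and both leave otherwise; the missing two are their successors or
    predecessors.\<close>
  proof (cases "para d0 e")
    case True
    then have in1: "(w + e, - e) \<in> E" and in2: "(w - e, e) \<in> E"
      using e1 e2 para[of w e] para[of w "- e"] od para_uminus by auto
    obtain k where k: "track a (z0, d0) (2 * k) = (w + e, - e)" "even k \<longleftrightarrow> even_pt z"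
      using E_even_pt[of z "- e"] in1 unfolding z(1) by metis
    obtain k' where k': "track a (z0, d0) (2 * k') = (w - e, e)" "even k' \<longleftrightarrow> even_pt z'"
      using E_even_pt[of z' e] in2 unfolding z'(1) by metis
    define t where "t = \<alpha> * (-1) ^ k"
    have t': "t = \<alpha> * (-1) ^ k'"
      using sgn_eq[of k k'] k(2) k'(2) par by (simp add: t_def)
    have "track a (z0, d0) (2 * k + 1) = (w, - turn t e)"
      unfolding track_odd_time k(1) by (simp add: t_def turn_def rot_def)
    moreover have "track a (z0, d0) (2 * k' + 1) = (w, turn t e)"
      unfolding track_odd_time k'(1) by (simp add: t')
    ultimately have out: "(w, turn t e) \<in> E" "(w, - turn t e) \<in> E"
      unfolding E_def by (metis rangeI)+
    show ?thesis
      unfolding full_def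
      using dirs_cases[OF _ e, of _ t] sgn[of k] out in1 in2 unfolding t_def by fastforce
  next
    case False
    then have out: "(w, e) \<in> E" "(w, - e) \<in> E"
      using e1 e2 para[of "w + e" "- e"] para[of "w - e" e] ev para_uminus by auto
    obtain k d where k: "(w - d, d) = track a (z0, d0) (2 * k)" "even k \<longleftrightarrow> \<not> even_pt z"
      "e = turn (\<alpha> * (-1) ^ k) d"
      using E_odd_pt[of w e z] out z(1) by blast
    obtain k' d' where k': "(w - d', d') = track a (z0, d0) (2 * k')" "even k' \<longleftrightarrow> \<not> even_pt z'"
      "- e = turn (\<alpha> * (-1) ^ k') d'"
      using E_odd_pt[of w "- e" z'] out z'(1) by auto
    define t where "t = \<alpha> * (-1) ^ k"
    have t': "t = \<alpha> * (-1) ^ k'"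
      using sgn_eq[of k k'] k(2) k'(2) par by (simp add: t_def)
    have "turn t d' = - turn t d" by (metis k(3) k'(3) t' t_def)
    then have d': "d' = - d"
      by (cases d; cases d') (auto simp: turn_def rot_def split: if_splits)
    have ins: "(w - d, d) \<in> E" "(w + d, - d) \<in> E"
      using k(1) k'(1) unfolding E_def d' by auto
    have dd: "d \<in> dirs"
      using track_dirs[of "(z0, d0)" a "2 * k"] d0 by (simp flip: k(1))
    show ?thesis
      unfolding full_def
      using dirs_cases[OF _ dd, of _ t] sgn[of k] out ins k(3) unfolding t_def by fastforce
  qed
qed

end

section \<open>Folding curves fill large discs\<close>

definition full_diamond :: "((int \<times> int) \<times> (int \<times> int)) set \<Rightarrow> int \<times> int \<Rightarrow> int \<Rightarrow> bool" where
  "full_diamond E p r \<longleftrightarrow> (\<forall>z. \<bar>fst z - fst p\<bar> + \<bar>snd z - snd p\<bar> \<le> r \<longrightarrow> full E z)"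

definition full_box :: "((int \<times> int) \<times> (int \<times> int)) set \<Rightarrow> int \<times> int \<Rightarrow> int \<Rightarrow> bool" where
  "full_box E p r \<longleftrightarrow> (\<forall>z. \<bar>fst z - fst p\<bar> \<le> r \<and> \<bar>snd z - snd p\<bar> \<le> r \<longrightarrow> full E z)"

lemma full_mono: "full E z \<Longrightarrow> E \<subseteq> E' \<Longrightarrow> full E' z"
  unfolding full_def by blast

lemma even_pt_scale:
  assumes "\<alpha> \<in> {1, -1}" "even_pt u"
  obtains v where "u = scale \<alpha> v"
proof -
  obtain k where k: "fst u + snd u = 2 * k" using assms(2) unfolding even_pt_def by (elim evenE)
  show ?thesis
  proof (cases "\<alpha> = 1")
    case True
    then show ?thesis using k that[of "(k, k - fst u)"]
      by (auto simp: scale_def turn_def rot_def prod_eq_iff)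
  next
    case False
    then show ?thesis using k assms(1) that[of "(fst u - k, k)"]
      by (auto simp: scale_def turn_def rot_def prod_eq_iff)
  qed
qed

context derived_track
begin

text \<open>Multiplication by \<open>1 + \<alpha>i\<close> maps the l1 ball of radius
  \<open>r\<close> onto the points of the sup ball whose difference from the centre is even. At
  every other point of the box the coordinate distances have different parities, so one is below
  \<open>r\<close> and both neighbours in that direction lie in the box; \<open>full_between\<close>
  then applies.\<close>

lemma box_scale:
  assumes "full_diamond E' p r"
  shows "full_box E (z0 + scale \<alpha> p) r"
proof -
  let ?q = "z0 + scale \<alpha> p"
  have ev: "full E z \<and> (\<exists>v. z = z0 + scale \<alpha> v)"
    if z: "\<bar>fst z - fst ?q\<bar> \<le> r" "\<bar>snd z - snd ?q\<bar> \<le> r" "even_pt (z - z0)" for z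
  proof -
    obtain v where v: "z - z0 = scale \<alpha> v" using even_pt_scale[OF alpha z(3)] .
    then have zv: "z = z0 + scale \<alpha> v" by (metis add_diff_cancel_left' diff_add_cancel add.commute)
    have "\<bar>fst v - fst p\<bar> + \<bar>snd v - snd p\<bar> \<le> r"
      using z(1,2) alpha unfolding zv by (auto simp: scale_def turn_def rot_def)
    then show ?thesis using assms full_scale zv unfolding full_diamond_def by blast
  qed
  show ?thesis
    unfolding full_box_def
  proof (intro allI impI, elim conjE)
    fix z assume z: "\<bar>fst z - fst ?q\<bar> \<le> r" "\<bar>snd z - snd ?q\<bar> \<le> r"
    show "full E z"
    proof (cases "even_pt (z - z0)")
      case True
      then show ?thesis using ev z by blast
    next
      case False
      have "even_pt (scale \<alpha> p)"
        using alpha by (auto simp: even_pt_def scale_def turn_def rot_def)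
      then have "\<bar>fst z - fst ?q\<bar> \<noteq> \<bar>snd z - snd ?q\<bar>"
        using False unfolding even_pt_def fst_add snd_add fst_diff snd_diff by presburger
      then consider "\<bar>fst z - fst ?q\<bar> < r" | "\<bar>snd z - snd ?q\<bar> < r" using z by linarith
      then obtain e where e: "e \<in> dirs"
        "\<bar>fst (z + e) - fst ?q\<bar> \<le> r" "\<bar>snd (z + e) - snd ?q\<bar> \<le> r"
        "\<bar>fst (z - e) - fst ?q\<bar> \<le> r" "\<bar>snd (z - e) - snd ?q\<bar> \<le> r"
      proof cases
        case 1
        show ?thesis by (rule that[of "(1, 0)"]) (use 1 z in \<open>auto simp: dirs_def\<close>)
      next
        case 2
        show ?thesis by (rule that[of "(0, 1)"]) (use 2 z in \<open>auto simp: dirs_def\<close>)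
      qed
      have "z + e - z0 = (z - z0) + e" "z - e - z0 = (z - z0) + - e" by (simp_all add: algebra_simps)
      then have "even_pt (z + e - z0)" "even_pt (z - e - z0)"
        using False by (simp_all only: even_pt_add_dir[OF e(1)] even_pt_add_dir[OF uminus_dirs[OF e(1)]]) simp_all
      then show ?thesis
        using ev[of "z + e"] ev[of "z - e"] e full_between[OF e(1)] by blast
    qed
  qed
qed

text \<open>Here \<open>|x - y| + |x + y| = 2 max(|x|, |y|)\<close> turns the sup ball of radius
  \<open>r\<close> into the even points of the l1 ball of radius \<open>2r\<close>.\<close>

lemma diamond_scale:
  assumes "full_box E' p r"
  shows "full_diamond E (z0 + scale \<alpha> p) (2 * r)"
proof -
  let ?q = "z0 + scale \<alpha> p"
  have ev: "full E z \<and> (\<exists>v. z = z0 + scale \<alpha> v)"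
    if z: "\<bar>fst z - fst ?q\<bar> + \<bar>snd z - snd ?q\<bar> \<le> 2 * r" "even_pt (z - z0)" for z
  proof -
    obtain v where v: "z - z0 = scale \<alpha> v" using even_pt_scale[OF alpha z(2)] .
    then have zv: "z = z0 + scale \<alpha> v" by (metis add_diff_cancel_left' diff_add_cancel add.commute)
    have "\<bar>fst v - fst p\<bar> \<le> r \<and> \<bar>snd v - snd p\<bar> \<le> r"
      using z(1) alpha unfolding zv by (auto simp: scale_def turn_def rot_def)
    then show ?thesis using assms full_scale zv unfolding full_box_def by blast
  qed
  show ?thesis
    unfolding full_diamond_def
  proof (intro allI impI)
    fix z assume z: "\<bar>fst z - fst ?q\<bar> + \<bar>snd z - snd ?q\<bar> \<le> 2 * r"
    show "full E z"
    proof (cases "even_pt (z - z0)")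
      case True
      then show ?thesis using ev z by blast
    next
      case False
      have "even_pt (scale \<alpha> p)"
        using alpha by (auto simp: even_pt_def scale_def turn_def rot_def)
      then have "\<bar>fst z - fst ?q\<bar> + \<bar>snd z - snd ?q\<bar> \<noteq> 2 * r"
        using False unfolding even_pt_def fst_add snd_add fst_diff snd_diff by presburger
      then have less: "\<bar>fst z - fst ?q\<bar> + \<bar>snd z - snd ?q\<bar> < 2 * r" using z by linarith
      \<comment> \<open>A point of the odd class has odd l1 distance from the centre, hence distance
        below \<open>2 * r\<close>, and any direction would do.\<close>
      define e :: "int \<times> int" where "e = (1, 0)"
      have e: "e \<in> dirs"
        "\<bar>fst (z + e) - fst ?q\<bar> + \<bar>snd (z + e) - snd ?q\<bar> \<le> 2 * r"
        "\<bar>fst (z - e) - fst ?q\<bar> + \<bar>snd (z - e) - snd ?q\<bar> \<le> 2 * r"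
        using less by (auto simp: dirs_def e_def)
      have "z + e - z0 = (z - z0) + e" "z - e - z0 = (z - z0) + - e" by (simp_all add: algebra_simps)
      then have "even_pt (z + e - z0)" "even_pt (z - e - z0)"
        using False by (simp_all only: even_pt_add_dir[OF e(1)] even_pt_add_dir[OF uminus_dirs[OF e(1)]]) simp_all
      then show ?thesis
        using ev[of "z + e"] ev[of "z - e"] e full_between[OF e(1)] by blast
    qed
  qed
qed

end

lemma folds_derived_track:
  assumes "folds a" "snd s \<in> dirs"
  obtains q \<alpha> b z0 d0 where "derived_track (\<lambda>k. a (q + k)) b \<alpha> d0"
    "track a s q = (z0, d0)" "folds b" "d0 \<in> dirs"
proof -
  obtain q \<alpha> where q: "q \<in> {0, 1}" "\<alpha> \<in> {1, -1}" "\<forall>k. a (q + 2 * k) = \<alpha> * (-1) ^ k"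
    and b: "folds (\<lambda>k. a (q + 2 * k + 1))"
    using folds_derive[OF assms(1)] by blast
  obtain z0 d0 where t: "track a s q = (z0, d0)" by (metis surj_pair)
  have d0: "d0 \<in> dirs" using track_dirs[OF assms(2), of a q] t by simp
  have "derived_track (\<lambda>k. a (q + k)) (\<lambda>k. a (q + 2 * k + 1)) \<alpha> d0"
    using q d0 folds_range[OF b] by unfold_locales (auto simp: add.assoc)
  then show ?thesis using that t b d0 by blast
qed

lemma range_track_shift:
  "range (track (\<lambda>k. a (q + k)) (track a s q)) \<subseteq> range (track a s)"
  by (auto simp: track_shift)

lemma folds_box:
  assumes "\<And>b d. folds b \<Longrightarrow> d \<in> dirs \<Longrightarrow> \<exists>p. full_diamond (range (track b (0, d))) p r"
    and "folds a" "snd s \<in> dirs"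
  shows "\<exists>p. full_box (range (track a s)) p r"
proof -
  obtain q \<alpha> b z0 d0 where dt: "derived_track (\<lambda>k. a (q + k)) b \<alpha> d0"
    and t: "track a s q = (z0, d0)" and b: "folds b" "d0 \<in> dirs"
    by (rule folds_derived_track[OF assms(2,3)])
  interpret derived_track "\<lambda>k. a (q + k)" b \<alpha> z0 d0 by (rule dt)
  obtain p where "full_diamond E' p r" using assms(1)[OF b] unfolding E'_def by blast
  then have "full_box E (z0 + scale \<alpha> p) r" by (rule box_scale)
  moreover have "E \<subseteq> range (track a s)"
    unfolding E_def t[symmetric] by (rule range_track_shift)
  ultimately show ?thesis unfolding full_box_def using full_mono by blast
qed

lemma folds_diamond_double:
  assumes "\<And>b d. folds b \<Longrightarrow> d \<in> dirs \<Longrightarrow> \<exists>p. full_box (range (track b (0, d))) p r"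
    and "folds a" "snd s \<in> dirs"
  shows "\<exists>p. full_diamond (range (track a s)) p (2 * r)"
proof -
  obtain q \<alpha> b z0 d0 where dt: "derived_track (\<lambda>k. a (q + k)) b \<alpha> d0"
    and t: "track a s q = (z0, d0)" and b: "folds b" "d0 \<in> dirs"
    by (rule folds_derived_track[OF assms(2,3)])
  interpret derived_track "\<lambda>k. a (q + k)" b \<alpha> z0 d0 by (rule dt)
  obtain p where "full_box E' p r" using assms(1)[OF b] unfolding E'_def by blast
  then have "full_diamond E (z0 + scale \<alpha> p) (2 * r)" by (rule diamond_scale)
  moreover have "E \<subseteq> range (track a s)"
    unfolding E_def t[symmetric] by (rule range_track_shift)
  ultimately show ?thesis unfolding full_diamond_def using full_mono by blast
qed

section \<open>Explicit folding words and the first filled diamond\<close>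

text \<open>The inverse of derivation: alternating terms, beginning with \<open>\<alpha>\<close>,
  are put before, between and after the terms of the list.\<close>

primrec zig :: "int \<Rightarrow> int list \<Rightarrow> int list" where
  "zig \<alpha> [] = [\<alpha>]"
| "zig \<alpha> (x # xs) = \<alpha> # x # zig (- \<alpha>) xs"

lemma length_zig: "length (zig \<alpha> xs) = 2 * length xs + 1"
  by (induction xs arbitrary: \<alpha>) auto

lemma nth_zig:
  "k \<le> length xs \<Longrightarrow> zig \<alpha> xs ! (2 * k) = \<alpha> * (-1) ^ k"
  "k < length xs \<Longrightarrow> zig \<alpha> xs ! (2 * k + 1) = xs ! k"
proof (induction xs arbitrary: \<alpha> k)
  case (Cons x xs)
  { case 1 then show ?case using Cons.IH(1)[of "k - 1" "- \<alpha>"] by (cases k) auto }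
  { case 2 then show ?case using Cons.IH(2)[of "k - 1" "- \<alpha>"] by (cases k) auto }
qed auto

lemma minus_one_power_square: "(-1::int) ^ n * (-1) ^ n = 1"
  by (simp flip: power_mult_distrib)

lemma zig_append: "zig \<alpha> (xs @ e # ys) = zig \<alpha> xs @ e # zig (\<alpha> * (-1) ^ (length xs + 1)) ys"
  by (induction xs arbitrary: \<alpha>) auto

lemma seq_bar_zig: "seq_bar (zig \<alpha> xs) = zig (\<alpha> * (-1) ^ (length xs + 1)) (seq_bar xs)"
proof (induction xs arbitrary: \<alpha>)
  case Nil
  then show ?case by (simp add: seq_bar_def)
next
  case (Cons x xs)
  have "seq_bar (zig \<alpha> (x # xs)) = seq_bar (zig (- \<alpha>) xs) @ [- x, - \<alpha>]"
    by (simp add: seq_bar_def)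
  also have "\<dots> = zig (\<alpha> * (-1) ^ length xs) (seq_bar xs) @ [- x, - \<alpha>]"
    unfolding Cons.IH by simp
  also have "\<dots> = zig (\<alpha> * (-1) ^ length xs) (seq_bar xs @ - x # [])"
    unfolding zig_append by (simp add: seq_bar_def mult.assoc minus_one_power_square)
  also have "seq_bar xs @ - x # [] = seq_bar (x # xs)" by (simp add: seq_bar_def)
  finally show ?case by simp
qed

lemma folding_seq_zig:
  assumes "folding_seq n T" "\<alpha> \<in> {1, -1}"
  shows "folding_seq (Suc n) (zig \<alpha> T)"
  using assms
proof (induction arbitrary: \<alpha> rule: folding_seq.induct)
  case folding_seq_0
  then show ?case using folding_seq_Suc[OF folding_seq.folding_seq_0, of \<alpha>] by (simp add: seq_bar_def)
next
  case (folding_seq_Suc n S e)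
  \<comment> \<open>The sign with which the alternation resumes after \<open>seq_bar S\<close> and
    \<open>e\<close>; with it \<open>zig \<alpha>\<close> of the whole word is again of the form
    \<open>seq_bar _ @ [e] @ _\<close>.\<close>
  define \<beta> where "\<beta> = \<alpha> * (-1) ^ (length S + 1)"
  have \<beta>: "\<beta> \<in> {1, -1}" using folding_seq_Suc.prems by (cases "even (length S)") (auto simp: \<beta>_def)
  have "seq_bar (zig \<beta> S) = zig \<alpha> (seq_bar S)"
    unfolding seq_bar_zig \<beta>_def by (simp add: mult.assoc minus_one_power_square)
  then have "zig \<alpha> (seq_bar S @ [e] @ S) = seq_bar (zig \<beta> S) @ [e] @ zig \<beta> S"
    using zig_append[of \<alpha> "seq_bar S" e S] by (simp add: \<beta>_def seq_bar_def)
  then show ?case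
    using folding_seq.folding_seq_Suc[OF folding_seq_Suc.IH[OF \<beta>] folding_seq_Suc.hyps(2)] by simp
qed

text \<open>By definition prefixes of \<open>a\<close> are only factors of folding words of unknown
  order. Deriving \<open>m\<close> times and refolding an empty block with \<open>zig\<close>
  produces a complete word of order \<open>m\<close>, so that only finitely many words have to be
  examined.\<close>

lemma folds_block:
  assumes "folds a"
  shows "\<exists>j w. folding_seq m w \<and> (\<forall>i<length w. a (j + i) = w ! i)"
  using assms
proof (induction m arbitrary: a)
  case 0
  show ?case by (intro exI[of _ 0] exI[of _ "[]"]) (auto intro: folding_seq.intros)
next
  case (Suc m)
  obtain q \<alpha> where \<alpha>: "\<alpha> \<in> {1, -1}" and ev: "\<And>k. a (q + 2 * k) = \<alpha> * (-1) ^ k"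
    and b: "folds (\<lambda>k. a (q + 2 * k + 1))"
    using folds_derive[OF Suc.prems] by blast
  obtain j w where w: "folding_seq m w"
    and od: "\<And>i. i < length w \<Longrightarrow> a (q + 2 * (j + i) + 1) = w ! i"
    using Suc.IH[OF b] by blast
  define \<beta> where "\<beta> = \<alpha> * (-1) ^ j"
  have \<beta>: "\<beta> \<in> {1, -1}" using \<alpha> by (cases "even j") (auto simp: \<beta>_def)
  have "a (q + 2 * j + i) = zig \<beta> w ! i" if i: "i < length (zig \<beta> w)" for i
  proof (cases "even i")
    case True
    then obtain k where k: "i = 2 * k" by blast
    have "a (q + 2 * (j + k)) = \<beta> * (-1) ^ k" unfolding ev \<beta>_def by (simp add: power_add)
    then show ?thesis using i k nth_zig(1)[of k w \<beta>] by (simp add: length_zig algebra_simps)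
  next
    case False
    then obtain k where k: "i = 2 * k + 1" by (elim oddE)
    then show ?thesis using i nth_zig(2)[of k w \<beta>] od[of k] by (simp add: length_zig algebra_simps)
  qed
  then show ?case using folding_seq_zig[OF w \<beta>] by blast
qed

text \<open>Lists of fold directions parametrize the folding sequences of a given order, which makes
  them enumerable by \<open>List.n_lists\<close>.\<close>

primrec fold_word :: "bool list \<Rightarrow> int list" where
  "fold_word [] = []"
| "fold_word (e # es) = seq_bar (fold_word es) @ [if e then 1 else -1] @ fold_word es"

lemma folding_seq_fold_word:
  "folding_seq n w \<Longrightarrow> \<exists>es. length es = n \<and> w = fold_word es"
proof (induction rule: folding_seq.induct)
  case (folding_seq_Suc n S e)
  then obtain es where "length es = n" "S = fold_word es" by blast
  then show ?case
    using folding_seq_Suc.hyps(2) by (intro exI[of _ "(e = 1) # es"]) auto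
qed simp

lemma seq_bar_seq_bar: "seq_bar (seq_bar w) = w"
  by (simp add: seq_bar_def rev_map comp_def)

lemma seq_bar_append: "seq_bar (u @ v) = seq_bar v @ seq_bar u"
  by (simp add: seq_bar_def)

lemma length_seq_bar: "length (seq_bar w) = length w"
  by (simp add: seq_bar_def)

type_synonym edge = "(int \<times> int) \<times> (int \<times> int)"

text \<open>\<open>travel es s (X, R)\<close> follows, from the edge \<open>X\<close>, the path turning according to
  \<open>fold_word es\<close> (\<open>seq_bar\<close> of it if not \<open>s\<close>) and deletes the edges traversed near the origin from the
  list \<open>R\<close>. Branching is by pattern matching since \<open>code_simp\<close> would simplify both branches of
  a conditional.\<close>

fun keep :: "bool \<Rightarrow> edge \<Rightarrow> edge list \<Rightarrow> edge list" where
  "keep True e L = e # L"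
| "keep False e L = L"

primrec delete :: "edge \<Rightarrow> edge list \<Rightarrow> edge list" where
  "delete q [] = []"
| "delete q (e # L) = keep (e \<noteq> q) e (delete q L)"

fun delete_if :: "bool \<Rightarrow> edge \<Rightarrow> edge list \<Rightarrow> edge list" where
  "delete_if True e L = delete e L"
| "delete_if False e L = L"

fun advance :: "edge \<Rightarrow> edge list \<Rightarrow> edge \<times> edge list" where
  "advance ((x, y), (u, v)) R = (((x + u, y + v), (u, v)),
     delete_if (x \<le> 2 \<and> - 2 \<le> x \<and> y \<le> 2 \<and> - 2 \<le> y) ((x, y), (u, v)) R)"

fun turn_edge :: "bool \<Rightarrow> edge \<times> edge list \<Rightarrow> edge \<times> edge list" where
  "turn_edge True (((x, y), (u, v)), R) = (((x, y), (- v, u)), R)"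
| "turn_edge False (((x, y), (u, v)), R) = (((x, y), (v, - u)), R)"

fun travel :: "bool list \<Rightarrow> bool \<Rightarrow> edge \<times> edge list \<Rightarrow> edge \<times> edge list" where
  "travel [] s (X, R) = advance X R"
| "travel (e # es) s Y = travel es True (turn_edge (s = e) (travel es False Y))"

lemma set_delete: "set L \<subseteq> insert q (set (delete q L))"
proof (induction L)
  case (Cons e L)
  then show ?case by (cases "e = q") auto
qed simp

lemma set_delete_if: "set L \<subseteq> insert q (set (delete_if b q L))"
  using set_delete[of L q] by (cases b) auto

text \<open>A word with \<open>l\<close> letters is a path with \<open>l + 1\<close> edges, and the
  final state has passed its last edge without turning. Only an inclusion is claimed: edges outside
  the window are never deleted, which can only make the check harder to pass.\<close>

lemma travel_sound:
  assumes w: "w = (if s then fold_word es else seq_bar (fold_word es))"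
    and a: "\<And>i. i < length w \<Longrightarrow> a i = w ! i"
  shows "\<exists>R'. travel es s (X, R) =
      ((fst (track a X (length w)) + snd (track a X (length w)), snd (track a X (length w))), R') \<and>
    set R \<subseteq> set R' \<union> range (track a X)"
  using a unfolding w
proof (induction es arbitrary: s a X R)
  case Nil
  obtain x y u v where X: "X = ((x, y), (u, v))" by (metis surj_pair)
  have "X \<in> range (track a X)" by (metis rangeI track.simps(1))
  then show ?case
    using set_delete_if[of R X "x \<le> 2 \<and> - 2 \<le> x \<and> y \<le> 2 \<and> - 2 \<le> y"]
    by (auto simp: X seq_bar_def)
next
  case (Cons e es)
  define l where "l = length (fold_word es)"
  have len: "length (if s then fold_word (e # es) else seq_bar (fold_word (e # es))) = l + Suc l"
    by (simp add: l_def length_seq_bar)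
  \<comment> \<open>\<open>seq_bar\<close> of \<open>seq_bar S @ [e] @ S\<close> is
    \<open>seq_bar S @ [- e] @ S\<close>: only the middle sign changes, so both values of
    \<open>s\<close> share one recursion.\<close>
  have word: "(if s then fold_word (e # es) else seq_bar (fold_word (e # es))) =
      seq_bar (fold_word es) @ (if s = e then 1 else -1) # fold_word es"
    by (simp add: seq_bar_append seq_bar_seq_bar) (simp add: seq_bar_def)
  have nth: "a i = (seq_bar (fold_word es) @ (if s = e then 1 else -1) # fold_word es) ! i"
    if "i < l + Suc l" for i
    using Cons.prems[of i] that unfolding len unfolding word .
  have a1: "a i = (if False then fold_word es else seq_bar (fold_word es)) ! i"
    if "i < length (if False then fold_word es else seq_bar (fold_word es))" for i
    using nth[of i] that by (simp add: nth_append length_seq_bar l_def)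
  have a2: "a l = (if s = e then 1 else -1)"
    using nth[of l] by (simp add: nth_append length_seq_bar l_def)
  have a3: "a (Suc l + i) = (if True then fold_word es else seq_bar (fold_word es)) ! i"
    if "i < length (if True then fold_word es else seq_bar (fold_word es))" for i
    using nth[of "Suc l + i"] that by (simp add: nth_append length_seq_bar l_def)
  obtain R1 where R1: "travel es False (X, R) =
      ((fst (track a X l) + snd (track a X l), snd (track a X l)), R1)"
    "set R \<subseteq> set R1 \<union> range (track a X)"
    using Cons.IH[of False a X R, OF a1] by (auto simp: length_seq_bar l_def)
  have turn: "turn_edge (s = e) (travel es False (X, R)) = (track a X (Suc l), R1)"
    unfolding R1 by (cases "s = e"; cases "track a X l") (auto simp: a2 turn_def rot_def)
  obtain R2 where R2: "travel es True (track a X (Suc l), R1) =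
      ((fst (track a X (Suc l + l)) + snd (track a X (Suc l + l)), snd (track a X (Suc l + l))), R2)"
    "set R1 \<subseteq> set R2 \<union> range (track (\<lambda>i. a (Suc l + i)) (track a X (Suc l)))"
    using Cons.IH[of True "\<lambda>i. a (Suc l + i)" "track a X (Suc l)" R1, OF a3]
    unfolding track_shift by (auto simp: l_def simp del: track.simps)
  have "set R \<subseteq> set R2 \<union> range (track a X)"
    using R1(2) R2(2) range_track_shift[of a "Suc l" X] by blast
  moreover have "travel (e # es) s (X, R) =
      ((fst (track a X (l + Suc l)) + snd (track a X (l + Suc l)), snd (track a X (l + Suc l))), R2)"
    unfolding travel.simps turn R2(1) by (simp only: add.commute[of "Suc l"])
  ultimately show ?case unfolding len by blast
qed

text \<open>The edges at the origin and at its neighbours, oriented so that the edges leaving the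
  origin are horizontal if \<open>b\<close> and vertical otherwise.\<close>

definition star_edges :: "bool \<Rightarrow> edge list" where
  "star_edges b = (if b
    then [((0,0),1,0), ((0,0),-1,0), ((0,1),0,-1), ((0,-1),0,1),
      ((1,0),0,1), ((1,0),0,-1), ((2,0),-1,0), ((-1,0),0,1), ((-1,0),0,-1), ((-2,0),1,0),
      ((1,1),-1,0), ((-1,1),1,0), ((0,1),0,1), ((1,-1),-1,0), ((-1,-1),1,0), ((0,-1),0,-1)]
    else [((0,0),0,1), ((0,0),0,-1), ((1,0),-1,0), ((-1,0),1,0),
      ((0,1),1,0), ((0,1),-1,0), ((0,2),0,-1), ((0,-1),1,0), ((0,-1),-1,0), ((0,-2),0,1),
      ((1,1),0,-1), ((1,-1),0,1), ((1,0),1,0), ((-1,1),0,-1), ((-1,-1),0,1), ((-1,0),-1,0)])"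

lemma diamond_1I:
  assumes "full E p" "\<And>d. d \<in> dirs \<Longrightarrow> full E (p + d)"
  shows "full_diamond E p 1"
  unfolding full_diamond_def
proof (intro allI impI)
  fix z assume z: "\<bar>fst z - fst p\<bar> + \<bar>snd z - snd p\<bar> \<le> 1"
  show "full E z"
  proof (cases "z = p")
    case False
    then have "fst z - fst p = 0 \<and> \<bar>snd z - snd p\<bar> = 1 \<or> \<bar>fst z - fst p\<bar> = 1 \<and> snd z - snd p = 0"
      using z by (auto simp: prod_eq_iff)
    then have "z - p \<in> dirs" by (cases "z - p") (auto simp: dirs_def prod_eq_iff abs_if split: if_splits)
    then show ?thesis using assms(2)[of "z - p"] by simp
  qed (use assms in simp)
qed

lemma full_star_edges:
  assumes "set (star_edges b) \<subseteq> E"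
  shows "full E (0, 0)" "d \<in> dirs \<Longrightarrow> full E d"
  using assms by (cases b; auto simp: star_edges_def full_def dirs_def)+

text \<open>The path starts at \<open>-p\<close> with a horizontal edge, so that the star with
  centre \<open>p\<close> relative to the start sits at the origin. Edges are horizontal at even
  times, hence the origin is left horizontally exactly if \<open>x + y\<close> is even.\<close>

definition has_star :: "bool list \<Rightarrow> int \<times> int \<Rightarrow> bool" where
  "has_star es p = (case p of (x, y) \<Rightarrow>
     snd (travel es True (((- x, - y), (1, 0)), star_edges (even (x + y)))) = [])"

text \<open>The second list was found by computer: it contains, for each word, the centre of a star
  covered by the path.\<close>

lemma fold_words_have_star:
  "list_all2 has_star (List.n_lists 7 [True, False])
    [(-2, 6), (2, 6), (-6, 2), (-9, 4), (-6, -2), (-6, -2), (-2, -2), (-2, -2), (-2, -2),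
     (-2, -2), (2, -6), (-2, -6), (2, -9), (2, -6), (6, 2), (6, -2), (-6, -2), (-6, 2),
     (-2, -6), (-4, -9), (2, -6), (2, -6), (2, -3), (2, -3), (2, -2), (2, -2), (6, 2),
     (6, -2), (8, 4), (6, 2), (-2, 6), (2, 6), (-6, -2), (-6, 2), (4, -6), (-4, -10),
     (2, -6), (2, -6), (2, -3), (2, -3), (2, -3), (2, -3), (2, 0), (6, -2), (2, 0),
     (2, 0), (2, 0), (2, 0), (2, 0), (2, 0), (2, 0), (2, 0), (8, 4), (2, 0),
     (2, 4), (2, 4), (2, 4), (4, -6), (-2, 4), (4, 6), (-2, 4), (-2, 4), (-4, 2),
     (-4, 2), (-4, -2), (-4, -2), (4, -6), (-4, -9), (4, -6), (4, -6), (4, 6), (8, -2),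
     (2, -3), (2, -3), (2, 0), (9, -3), (2, 0), (2, 0), (2, 0), (2, 0), (2, 0),
     (2, 0), (2, 0), (2, 0), (6, 2), (2, 0), (2, 2), (2, 2), (2, 2), (2, 2),
     (-2, 6), (2, 6), (-2, 4), (-2, 6), (-6, -2), (-6, 2), (2, -6), (-2, -6), (6, -2),
     (9, -3), (6, 2), (6, 2), (2, 2), (2, 2), (2, 2), (2, 2), (-2, 6), (2, 6),
     (-5, 8), (-2, 6), (-6, -2), (-6, 2), (6, 2), (6, -2), (2, 6), (3, 8), (-2, 6),
     (-2, 6), (-2, 2), (-2, 2), (-2, 2), (-2, 2), (-6, -2), (-6, 2), (-9, -3), (-6, -2),
     (2, -6), (-2, -6)]"
  by code_simp

text \<open>Complex multiplication. For \<open>d\<close> in \<open>dirs\<close> it is a rotation,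
  which carries the computed paths, all starting in direction \<open>(1, 0)\<close>, to paths
  starting in direction \<open>d\<close>.\<close>

definition cmul :: "int \<times> int \<Rightarrow> int \<times> int \<Rightarrow> int \<times> int" where
  "cmul d z = (fst d * fst z - snd d * snd z, fst d * snd z + snd d * fst z)"

lemma cmul_add: "cmul d (y + z) = cmul d y + cmul d z"
  by (simp add: cmul_def prod_eq_iff algebra_simps)

lemma cmul_uminus: "cmul d (- z) = - cmul d z"
  by (simp add: cmul_def prod_eq_iff)

lemma cmul_turn: "cmul d (turn a z) = turn a (cmul d z)"
  by (simp add: cmul_def turn_def rot_def prod_eq_iff)

lemma track_cmul:
  "track a (z0 + cmul d0 z, cmul d0 d) k =
    (z0 + cmul d0 (fst (track a (z, d) k)), cmul d0 (snd (track a (z, d) k)))"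
  by (induction k) (simp_all add: cmul_add cmul_turn add.assoc)

lemma full_cmul:
  assumes d0: "d0 \<in> dirs" and "full E z"
    and E: "\<And>z d. (z, d) \<in> E \<Longrightarrow> (z0 + cmul d0 z, cmul d0 d) \<in> E2"
  shows "full E2 (z0 + cmul d0 z)"
  unfolding full_def
proof
  fix d :: "int \<times> int" assume "d \<in> dirs"
  moreover have "d0 = (1, 0) \<or> d0 = (0, 1) \<or> d0 = (-1, 0) \<or> d0 = (0, -1)"
    using d0 by (simp add: dirs_def)
  ultimately obtain e where e: "e \<in> dirs" "d = cmul d0 e"
    by (elim disjE; force simp: dirs_def cmul_def)
  then have "(z, e) \<in> E \<or> (z + e, - e) \<in> E" using assms(2) by (auto simp: full_def)
  then show "(z0 + cmul d0 z, d) \<in> E2 \<or> (z0 + cmul d0 z + d, - d) \<in> E2"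
    using E[of z e] E[of "z + e" "- e"] e(2) by (auto simp: cmul_add cmul_uminus add.assoc)
qed

lemma folds_diamond_1:
  assumes "folds a" "snd s \<in> dirs"
  shows "\<exists>p. full_diamond (range (track a s)) p 1"
proof -
  obtain j w where w: "folding_seq 7 w" "\<forall>i<length w. a (j + i) = w ! i"
    using folds_block[OF assms(1), of 7] by blast
  obtain es where es: "length es = 7" "w = fold_word es"
    using folding_seq_fold_word[OF w(1)] by blast
  have "es \<in> set (List.n_lists 7 [True, False])"
    using es(1) by (simp add: set_n_lists) blast
  then obtain c where c: "has_star es c"
    using fold_words_have_star unfolding list_all2_conv_all_nth in_set_conv_nth by metis
  define b where "b = even (fst c + snd c)"
  define a' where "a' = (\<lambda>i. a (j + i))"
  define X :: edge where "X = (- c, (1, 0))"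
  define E where "E = range (track a' X)"
  have "snd (travel es True (X, star_edges b)) = []"
    using c by (cases c) (simp add: has_star_def X_def b_def)
  then have star: "set (star_edges b) \<subseteq> E"
    using travel_sound[of w True es a' X "star_edges b"] w(2) es(2)
    by (auto simp: a'_def E_def)
  obtain p d0 where t: "track a s j = (p, d0)" by (metis surj_pair)
  have d0: "d0 \<in> dirs" using track_dirs[OF assms(2), of a j] t by simp
  \<comment> \<open>The motion taking \<open>z\<close> to \<open>z0 + cmul d0 z\<close> sends the
    start \<open>-c\<close> of the computed path to \<open>p\<close>, and the centre of its star to
    \<open>z0\<close>.\<close>
  define z0 where "z0 = p + cmul d0 c"
  have start: "(z0 + cmul d0 (fst X), cmul d0 (snd X)) = (p, d0)"
    by (simp add: z0_def X_def cmul_uminus) (simp add: cmul_def)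
  have E2: "(z0 + cmul d0 z, cmul d0 d) \<in> range (track a s)" if zd: "(z, d) \<in> E" for z d
  proof -
    obtain k where "track a' X k = (z, d)" using zd by (auto simp: E_def)
    then have "track a' (p, d0) k = (z0 + cmul d0 z, cmul d0 d)"
      using track_cmul[of a' z0 d0 "fst X" "snd X" k] unfolding start by simp
    then have "(z0 + cmul d0 z, cmul d0 d) \<in> range (track a' (p, d0))" by (metis rangeI)
    then show ?thesis using range_track_shift[of a j s] unfolding a'_def t by blast
  qed
  have "full_diamond (range (track a s)) z0 1"
  proof (rule diamond_1I)
    show "full (range (track a s)) z0"
      using full_cmul[OF d0 full_star_edges(1)[OF star] E2] by (simp add: cmul_def flip: zero_prod_def)
    fix d :: "int \<times> int" assume d: "d \<in> dirs"
    have "d0 = (1, 0) \<or> d0 = (0, 1) \<or> d0 = (-1, 0) \<or> d0 = (0, -1)"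
      using d0 by (simp add: dirs_def)
    then obtain e where e: "e \<in> dirs" "d = cmul d0 e"
      using d by (elim disjE; force simp: dirs_def cmul_def)
    show "full (range (track a s)) (z0 + d)"
      using full_cmul[OF d0 full_star_edges(2)[OF star e(1)] E2] by (simp add: e(2))
  qed
  then show ?thesis by blast
qed

text \<open>A diamond of radius 1 yields a box of radius 1; from then on two derivations lead from a
  box of radius \<open>r\<close> through a diamond of radius \<open>2r\<close> to a box of radius
  \<open>2r\<close>.\<close>

lemma folds_box_power: "folds a \<Longrightarrow> snd s \<in> dirs \<Longrightarrow> \<exists>p. full_box (range (track a s)) p (2 ^ n)"
proof (induction n arbitrary: a s)
  case 0
  show ?case
    unfolding power_0 by (rule folds_box[OF folds_diamond_1 0]) simp_all
next
  case (Suc n)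
  show ?case
    unfolding power_Suc
    by (rule folds_box[OF folds_diamond_double[OF Suc.IH] Suc.prems]) simp_all
qed

lemma folds_shift:
  assumes "folds a"
  shows "folds (\<lambda>k. a (q + k))"
  unfolding folds_def
proof
  fix l
  obtain n S where S: "folding_seq n S" "sublist (map a [0..<q + l]) S"
    using assms unfolding folds_def by blast
  have "map (\<lambda>k. a (q + k)) [0..<l] = drop q (map a [0..<q + l])"
    by (rule nth_equalityI) auto
  then show "\<exists>n S. folding_seq n S \<and> sublist (map (\<lambda>k. a (q + k)) [0..<l]) S"
    using S by (metis sublist_drop sublist_order.order_trans)
qed

lemma folds_visits:
  assumes "folds a" "snd s \<in> dirs"
  shows "\<exists>p. \<forall>z. \<bar>fst z - fst p\<bar> \<le> r \<and> \<bar>snd z - snd p\<bar> \<le> r \<longrightarrow>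
    (\<exists>k. fst (track a s (Suc k)) = z)"
proof -
  \<comment> \<open>The first edge is skipped because the path makes no turn at its starting point;
    every point found must be one where a term of the sequence is read.\<close>
  define s' where "s' = track a s 1"
  have s': "snd s' \<in> dirs" unfolding s'_def using track_dirs[OF assms(2)] .
  define n where "n = nat r"
  have n: "r \<le> 2 ^ n"
  proof -
    have "n < 2 ^ n" by simp
    then have "int n < 2 ^ n" by (metis of_nat_less_iff of_nat_numeral of_nat_power)
    moreover have "r \<le> int n" by (simp add: n_def)
    ultimately show ?thesis by linarith
  qed
  obtain p where p: "full_box (range (track (\<lambda>k. a (1 + k)) s')) p (2 ^ n)"
    using folds_box_power[OF folds_shift[OF assms(1)] s'] by blast
  have "\<exists>k. fst (track a s (Suc k)) = z"
    if z: "\<bar>fst z - fst p\<bar> \<le> r \<and> \<bar>snd z - snd p\<bar> \<le> r" for z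
  proof -
    have "full (range (track (\<lambda>k. a (1 + k)) s')) z"
      using p order_trans[OF _ n] z unfolding full_box_def by blast
    then have "(z, (1, 0)) \<in> range (track (\<lambda>k. a (1 + k)) s') \<or>
        (z + (1, 0), - (1, 0)) \<in> range (track (\<lambda>k. a (1 + k)) s')"
      unfolding full_def dirs_def by blast
    then obtain k where "track a s (1 + k) = (z, (1, 0)) \<or> track a s (1 + k) = (z + (1, 0), - (1, 0))"
      unfolding s'_def track_shift by (metis imageE)
    then have "fst (track a s (Suc k)) = z \<or> fst (track a s (Suc (Suc k))) = z"
    proof
      assume "track a s (1 + k) = (z + (1, 0), - (1, 0))"
      then have "fst (track a s (Suc (Suc k))) = z" unfolding track.simps(2)[of a s "Suc k"] by (simp flip: zero_prod_def)
      then show ?thesis ..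
    qed simp
    then show ?thesis by blast
  qed
  then show ?thesis by blast
qed

section \<open>Turning functions\<close>

text \<open>A covering is encoded by the function \<open>\<sigma>\<close> giving the common turn at each lattice point of the
  two strands through it.\<close>

primrec walk :: "(int \<times> int \<Rightarrow> int) \<Rightarrow> edge \<Rightarrow> nat \<Rightarrow> edge" where
  "walk \<sigma> s 0 = s"
| "walk \<sigma> s (Suc k) = (let z = fst (walk \<sigma> s k) + snd (walk \<sigma> s k) in
     (z, turn (\<sigma> z) (snd (walk \<sigma> s k))))"

definition turns :: "(int \<times> int \<Rightarrow> int) \<Rightarrow> edge \<Rightarrow> nat \<Rightarrow> int" where
  "turns \<sigma> s k = \<sigma> (fst (walk \<sigma> s (Suc k)))"

text \<open>The orientation convention: even points are left horizontally, odd points vertically.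
  Each lattice edge is valid in exactly one of its two directions.\<close>

definition valid :: "edge \<Rightarrow> bool" where
  "valid s \<longleftrightarrow> snd s \<in> dirs \<and> (even_pt (fst s) \<longleftrightarrow> snd (snd s) = 0)"

definition folding_field :: "(int \<times> int \<Rightarrow> int) \<Rightarrow> bool" where
  "folding_field \<sigma> \<longleftrightarrow> (\<forall>s. valid s \<longrightarrow> folds (turns \<sigma> s))"

text \<open>What remains of the local isomorphism property for turning functions. The vectors
  \<open>v\<close> are even because only these respect the orientation of edges.\<close>

definition recurrent :: "(int \<times> int \<Rightarrow> int) \<Rightarrow> bool" where
  "recurrent \<sigma> \<longleftrightarrow> (\<forall>W. finite W \<longrightarrow> (\<exists>r. \<forall>z. \<exists>v. even_pt v \<and>
     \<bar>fst v - fst z\<bar> \<le> r \<and> \<bar>snd v - snd z\<bar> \<le> r \<and> (\<forall>w\<in>W. \<sigma> (w + v) = \<sigma> w)))"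

lemma walk_track: "walk \<sigma> s k = track (turns \<sigma> s) s k"
  by (induction k) (simp_all add: turns_def Let_def)

lemma valid_step:
  assumes "valid s"
  shows "valid (fst s + snd s, turn a (snd s))"
proof -
  obtain x y u v where s: "s = ((x, y), (u, v))" by (metis surj_pair)
  have "(u, v) = (1, 0) \<or> (u, v) = (0, 1) \<or> (u, v) = (-1, 0) \<or> (u, v) = (0, -1)"
    using assms by (simp add: valid_def s dirs_def)
  then show ?thesis
    using assms by (elim disjE) (auto simp: valid_def s turn_def rot_def dirs_def even_pt_def)
qed

lemma valid_walk: "valid s \<Longrightarrow> valid (walk \<sigma> s k)"
  by (induction k) (simp_all add: Let_def valid_step)

lemma even_pt_add: "even_pt (y + z) \<longleftrightarrow> (even_pt y \<longleftrightarrow> even_pt z)"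
  unfolding even_pt_def fst_add snd_add by presburger

text \<open>Two consecutive edges of a path are one horizontal and one vertical edge, so the first
  coordinate changes parity with every two steps. Alternation in time is therefore dependence on the
  parity of \<open>fst z\<close>.\<close>

definition alternating_on :: "bool \<Rightarrow> int \<Rightarrow> (int \<times> int \<Rightarrow> int) \<Rightarrow> bool" where
  "alternating_on e c \<sigma> \<longleftrightarrow>
     (\<forall>z. even_pt z = e \<longrightarrow> \<sigma> z = (if even (fst z) then c else - c))"

lemma alternating_onD:
  "alternating_on e c \<sigma> \<Longrightarrow> even_pt z = e \<Longrightarrow> \<sigma> z = (if even (fst z) then c else - c)"
  unfolding alternating_on_def by blast

lemma even_fst_two_steps:
  assumes "valid s"
  shows "even (fst (fst (walk \<sigma> s (Suc (Suc k))))) \<longleftrightarrow> odd (fst (fst (walk \<sigma> s k)))"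
proof -
  obtain x y u v where s: "walk \<sigma> s k = ((x, y), (u, v))" by (metis surj_pair)
  have "(u, v) = (1, 0) \<or> (u, v) = (0, 1) \<or> (u, v) = (-1, 0) \<or> (u, v) = (0, -1)"
    using valid_walk[OF assms, of \<sigma> k] by (simp add: valid_def s dirs_def)
  then show ?thesis
    by (elim disjE) (auto simp: s turn_def rot_def Let_def)
qed

lemma alternating_on_visited:
  assumes "folding_field \<sigma>" "valid s"
  shows "\<exists>e. \<exists>c\<in>{1, -1}. (\<exists>n. even_pt (fst (walk \<sigma> s (Suc n))) = e) \<and>
    (\<forall>n z. z = fst (walk \<sigma> s (Suc n)) \<longrightarrow> even_pt z = e \<longrightarrow>
      \<sigma> z = (if even (fst z) then c else - c))"
proof -
  have "folds (turns \<sigma> s)" using assms unfolding folding_field_def by blast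
  then obtain q \<alpha> where q: "q \<in> {0, 1}" "\<alpha> \<in> {1, -1}"
    and alt: "\<And>k. turns \<sigma> s (q + 2 * k) = \<alpha> * (-1) ^ k"
    using folds_derive by blast
  define pos where "pos n = fst (walk \<sigma> s n)" for n
  have par: "even_pt (pos n) \<longleftrightarrow> (even_pt (fst s) \<longleftrightarrow> even n)" for n
  proof (induction n)
    case (Suc n)
    have "pos (Suc n) = pos n + snd (walk \<sigma> s n)" by (simp add: pos_def Let_def)
    moreover have "snd (walk \<sigma> s n) \<in> dirs" using valid_walk[OF assms(2)] by (simp add: valid_def)
    ultimately show ?case using Suc by (auto simp: even_pt_add_dir)
  qed (simp add: pos_def)
  define e where "e = even_pt (pos (Suc q))"
  define c where "c = (if even (fst (pos (Suc q))) then \<alpha> else - \<alpha>)"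
  have x: "even (fst (pos (Suc (q + 2 * k)))) \<longleftrightarrow> (even (fst (pos (Suc q))) \<longleftrightarrow> even k)" for k
  proof (induction k)
    case (Suc k)
    have "Suc (q + 2 * Suc k) = Suc (Suc (Suc (q + 2 * k)))" by simp
    then show ?case
      using Suc even_fst_two_steps[OF assms(2), of \<sigma> "Suc (q + 2 * k)"] unfolding pos_def
      by (metis even_Suc)
  qed simp
  have "\<sigma> z = (if even (fst z) then c else - c)" if z: "z = pos (Suc n)" "even_pt z = e" for n z
  proof -
    have "even (Suc n) \<longleftrightarrow> even (Suc q)" using z par by (auto simp: e_def)
    moreover have "q = 0 \<or> q = 1" using q(1) by simp
    ultimately have "\<exists>k. n = q + 2 * k" by presburger
    then obtain k where k: "n = q + 2 * k" by blast
    have "\<sigma> z = \<alpha> * (-1) ^ k" using alt[of k] by (simp add: z k turns_def pos_def)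
    then show ?thesis using x[of k] by (auto simp: z k c_def)
  qed
  moreover have "c \<in> {1, -1}" using q(2) by (auto simp: c_def)
  ultimately show ?thesis unfolding pos_def e_def by blast
qed

text \<open>By recurrence every point has a copy in a disc filled by a single path.\<close>

lemma folding_field_alternating:
  assumes "folding_field \<sigma>" "recurrent \<sigma>"
  obtains e c where "c \<in> {1, -1}" "alternating_on e c \<sigma>"
proof -
  define s :: edge where "s = ((0, 0), (1, 0))"
  have s: "valid s" by (simp add: s_def valid_def dirs_def even_pt_def)
  then have "folds (turns \<sigma> s)" "snd s \<in> dirs"
    using assms(1) unfolding folding_field_def valid_def by blast+
  obtain e c n0 where c: "c \<in> {1, -1}"
    and n0: "even_pt (fst (walk \<sigma> s (Suc n0))) = e"
    and vis: "\<And>n z. z = fst (walk \<sigma> s (Suc n)) \<Longrightarrow> even_pt z = e \<Longrightarrow>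
      \<sigma> z = (if even (fst z) then c else - c)"
    using alternating_on_visited[OF assms(1) s] by blast
  define z0 where "z0 = fst (walk \<sigma> s (Suc n0))"
  have "\<sigma> z = (if even (fst z) then c else - c)" if z: "even_pt z = e" for z
  proof -
    \<comment> \<open>Recurrence does not control the parity of \<open>fst v\<close>. The visited
      point \<open>z0\<close> is moved along with \<open>z\<close>: the rule is known at both
      \<open>z0\<close> and \<open>z0 + v\<close>, and equality of the two turns forces
      \<open>fst v\<close> to be even.\<close>
    obtain r where r: "\<And>p. \<exists>v. even_pt v \<and> \<bar>fst v - fst p\<bar> \<le> r \<and> \<bar>snd v - snd p\<bar> \<le> r \<and>
        (\<forall>w\<in>{z, z0}. \<sigma> (w + v) = \<sigma> w)"
      using assms(2) unfolding recurrent_def by (meson finite.emptyI finite_insert)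
    define R where "R = r + \<bar>fst z\<bar> + \<bar>snd z\<bar> + \<bar>fst z0\<bar> + \<bar>snd z0\<bar>"
    obtain p where p: "\<And>y. \<bar>fst y - fst p\<bar> \<le> R \<and> \<bar>snd y - snd p\<bar> \<le> R \<Longrightarrow>
        \<exists>k. fst (walk \<sigma> s (Suc k)) = y"
      using folds_visits[OF \<open>folds (turns \<sigma> s)\<close> \<open>snd s \<in> dirs\<close>, of R]
      unfolding walk_track by blast
    obtain v where v: "even_pt v" "\<bar>fst v - fst p\<bar> \<le> r" "\<bar>snd v - snd p\<bar> \<le> r"
      "\<sigma> (z + v) = \<sigma> z" "\<sigma> (z0 + v) = \<sigma> z0"
      using r[of p] by blast
    have "\<exists>k. fst (walk \<sigma> s (Suc k)) = z + v" "\<exists>k. fst (walk \<sigma> s (Suc k)) = z0 + v"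
      using v(2,3) by (intro p; simp add: R_def; linarith)+
    moreover have "even_pt (z + v) = e" "even_pt (z0 + v) = e"
      using z n0 v(1) by (auto simp: even_pt_add z0_def)
    ultimately have "\<sigma> (z + v) = (if even (fst (z + v)) then c else - c)"
      "\<sigma> (z0 + v) = (if even (fst (z0 + v)) then c else - c)"
      using vis by metis+
    moreover have "\<sigma> z0 = (if even (fst z0) then c else - c)" using vis n0 z0_def by blast
    ultimately show ?thesis using v(4,5) c by (auto split: if_splits)
  qed
  then show ?thesis using that c unfolding alternating_on_def by blast
qed

text \<open>The terms at \<open>q\<close> and \<open>q + 2\<close> are opposite by derivation but
  equal by periodicity. This excludes a wrong offset when a field is derived.\<close>

lemma not_folds_period_two:
  assumes "folds b" "\<And>k. b (Suc (Suc k)) = b k"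
  shows False
proof -
  obtain q \<alpha> where "\<alpha> \<in> {1, -1}" "\<And>k. b (q + 2 * k) = \<alpha> * (-1) ^ k"
    using folds_derive[OF assms(1)] by blast
  from this(1) this(2)[of 0] this(2)[of 1] assms(2)[of q] show False by auto
qed

section \<open>The derived turning function\<close>

text \<open>The derived covering lives on the class not equal to \<open>e\<close>, with origin
  \<open>o0\<close>. The sign condition on \<open>o0\<close> arranges the alternation so that the
  factor is always \<open>1 + i\<close>, whatever \<open>c\<close> is.\<close>

locale alternating_field =
  fixes \<sigma> :: "int \<times> int \<Rightarrow> int" and e :: bool and c :: int and o0 :: "int \<times> int"
  assumes c: "c \<in> {1, -1}"
    and alternating: "alternating_on e c \<sigma>"
    and base: "even_pt o0 \<noteq> e" "(if even (fst o0) then c else - c) = -1"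
begin

definition \<sigma>' where "\<sigma>' z = \<sigma> (o0 + scale 1 z)"

text \<open>The first of the two edges that replace \<open>s\<close>. It starts at a point of the
  parity of \<open>o0\<close>, and the orientation convention then dictates which side over the
  diagonal it is.\<close>

definition embed :: "edge \<Rightarrow> edge" where
  "embed s = (o0 + scale 1 (fst s),
     if even_pt (fst s) = even_pt o0 then snd s else turn 1 (snd s))"

lemma even_pt_scale1: "even_pt (scale 1 z)"
  by (simp add: even_pt_def scale_def turn_def rot_def)

lemma valid_embed: "valid s \<Longrightarrow> valid (embed s)"
  using even_pt_scale1[of "fst s"]
  by (auto simp: valid_def embed_def even_pt_add turn_dirs) (auto simp: dirs_def turn_def rot_def)

lemma embed_mid:
  assumes "valid s"
  shows "\<sigma> (fst (embed s) + snd (embed s)) = (if even_pt (fst s) = even_pt o0 then 1 else - 1)"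
proof -
  obtain x y u v where s: "s = ((x, y), (u, v))" by (metis surj_pair)
  have v: "(u, v) = (1, 0) \<or> (u, v) = (0, 1) \<or> (u, v) = (-1, 0) \<or> (u, v) = (0, -1)"
    using assms by (simp add: valid_def s dirs_def)
  let ?w = "fst (embed s) + snd (embed s)"
  have "snd (embed s) \<in> dirs" using valid_embed[OF assms] by (simp add: valid_def)
  then have "even_pt ?w = e"
    using base(1) even_pt_scale1[of "fst s"]
    by (simp only: even_pt_add_dir) (auto simp: embed_def even_pt_add)
  then have "\<sigma> ?w = (if even (fst ?w) then c else - c)"
    by (rule alternating_onD[OF alternating])
  moreover have "even (fst ?w) \<longleftrightarrow> (even (fst o0) \<longleftrightarrow> (even_pt (fst s) \<noteq> even_pt o0))"
    using v assms unfolding embed_def s valid_def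
    by (elim disjE; cases "even_pt o0"; cases "even_pt (x, y)")
      (auto simp: scale_def turn_def rot_def even_pt_def)
  ultimately show ?thesis using base(2) c by (auto split: if_splits)
qed

lemma walk_embed:
  assumes "valid s"
  shows "walk \<sigma> (embed s) (2 * k) = embed (walk \<sigma>' s k)"
proof (induction k)
  case (Suc k)
  define t where "t = walk \<sigma>' s k"
  have t: "valid t" using valid_walk[OF assms] by (simp add: t_def)
  define z d where "z = fst t" and "d = snd t"
  have d: "d \<in> dirs" using t by (simp add: valid_def d_def)
  define w where "w = fst (embed t) + snd (embed t)"
  have "2 * Suc k = Suc (Suc (2 * k))" by simp
  then have "walk \<sigma> (embed s) (2 * Suc k) =
      (let d' = turn (\<sigma> w) (snd (embed t)) in (w + d', turn (\<sigma> (w + d')) d'))"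
    using Suc by (simp add: Let_def t_def w_def)
  moreover have "embed (walk \<sigma>' s (Suc k)) = embed (z + d, turn (\<sigma>' (z + d)) d)"
    by (simp add: Let_def t_def z_def d_def)
  moreover have "(let d' = turn (\<sigma> w) (snd (embed t)) in (w + d', turn (\<sigma> (w + d')) d')) =
      embed (z + d, turn (\<sigma>' (z + d)) d)"
  proof (cases "even_pt z = even_pt o0")
    case True
    then have "\<sigma> w = 1" using embed_mid[OF t] by (simp add: w_def z_def)
    moreover have "snd (embed t) = d" using True by (simp add: embed_def z_def d_def)
    moreover have "w + turn 1 d = o0 + scale 1 (z + d)"
      using True by (simp add: w_def embed_def z_def d_def scale_def turn_add add_ac)
    ultimately show ?thesis
      using True by (simp add: embed_def even_pt_add_dir[OF d] \<sigma>'_def turn_commute[of 1])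
  next
    case False
    then have "\<sigma> w = - 1" using embed_mid[OF t] by (simp add: w_def z_def)
    moreover have 1: "snd (embed t) = turn 1 d" using False by (simp add: embed_def z_def d_def)
    moreover have 2: "turn (- 1) (turn 1 d) = d" using turn_cancel[of 1 d] by simp
    moreover have "w + d = o0 + scale 1 (z + d)"
      using False by (simp add: w_def embed_def z_def d_def scale_def turn_add add_ac)
    ultimately show ?thesis
      using False by (simp add: embed_def even_pt_add_dir[OF d] \<sigma>'_def)
  qed
  ultimately show ?case by simp
qed simp

lemma folding_field_derived:
  assumes "folding_field \<sigma>"
  shows "folding_field \<sigma>'"
  unfolding folding_field_def
proof (intro allI impI)
  fix s assume s: "valid s"
  define a where "a = turns \<sigma> (embed s)"
  have a: "folds a" using assms valid_embed[OF s] unfolding a_def folding_field_def by blast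
  have odd: "a (2 * k + 1) = turns \<sigma>' s k" for k
  proof -
    have "a (2 * k + 1) = \<sigma> (fst (walk \<sigma> (embed s) (2 * Suc k)))" by (simp add: a_def turns_def)
    then show ?thesis unfolding walk_embed[OF s] by (simp add: embed_def turns_def \<sigma>'_def)
  qed
  have ev: "a (2 * k) = (if even_pt (fst (walk \<sigma>' s k)) = even_pt o0 then 1 else - 1)" for k
  proof -
    have "a (2 * k) = \<sigma> (fst (walk \<sigma> (embed s) (2 * k)) + snd (walk \<sigma> (embed s) (2 * k)))"
      by (simp add: a_def turns_def Let_def)
    then show ?thesis unfolding walk_embed[OF s] using embed_mid[OF valid_walk[OF s]] by simp
  qed
  have par: "even_pt (fst (walk \<sigma>' s (Suc k))) \<longleftrightarrow> \<not> even_pt (fst (walk \<sigma>' s k))" for k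
    using valid_walk[OF s, of \<sigma>' k] by (simp add: Let_def even_pt_add_dir valid_def)
  obtain q where q: "q \<in> {0, 1}" "folds (\<lambda>k. a (q + 2 * k + 1))"
    using folds_derive[OF a] by blast
  \<comment> \<open>With offset 1 the folding subsequence would consist of the terms of even index,
    but by \<open>ev\<close> and \<open>par\<close> these are alternately 1 and -1, hence of period
    two.\<close>
  have "q \<noteq> 1"
  proof
    assume "q = 1"
    define b where "b k = a (2 * Suc k)" for k
    have "folds b" using q(2) by (simp add: \<open>q = 1\<close> b_def[abs_def])
    moreover have "b (Suc (Suc k)) = b k" for k unfolding b_def ev par by simp
    ultimately show False by (rule not_folds_period_two)
  qed
  then show "folds (turns \<sigma>' s)" using q by (simp add: odd[simplified])
qed

lemma recurrent_derived:
  assumes "recurrent \<sigma>"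
  shows "recurrent \<sigma>'"
  unfolding recurrent_def
proof (intro allI impI)
  fix W :: "(int \<times> int) set" assume W: "finite W"
  \<comment> \<open>A point of the alternating class. Added to the pattern it forces
    \<open>fst v\<close> to be even, so that \<open>v\<close> is \<open>scale 1\<close> of an even
    point.\<close>
  define e0 :: "int \<times> int" where "e0 = (if e then (0, 0) else (1, 0))"
  have e0: "even_pt e0 = e" by (simp add: e0_def even_pt_def)
  have "finite (insert e0 ((\<lambda>z. o0 + scale 1 z) ` W))" using W by simp
  then obtain r where r: "\<And>z. \<exists>v. even_pt v \<and> \<bar>fst v - fst z\<bar> \<le> r \<and> \<bar>snd v - snd z\<bar> \<le> r \<and>
      (\<forall>w\<in>insert e0 ((\<lambda>z. o0 + scale 1 z) ` W). \<sigma> (w + v) = \<sigma> w)"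
    using assms unfolding recurrent_def by meson
  show "\<exists>r. \<forall>z. \<exists>v. even_pt v \<and> \<bar>fst v - fst z\<bar> \<le> r \<and> \<bar>snd v - snd z\<bar> \<le> r \<and>
      (\<forall>w\<in>W. \<sigma>' (w + v) = \<sigma>' w)"
  proof (intro exI[of _ r] allI)
    fix z
    \<comment> \<open>Division by \<open>1 + i\<close> does not increase the sup norm, so aiming at
      \<open>scale 1 z\<close> allows the same radius.\<close>
    obtain v where v: "even_pt v" "\<bar>fst v - fst (scale 1 z)\<bar> \<le> r" "\<bar>snd v - snd (scale 1 z)\<bar> \<le> r"
      and eq: "\<sigma> (e0 + v) = \<sigma> e0" "\<And>w. w \<in> W \<Longrightarrow> \<sigma> (o0 + scale 1 w + v) = \<sigma> (o0 + scale 1 w)"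
      using r[of "scale 1 z"] by blast
    have "even_pt (e0 + v) = e" using e0 v(1) by (auto simp: even_pt_add)
    then have "(if even (fst e0) then c else - c) = (if even (fst (e0 + v)) then c else - c)"
      using eq(1) e0 alternating unfolding alternating_on_def by metis
    then have "even (fst v)" using c by (auto split: if_splits)
    then have "even (snd v)" using v(1) by (simp add: even_pt_def)
    obtain v' where v': "v = scale 1 v'" using even_pt_scale[of 1 v] v(1) by auto
    then have f: "fst v = fst v' - snd v'" "snd v = snd v' + fst v'"
      by (simp_all add: scale_def turn_def rot_def)
    have "even_pt v'" using \<open>even (snd v)\<close> by (simp add: f even_pt_def add.commute)
    moreover have "\<bar>fst v' - fst z\<bar> \<le> r \<and> \<bar>snd v' - snd z\<bar> \<le> r"
      using v(2,3) unfolding f by (auto simp: scale_def turn_def rot_def)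
    moreover have "\<sigma>' (w + v') = \<sigma>' w" if "w \<in> W" for w
    proof -
      have "o0 + scale 1 (w + v') = o0 + scale 1 w + v"
        by (simp add: v' scale_def turn_add add_ac)
      then show ?thesis using eq(2)[OF that] by (simp only: \<sigma>'_def)
    qed
    ultimately show "\<exists>v. even_pt v \<and> \<bar>fst v - fst z\<bar> \<le> r \<and> \<bar>snd v - snd z\<bar> \<le> r \<and>
      (\<forall>w\<in>W. \<sigma>' (w + v) = \<sigma>' w)" by blast
  qed
qed

end

lemma folding_field_derive:
  assumes "folding_field \<sigma>" "recurrent \<sigma>"
  obtains e c o0 where "alternating_on e c \<sigma>" "even_pt o0 \<noteq> e"
    "folding_field (\<lambda>z. \<sigma> (o0 + scale 1 z))" "recurrent (\<lambda>z. \<sigma> (o0 + scale 1 z))"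
proof -
  obtain e c where c: "c \<in> {1, -1}" and alt: "alternating_on e c \<sigma>"
    using folding_field_alternating[OF assms] .
  define o0 :: "int \<times> int" where
    "o0 = (if e then if c = 1 then (1, 0) else (0, 1) else if c = 1 then (1, 1) else (0, 0))"
  interpret alternating_field \<sigma> e c o0
    using c alt by unfold_locales (auto simp: o0_def even_pt_def)
  have "\<sigma>' = (\<lambda>z. \<sigma> (o0 + scale 1 z))" by (simp add: \<sigma>'_def[abs_def])
  then show ?thesis
    using that alt base(1) folding_field_derived[OF assms(1)] recurrent_derived[OF assms(2)] by metis
qed

text \<open>Each induction step derives twice, since \<open>(1 + i)^2 = 2i\<close> brings the
  lattice back to an axis-parallel one of double mesh. The classes settled on the way have periods
  dividing 4, and for \<open>m = 0\<close> the claim is vacuous.\<close>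

lemma folding_field_limit_periodic:
  assumes "folding_field \<sigma>" "recurrent \<sigma>"
  shows "\<exists>u. \<forall>z. \<not> (2 ^ m dvd fst z - fst u \<and> 2 ^ m dvd snd z - snd u) \<longrightarrow>
    (\<forall>v. \<sigma> (fst z + 2 ^ Suc m * fst v, snd z + 2 ^ Suc m * snd v) = \<sigma> z)"
  using assms
proof (induction m arbitrary: \<sigma>)
  case (Suc m)
  obtain e1 c1 o1 where alt1: "alternating_on e1 c1 \<sigma>" and o1: "even_pt o1 \<noteq> e1"
    and 1: "folding_field (\<lambda>z. \<sigma> (o1 + scale 1 z))" "recurrent (\<lambda>z. \<sigma> (o1 + scale 1 z))"
    using folding_field_derive[OF Suc.prems] .
  define \<sigma>1 where "\<sigma>1 = (\<lambda>z. \<sigma> (o1 + scale 1 z))"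
  obtain e2 c2 o2 where alt2: "alternating_on e2 c2 \<sigma>1" and o2: "even_pt o2 \<noteq> e2"
    and 2: "folding_field (\<lambda>z. \<sigma>1 (o2 + scale 1 z))" "recurrent (\<lambda>z. \<sigma>1 (o2 + scale 1 z))"
    using folding_field_derive[OF 1[folded \<sigma>1_def]] .
  obtain u where u: "\<And>z v. \<not> (2 ^ m dvd fst z - fst u \<and> 2 ^ m dvd snd z - snd u) \<Longrightarrow>
      \<sigma>1 (o2 + scale 1 (fst z + 2 ^ Suc m * fst v, snd z + 2 ^ Suc m * snd v)) = \<sigma>1 (o2 + scale 1 z)"
    using Suc.IH[OF 2] by blast
  have decomp: "\<exists>z'. z = w + scale 1 z'" if "even_pt z = even_pt w" for z w
  proof -
    have "even_pt (z - w)" by (metis that diff_add_cancel even_pt_add)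
    then obtain z' where "z - w = scale 1 z'" using even_pt_scale[of 1 "z - w"] by auto
    then show ?thesis by (metis add.commute diff_add_cancel)
  qed
  have per: "\<tau> (fst z + 2 * p, snd z + 2 * q) = \<tau> z"
    if "alternating_on e c \<tau>" "even_pt z = e" for \<tau> e c z p q
    using alternating_onD[OF that] alternating_onD[OF that(1), of "(fst z + 2 * p, snd z + 2 * q)"] that(2)
    by (simp add: even_pt_def)
  define U where "U = o1 + scale 1 (o2 + scale 1 u)"
  show ?case
  proof (intro exI[of _ U] allI impI)
    fix z v
    assume z: "\<not> (2 ^ Suc m dvd fst z - fst U \<and> 2 ^ Suc m dvd snd z - snd U)"
    show "\<sigma> (fst z + 2 ^ Suc (Suc m) * fst v, snd z + 2 ^ Suc (Suc m) * snd v) = \<sigma> z"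
    proof (cases "even_pt z = e1")
      case True
      then show ?thesis
        using per[OF alt1, of z "2 ^ Suc m * fst v" "2 ^ Suc m * snd v"] by (simp add: mult.assoc)
    next
      case False
      then obtain z' where z': "z = o1 + scale 1 z'" using decomp o1 by blast
      have \<sigma>z: "\<sigma> z = \<sigma>1 z'" by (simp add: \<sigma>1_def z')
      \<comment> \<open>In derived coordinates the shift is divided by \<open>1 + i\<close>, that
        is, multiplied by \<open>(1 - i) / 2\<close>.\<close>
      have shift: "(fst z + 2 ^ Suc (Suc m) * fst v, snd z + 2 ^ Suc (Suc m) * snd v) =
          o1 + scale 1 (fst z' + 2 ^ Suc m * (fst v + snd v), snd z' + 2 ^ Suc m * (snd v - fst v))"
        by (simp add: z' scale_def turn_def rot_def prod_eq_iff algebra_simps)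
      show ?thesis
      proof (cases "even_pt z' = e2")
        case True
        then show ?thesis
          using per[OF alt2, of z' "2 ^ m * (fst v + snd v)" "2 ^ m * (snd v - fst v)"]
          unfolding shift \<sigma>z by (simp add: \<sigma>1_def mult.assoc)
      next
        case False
        then obtain z2 where z2: "z' = o2 + scale 1 z2" using decomp o2 by blast
        have "\<not> (2 ^ m dvd fst z2 - fst u \<and> 2 ^ m dvd snd z2 - snd u)"
        proof
          assume "2 ^ m dvd fst z2 - fst u \<and> 2 ^ m dvd snd z2 - snd u"
          then have "2 * 2 ^ m dvd 2 * (fst z2 - fst u)" "2 * 2 ^ m dvd 2 * (snd z2 - snd u)"
            by (blast intro: mult_dvd_mono dvd_refl)+
          moreover have "fst z - fst U = - (2 * (snd z2 - snd u))" "snd z - snd U = 2 * (fst z2 - fst u)"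
            by (simp_all add: z' z2 U_def scale_def turn_def rot_def)
          ultimately show False using z by (simp del: minus_diff_eq)
        qed
        \<comment> \<open>After two derivations the shift is divided by \<open>2i\<close>; the
          vector is \<open>v / i\<close>.\<close>
        from u[OF this, of "(snd v, - fst v)"]
        have "\<sigma>1 (o2 + scale 1 (fst z2 + 2 ^ Suc m * snd v, snd z2 - 2 ^ Suc m * fst v)) = \<sigma>1 z'"
          by (simp add: z2)
        moreover have "o2 + scale 1 (fst z2 + 2 ^ Suc m * snd v, snd z2 - 2 ^ Suc m * fst v) =
            (fst z' + 2 ^ Suc m * (fst v + snd v), snd z' + 2 ^ Suc m * (snd v - fst v))"
          by (simp add: z2 scale_def turn_def rot_def prod_eq_iff algebra_simps)
        ultimately show ?thesis unfolding shift \<sigma>z by (simp add: \<sigma>1_def)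
      qed
    qed
  qed
qed simp

section \<open>Densities of subsets of the square lattice\<close>

definition qbox :: "int \<Rightarrow> int \<Rightarrow> int \<Rightarrow> (int \<times> int) set" where
  "qbox x y L = {x..<x + L} \<times> {y..<y + L}"

definition periodic :: "int \<Rightarrow> (int \<times> int) set \<Rightarrow> bool" where
  "periodic M U \<longleftrightarrow> (\<forall>x y i j. (x + M * i, y + M * j) \<in> U \<longleftrightarrow> (x, y) \<in> U)"

text \<open>Density along boxes with integer corners and sides, uniformly in their position; real
  squares are handled separately by rounding.\<close>

definition uniform_density :: "(int \<times> int) set \<Rightarrow> real \<Rightarrow> bool" where
  "uniform_density V d \<longleftrightarrow> (\<forall>\<epsilon>>0. \<exists>K. \<forall>L\<ge>K. \<forall>x y.
     \<bar>real (card (V \<inter> qbox x y L)) - d * (real_of_int L)\<^sup>2\<bar> \<le> \<epsilon> * (real_of_int L)\<^sup>2)"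

lemma finite_qbox [simp]: "finite (qbox x y L)"
  by (simp add: qbox_def)

lemma card_qbox_mono: "U \<subseteq> V \<Longrightarrow> card (U \<inter> qbox x y L) \<le> card (V \<inter> qbox x y L)"
  by (intro card_mono) auto

lemma card_qbox_mono_size: "L \<le> L' \<Longrightarrow> card (V \<inter> qbox x y L) \<le> card (V \<inter> qbox x y L')"
  by (intro card_mono) (auto simp: qbox_def)

lemma card_qbox_tiles:
  assumes "M > 0"
  shows "card (V \<inter> qbox x y (int q * M)) =
    (\<Sum>i<q. \<Sum>j<q. card (V \<inter> qbox (x + int i * M) (y + int j * M) M))"
proof -
  let ?T = "\<lambda>p. V \<inter> qbox (x + int (fst p) * M) (y + int (snd p) * M) M"
  have div: "nat ((a - x) div M) < q \<and> x + int (nat ((a - x) div M)) * M \<le> a \<and>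
      a < x + int (nat ((a - x) div M)) * M + M"
    if a: "x \<le> a" "a < x + int q * M" for a x
  proof -
    have "0 \<le> (a - x) div M" using a assms by (simp add: pos_imp_zdiv_nonneg_iff)
    moreover have eq: "a - x = (a - x) div M * M + (a - x) mod M" by simp
    moreover have "(a - x) div M < int q"
    proof (rule ccontr)
      assume "\<not> ?thesis"
      then have "int q * M \<le> (a - x) div M * M" using assms by (intro mult_right_mono) auto
      moreover have "0 \<le> (a - x) mod M" using assms by simp
      ultimately show False using eq a(2) by linarith
    qed
    moreover have "0 \<le> (a - x) mod M" "(a - x) mod M < M" using assms by simp_all
    ultimately show ?thesis by (simp; linarith)
  qed
  have uniq: "i = i'" if "x + int i * M \<le> a" "a < x + int i * M + M"
    "x + int i' * M \<le> a" "a < x + int i' * M + M" for i i' :: nat and a x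
  proof -
    have "int i * M < (int i' + 1) * M" "int i' * M < (int i + 1) * M"
      using that by (simp_all add: distrib_right)
    then have "int i < int i' + 1" "int i' < int i + 1"
      using assms by (simp_all add: mult_less_cancel_right)
    then show ?thesis by simp
  qed
  have "V \<inter> qbox x y (int q * M) = (\<Union>p\<in>{..<q} \<times> {..<q}. ?T p)"
  proof (intro equalityI subsetI)
    fix z assume z: "z \<in> V \<inter> qbox x y (int q * M)"
    then have "z \<in> ?T (nat ((fst z - x) div M), nat ((snd z - y) div M))"
      using div[of x "fst z"] div[of y "snd z"] by (auto simp: qbox_def)
    moreover have "(nat ((fst z - x) div M), nat ((snd z - y) div M)) \<in> {..<q} \<times> {..<q}"
      using z div[of x "fst z"] div[of y "snd z"] by (auto simp: qbox_def)
    ultimately show "z \<in> (\<Union>p\<in>{..<q} \<times> {..<q}. ?T p)" by blast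
  next
    fix z assume "z \<in> (\<Union>p\<in>{..<q} \<times> {..<q}. ?T p)"
    then obtain i j where ij: "i < q" "j < q" "z \<in> ?T (i, j)" by auto
    have "(int i + 1) * M \<le> int q * M" "(int j + 1) * M \<le> int q * M"
      using ij assms by (intro mult_right_mono; simp)+
    then have le: "int i * M + M \<le> int q * M" "int j * M + M \<le> int q * M"
      by (simp_all only: distrib_right mult_1)
    have ge: "0 \<le> int i * M" "0 \<le> int j * M" using assms by simp_all
    have "x + int i * M \<le> fst z" "fst z < x + int i * M + M"
      "y + int j * M \<le> snd z" "snd z < y + int j * M + M" and V: "z \<in> V"
      using ij(3) by (auto simp: qbox_def)
    then have "x \<le> fst z" "fst z < x + int q * M" "y \<le> snd z" "snd z < y + int q * M"
      using le ge by linarith+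
    then show "z \<in> V \<inter> qbox x y (int q * M)"
      using V by (cases z) (simp add: qbox_def)
  qed
  moreover have "card (\<Union>p\<in>{..<q} \<times> {..<q}. ?T p) = (\<Sum>p\<in>{..<q} \<times> {..<q}. card (?T p))"
  proof (rule card_UN_disjoint)
    show "\<forall>p\<in>{..<q} \<times> {..<q}. \<forall>p'\<in>{..<q} \<times> {..<q}. p \<noteq> p' \<longrightarrow> ?T p \<inter> ?T p' = {}"
    proof (intro ballI impI, rule ccontr)
      fix p p' assume "p \<noteq> p'" "?T p \<inter> ?T p' \<noteq> {}"
      then obtain z where "z \<in> ?T p" "z \<in> ?T p'" by blast
      then have "fst p = fst p'" "snd p = snd p'"
        using uniq[of x "fst p" "fst z" "fst p'"] uniq[of y "snd p" "snd z" "snd p'"]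
        by (auto simp: qbox_def)
      then show False using \<open>p \<noteq> p'\<close> by (simp add: prod_eq_iff)
    qed
  qed auto
  ultimately show ?thesis by (simp add: sum.cartesian_product case_prod_beta)
qed

lemma periodic_mod:
  assumes "periodic M U"
  shows "(a mod M, b mod M) \<in> U \<longleftrightarrow> (a, b) \<in> U"
proof -
  have "(a mod M + M * (a div M), b mod M + M * (b div M)) \<in> U \<longleftrightarrow> (a mod M, b mod M) \<in> U"
    using assms unfolding periodic_def by blast
  then show ?thesis by simp
qed

lemma card_periodic_qbox:
  assumes "periodic M U" "M > 0"
  shows "card (U \<inter> qbox x y M) = card (U \<inter> qbox 0 0 M)"
proof (rule bij_betw_same_card)
  have mod: "x + (a - x) mod M \<in> {x..<x + M}" "(x + (a - x) mod M) mod M = a mod M" for a x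
    using assms(2) by (simp_all add: mod_simps)
  have inj: "a = b" if "a \<in> {x..<x + M}" "b \<in> {x..<x + M}" "a mod M = b mod M" for a b x
  proof -
    have "M dvd a - b" using that(3) by (simp add: mod_eq_dvd_iff)
    then have "M dvd b - a" by (simp add: dvd_diff_commute)
    have "\<not> a < b" using zdvd_imp_le[OF \<open>M dvd b - a\<close>] that(1,2) by auto
    moreover have "\<not> b < a" using zdvd_imp_le[OF \<open>M dvd a - b\<close>] that(1,2) by auto
    ultimately show ?thesis by simp
  qed
  show "bij_betw (\<lambda>z. (fst z mod M, snd z mod M)) (U \<inter> qbox x y M) (U \<inter> qbox 0 0 M)"
    unfolding bij_betw_def
  proof
    show "inj_on (\<lambda>z. (fst z mod M, snd z mod M)) (U \<inter> qbox x y M)"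
      by (rule inj_onI) (auto simp: qbox_def intro: inj[of _ x] inj[of _ y])
    show "(\<lambda>z. (fst z mod M, snd z mod M)) ` (U \<inter> qbox x y M) = U \<inter> qbox 0 0 M"
    proof (intro equalityI subsetI)
      fix z assume "z \<in> (\<lambda>z. (fst z mod M, snd z mod M)) ` (U \<inter> qbox x y M)"
      then show "z \<in> U \<inter> qbox 0 0 M"
        using assms periodic_mod[OF assms(1)] by (auto simp: qbox_def)
    next
      fix z assume z: "z \<in> U \<inter> qbox 0 0 M"
      define w where "w = (x + (fst z - x) mod M, y + (snd z - y) mod M)"
      have m: "fst w mod M = fst z" "snd w mod M = snd z"
        using z by (auto simp: w_def mod qbox_def)
      have "w \<in> qbox x y M" using mod(1) by (auto simp: w_def qbox_def)
      moreover have "w \<in> U"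
        using z periodic_mod[OF assms(1), of "fst w" "snd w"] by (simp add: m)
      ultimately show "z \<in> (\<lambda>z. (fst z mod M, snd z mod M)) ` (U \<inter> qbox x y M)"
        using m by (intro image_eqI[of _ _ w]) auto
    qed
  qed
qed

text \<open>A box of side \<open>L\<close> is squeezed between blocks of \<open>q * q\<close> and
  \<open>Suc q * Suc q\<close> periods, where \<open>q = L div M\<close>; these differ by an amount
  linear in \<open>L\<close>.\<close>

lemma uniform_density_periodic:
  assumes "periodic M U" "M > 0"
  shows "uniform_density U (real (card (U \<inter> qbox 0 0 M)) / (real_of_int M)\<^sup>2)"
  unfolding uniform_density_def
proof (intro allI impI)
  fix \<epsilon> :: real assume \<epsilon>: "\<epsilon> > 0"
  define c where "c = card (U \<inter> qbox 0 0 M)"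
  define m where "m = real_of_int M"
  have m: "m > 0" using assms(2) by (simp add: m_def)
  have "c \<le> card (qbox 0 0 M)" unfolding c_def by (intro card_mono) auto
  also have "\<dots> = nat M * nat M" by (simp add: qbox_def)
  finally have "real c \<le> real (nat M * nat M)" by (rule of_nat_mono)
  then have c: "real c \<le> m\<^sup>2" using assms(2) by (simp add: m_def power2_eq_square)
  have "card (U \<inter> qbox x y M) = c" for x y
    unfolding c_def by (rule card_periodic_qbox[OF assms])
  then have tiles: "card (U \<inter> qbox x y (int q * M)) = q * q * c" for x y q
    unfolding card_qbox_tiles[OF assms(2)] by simp
  \<comment> \<open>With \<open>t = l / m\<close> the error is at most
    \<open>(2 * t + 1) * c\<close>. The bound \<open>M\<close> gives \<open>t \<ge> 1\<close>, so
    this is at most \<open>3 * t * m^2 = 3 * m * l\<close>, and the other bound makes it at most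
    \<open>\<epsilon> * l^2\<close>.\<close>
  define K where "K = max M \<lceil>3 * m / \<epsilon>\<rceil>"
  show "\<exists>K. \<forall>L\<ge>K. \<forall>x y. \<bar>real (card (U \<inter> qbox x y L)) -
      real (card (U \<inter> qbox 0 0 M)) / (real_of_int M)\<^sup>2 * (real_of_int L)\<^sup>2\<bar> \<le> \<epsilon> * (real_of_int L)\<^sup>2"
  proof (intro exI[of _ K] allI impI)
    fix L x y assume L: "K \<le> L"
    define l where "l = real_of_int L"
    have LM: "M \<le> L" and "\<lceil>3 * m / \<epsilon>\<rceil> \<le> L" using L by (auto simp: K_def)
    then have "3 * m / \<epsilon> \<le> l" unfolding l_def by linarith
    then have l: "3 * m \<le> \<epsilon> * l" using \<epsilon> by (simp add: field_simps)
    have lm: "m \<le> l" using LM by (simp add: l_def m_def)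
    define q where "q = nat (L div M)"
    have q: "int q = L div M" using LM assms(2) by (simp add: q_def pos_imp_zdiv_nonneg_iff)
    have eq: "L = L div M * M + L mod M" by simp
    have md: "0 \<le> L mod M" "L mod M < M" using assms(2) by simp_all
    have b: "int q * M \<le> L" "L \<le> int (Suc q) * M"
      using eq md unfolding of_nat_Suc q distrib_right by linarith+
    have "real_of_int (int q * M) \<le> real_of_int L" "real_of_int L \<le> real_of_int (int (Suc q) * M)"
      using b by (simp_all only: of_int_le_iff)
    then have b': "real q * m \<le> l" "l \<le> (real q + 1) * m"
      by (simp_all add: l_def m_def distrib_right)
    define N where "N = real (card (U \<inter> qbox x y L))"
    have "q * q * c \<le> card (U \<inter> qbox x y L)" "card (U \<inter> qbox x y L) \<le> Suc q * Suc q * c"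
      unfolding tiles[of x y, symmetric] using b by (auto intro: card_qbox_mono_size)
    then have "real (q * q * c) \<le> N" "N \<le> real (Suc q * Suc q * c)"
      unfolding N_def by (simp_all only: of_nat_le_iff)
    then have N: "real q * real q * real c \<le> N" "N \<le> (real q + 1) * (real q + 1) * real c"
      by (simp_all add: algebra_simps)
    define t where "t = l / m"
    have t: "real q \<le> t" "t \<le> real q + 1" "1 \<le> t"
      using b' lm m by (simp_all add: t_def field_simps)
    have up: "N \<le> real c * t\<^sup>2 + (2 * t + 1) * real c"
    proof -
      have "(real q + 1) * (real q + 1) \<le> (t + 1) * (t + 1)" using t by (intro mult_mono) auto
      then have "N \<le> (t + 1) * (t + 1) * real c"
        using N(2) by (meson mult_right_mono of_nat_0_le_iff order_trans)
      then show ?thesis by (simp add: power2_eq_square algebra_simps)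
    qed
    have lo: "real c * t\<^sup>2 - (2 * t + 1) * real c \<le> N"
    proof -
      have "(t - 1) * (t - 1) \<le> real q * real q" using t by (intro mult_mono) auto
      then have "(t - 1) * (t - 1) * real c \<le> N"
        using N(1) by (meson mult_right_mono of_nat_0_le_iff order_trans)
      moreover have "real c * t\<^sup>2 - (2 * t + 1) * real c \<le> (t - 1) * (t - 1) * real c"
        by (simp add: power2_eq_square algebra_simps)
      ultimately show ?thesis by (rule order_trans[rotated])
    qed
    have "(2 * t + 1) * real c \<le> 3 * t * real c"
      using t by (intro mult_right_mono) auto
    also have "\<dots> \<le> 3 * t * m\<^sup>2"
      using t c by (intro mult_left_mono) auto
    also have "\<dots> = 3 * m * l" using m by (simp add: t_def power2_eq_square)
    also have "\<dots> \<le> \<epsilon> * l * l" using l lm m by (intro mult_right_mono) auto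
    finally have "\<bar>N - real c * t\<^sup>2\<bar> \<le> \<epsilon> * l * l"
      using up lo by (intro abs_leI) auto
    moreover have "real c * t\<^sup>2 = real c / m\<^sup>2 * l\<^sup>2" by (simp add: t_def power_divide)
    ultimately show "\<bar>real (card (U \<inter> qbox x y L)) -
      real (card (U \<inter> qbox 0 0 M)) / (real_of_int M)\<^sup>2 * (real_of_int L)\<^sup>2\<bar> \<le> \<epsilon> * (real_of_int L)\<^sup>2"
      by (simp add: N_def c_def l_def m_def power2_eq_square mult.assoc)
  qed
qed

lemma card_qbox_Un: "V \<subseteq> U \<union> P \<Longrightarrow>
  card (V \<inter> qbox x y L) \<le> card (U \<inter> qbox x y L) + card (P \<inter> qbox x y L)"
  by (rule order_trans[OF card_mono card_Un_le]) auto

text \<open>The densities \<open>u n\<close> of inner periodic approximations satisfy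
  \<open>u m \<le> u n + p n\<close> with \<open>p n\<close> tending to 0, so their supremum is
  within \<open>p n\<close> of each \<open>u n\<close> and is the density of
  \<open>V\<close>.\<close>

lemma uniform_density_limit_periodic:
  assumes "\<And>\<epsilon>::real. \<epsilon> > 0 \<Longrightarrow> \<exists>M U P. M > 0 \<and> periodic M U \<and> periodic M P \<and>
    U \<subseteq> V \<and> V \<subseteq> U \<union> P \<and> real (card (P \<inter> qbox 0 0 M)) \<le> \<epsilon> * (real_of_int M)\<^sup>2"
  shows "\<exists>d. uniform_density V d"
proof -
  have "\<exists>U P u p. U \<subseteq> V \<and> V \<subseteq> U \<union> P \<and> uniform_density U u \<and> uniform_density P p \<and> p \<le> 1 / Suc n"
    for n :: nat
  proof -
    obtain M U P where M: "M > 0" "periodic M U" "periodic M P" "U \<subseteq> V" "V \<subseteq> U \<union> P"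
      "real (card (P \<inter> qbox 0 0 M)) \<le> 1 / Suc n * (real_of_int M)\<^sup>2"
      using assms[of "1 / Suc n"] by auto
    have "real (card (P \<inter> qbox 0 0 M)) / (real_of_int M)\<^sup>2 \<le> 1 / Suc n"
      using M(1,6) by (simp add: pos_divide_le_eq)
    then show ?thesis
      using M(4,5) uniform_density_periodic[OF M(2,1)] uniform_density_periodic[OF M(3,1)] by blast
  qed
  then obtain U P u p where U: "\<And>n. U n \<subseteq> V" "\<And>n. V \<subseteq> U n \<union> P n"
    and u: "\<And>n. uniform_density (U n) (u n)" and p: "\<And>n. uniform_density (P n) (p n)"
    and p_le: "\<And>n::nat. p n \<le> 1 / Suc n"
    by metis
  have bounds: "\<exists>K>0. \<forall>L\<ge>K. \<forall>x y. (u n - \<epsilon>) * (real_of_int L)\<^sup>2 \<le> card (V \<inter> qbox x y L) \<and>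
      card (V \<inter> qbox x y L) \<le> (u n + p n + \<epsilon>) * (real_of_int L)\<^sup>2" if "\<epsilon> > 0" for n and \<epsilon> :: real
  proof -
    have e2: "\<epsilon> / 2 > 0" using that by simp
    obtain K1 where K1: "\<And>L x y. L \<ge> K1 \<Longrightarrow>
        \<bar>real (card (U n \<inter> qbox x y L)) - u n * (real_of_int L)\<^sup>2\<bar> \<le> \<epsilon> / 2 * (real_of_int L)\<^sup>2"
      using u[of n] e2 unfolding uniform_density_def by meson
    obtain K2 where K2: "\<And>L x y. L \<ge> K2 \<Longrightarrow>
        \<bar>real (card (P n \<inter> qbox x y L)) - p n * (real_of_int L)\<^sup>2\<bar> \<le> \<epsilon> / 2 * (real_of_int L)\<^sup>2"
      using p[of n] e2 unfolding uniform_density_def by meson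
    show ?thesis
    proof (intro exI[of _ "max 1 (max K1 K2)"] conjI allI impI)
      fix L x y assume L: "max 1 (max K1 K2) \<le> L"
      have 1: "real (card (U n \<inter> qbox x y L)) \<le> card (V \<inter> qbox x y L)"
        using card_qbox_mono[OF U(1)] by simp
      have 2: "real (card (V \<inter> qbox x y L)) \<le> card (U n \<inter> qbox x y L) + card (P n \<inter> qbox x y L)"
        using card_qbox_Un[OF U(2), of x y L n] by linarith
      have 3: "0 \<le> \<epsilon> / 2 * (real_of_int L)\<^sup>2" using that by simp
      have 4: "\<epsilon> * (real_of_int L)\<^sup>2 = \<epsilon> / 2 * (real_of_int L)\<^sup>2 + \<epsilon> / 2 * (real_of_int L)\<^sup>2" by simp
      show "(u n - \<epsilon>) * (real_of_int L)\<^sup>2 \<le> card (V \<inter> qbox x y L)"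
        unfolding left_diff_distrib 4 using K1[of L x y] L 1 3 by linarith
      show "card (V \<inter> qbox x y L) \<le> (u n + p n + \<epsilon>) * (real_of_int L)\<^sup>2"
        unfolding distrib_right 4 using K1[of L x y] K2[of L x y] L 2 3 by linarith
    qed simp
  qed
  have le: "u m \<le> u n + p n" for m n
  proof (rule field_le_epsilon)
    fix \<epsilon> :: real assume "\<epsilon> > 0"
    then have e2: "\<epsilon> / 2 > 0" by simp
    obtain K1 where "K1 > 0" and K1: "\<And>L x y. L \<ge> K1 \<Longrightarrow> (u m - \<epsilon> / 2) * (real_of_int L)\<^sup>2 \<le> card (V \<inter> qbox x y L)"
      using bounds[OF e2, of m] by blast
    obtain K2 where "K2 > 0" and K2: "\<And>L x y. L \<ge> K2 \<Longrightarrow> card (V \<inter> qbox x y L) \<le> (u n + p n + \<epsilon> / 2) * (real_of_int L)\<^sup>2"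
      using bounds[OF e2, of n] by blast
    define L where "L = max K1 K2"
    have "(u m - \<epsilon> / 2) * (real_of_int L)\<^sup>2 \<le> (u n + p n + \<epsilon> / 2) * (real_of_int L)\<^sup>2"
      using K1[of L 0 0] K2[of L 0 0] by (simp add: L_def)
    moreover have "(real_of_int L)\<^sup>2 > 0" using \<open>K1 > 0\<close> by (simp add: L_def)
    ultimately show "u m \<le> u n + p n + \<epsilon>" by (simp add: mult_le_cancel_right)
  qed
  define d where "d = (SUP n. u n)"
  have bdd: "bdd_above (range u)" using le by (intro bdd_aboveI2) blast
  have d1: "u n \<le> d" for n unfolding d_def using bdd by (intro cSUP_upper) auto
  have d2: "d \<le> u n + p n" for n unfolding d_def using le by (intro cSUP_least) auto
  have "uniform_density V d"
    unfolding uniform_density_def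
  proof (intro allI impI)
    fix \<epsilon> :: real assume \<epsilon>: "\<epsilon> > 0"
    then have e2: "\<epsilon> / 2 > 0" by simp
    obtain n :: nat where n: "1 / Suc n < \<epsilon> / 2" using nat_approx_posE[OF e2] by blast
    then have pn: "p n \<le> \<epsilon> / 2" using p_le[of n] by linarith
    obtain K where K: "\<And>L x y. L \<ge> K \<Longrightarrow> (u n - \<epsilon> / 2) * (real_of_int L)\<^sup>2 \<le> card (V \<inter> qbox x y L) \<and>
      card (V \<inter> qbox x y L) \<le> (u n + p n + \<epsilon> / 2) * (real_of_int L)\<^sup>2"
      using bounds[OF e2, of n] by blast
    show "\<exists>K. \<forall>L\<ge>K. \<forall>x y. \<bar>real (card (V \<inter> qbox x y L)) - d * (real_of_int L)\<^sup>2\<bar> \<le> \<epsilon> * (real_of_int L)\<^sup>2"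
    proof (intro exI[of _ K] allI impI)
      fix L x y assume "K \<le> L"
      have "(d - \<epsilon>) * (real_of_int L)\<^sup>2 \<le> (u n - \<epsilon> / 2) * (real_of_int L)\<^sup>2"
        using d2[of n] pn by (intro mult_right_mono) auto
      moreover have "(u n + p n + \<epsilon> / 2) * (real_of_int L)\<^sup>2 \<le> (d + \<epsilon>) * (real_of_int L)\<^sup>2"
        using d1[of n] pn by (intro mult_right_mono) auto
      ultimately have "(d - \<epsilon>) * (real_of_int L)\<^sup>2 \<le> card (V \<inter> qbox x y L)"
        "card (V \<inter> qbox x y L) \<le> (d + \<epsilon>) * (real_of_int L)\<^sup>2"
        using K[OF \<open>K \<le> L\<close>, of x y] by linarith+
      then show "\<bar>real (card (V \<inter> qbox x y L)) - d * (real_of_int L)\<^sup>2\<bar> \<le> \<epsilon> * (real_of_int L)\<^sup>2"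
        unfolding left_diff_distrib distrib_right by linarith
    qed
  qed
  then show ?thesis ..
qed

lemma uniform_density_pos:
  assumes "uniform_density V d" "M > 0" "\<And>x y. V \<inter> qbox x y M \<noteq> {}"
  shows "d > 0"
proof -
  define m where "m = real_of_int M"
  have m: "m > 0" using assms(2) by (simp add: m_def)
  \<comment> \<open>One point in every tile of side \<open>m\<close> means at least
    \<open>1 / m^2\<close> points per unit area; half of that is given away as error.\<close>
  define \<epsilon> where "\<epsilon> = 1 / (2 * m\<^sup>2)"
  have \<epsilon>: "\<epsilon> > 0" using m by (simp add: \<epsilon>_def)
  obtain K where K: "\<And>L x y. L \<ge> K \<Longrightarrow>
      \<bar>real (card (V \<inter> qbox x y L)) - d * (real_of_int L)\<^sup>2\<bar> \<le> \<epsilon> * (real_of_int L)\<^sup>2"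
    using assms(1) \<epsilon> unfolding uniform_density_def by meson
  define q where "q = nat (max 1 K)"
  have q: "q \<ge> 1" "K \<le> int q" by (auto simp: q_def)
  then have "K \<le> int q * M" using assms(2)
    by (metis mult.right_neutral mult_left_mono of_nat_0_le_iff order_trans zero_less_imp_eq_int
        int_one_le_iff_zero_less)
  then have k: "\<bar>real (card (V \<inter> qbox 0 0 (int q * M))) - d * (real q * m)\<^sup>2\<bar> \<le> \<epsilon> * (real q * m)\<^sup>2"
    using K[of "int q * M" 0 0] by (simp add: m_def)
  have "1 \<le> card (V \<inter> qbox x y M)" for x y
    using assms(3)[of x y] by (simp add: Suc_le_eq card_gt_0_iff)
  then have "(\<Sum>i<q. \<Sum>j<q. 1) \<le> card (V \<inter> qbox 0 0 (int q * M))"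
    unfolding card_qbox_tiles[OF assms(2)] by (intro sum_mono)
  then have "real (q * q) \<le> card (V \<inter> qbox 0 0 (int q * M))"
    by (simp only: of_nat_le_iff) simp
  then have "(real q)\<^sup>2 \<le> d * (real q * m)\<^sup>2 + \<epsilon> * (real q * m)\<^sup>2"
    using k by (simp add: power2_eq_square)
  moreover have "\<epsilon> * (real q * m)\<^sup>2 = (real q)\<^sup>2 / 2"
    using m by (simp add: \<epsilon>_def power_mult_distrib)
  moreover have "(real q)\<^sup>2 > 0" using q by simp
  ultimately have "d * (real q * m)\<^sup>2 > 0" by linarith
  then show ?thesis by (simp add: zero_less_mult_iff)
qed

text \<open>\<open>Q s z v\<close> stands for the condition that a bounded pattern translated by \<open>v\<close> lies in the
  square of side \<open>s\<close> at \<open>z\<close>; it only matters near the boundary of the square.\<close>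

lemma uniform_density_squares:
  fixes Q :: "real \<Rightarrow> complex \<Rightarrow> int \<times> int \<Rightarrow> bool" and h :: int and d \<epsilon> :: real
  assumes dens: "uniform_density V d" and d: "d > 0" and h: "h \<ge> (0::int)"
    and inner: "\<And>s z v. Re z \<le> real_of_int (fst v - h) \<Longrightarrow> real_of_int (fst v + h) \<le> Re z + s \<Longrightarrow>
      Im z \<le> real_of_int (snd v - h) \<Longrightarrow> real_of_int (snd v + h) \<le> Im z + s \<Longrightarrow> Q s z v"
    and outer: "\<And>s z v. Q s z v \<Longrightarrow>
      Re z \<le> real_of_int (fst v + h) \<and> real_of_int (fst v - h) \<le> Re z + s \<and>
      Im z \<le> real_of_int (snd v + h) \<and> real_of_int (snd v - h) \<le> Im z + s"
    and \<epsilon>: "\<epsilon> > 0"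
  shows "\<exists>r>0. \<forall>s\<ge>r. \<forall>z. finite {v \<in> V. Q s z v} \<and>
    s\<^sup>2 * d * (1 - \<epsilon>) < card {v \<in> V. Q s z v} \<and> card {v \<in> V. Q s z v} < s\<^sup>2 * d * (1 + \<epsilon>)"
proof -
  define \<epsilon>1 where "\<epsilon>1 = min \<epsilon> 1"
  have \<epsilon>1: "0 < \<epsilon>1" "\<epsilon>1 \<le> 1" "\<epsilon>1 \<le> \<epsilon>" using \<epsilon> by (auto simp: \<epsilon>1_def)
  have "d * \<epsilon>1 / 4 > 0" using d \<epsilon>1 by simp
  then obtain K where K: "\<And>L x y. L \<ge> K \<Longrightarrow>
      \<bar>real (card (V \<inter> qbox x y L)) - d * (real_of_int L)\<^sup>2\<bar> \<le> d * \<epsilon>1 / 4 * (real_of_int L)\<^sup>2"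
    using dens unfolding uniform_density_def by meson
  define k where "k = 2 * real_of_int h + 2"
  have k: "k \<ge> 2" using h by (simp add: k_def)
  \<comment> \<open>The integer boxes inside and around the square have sides within
    \<open>k\<close> of \<open>s\<close>. The first bound gives
    \<open>t = k / s \<le> \<epsilon>1 / 16\<close>, small enough for both final estimates; the
    second makes the inner side \<open>L\<close> at least \<open>K\<close>.\<close>
  define r where "r = max (16 * k / \<epsilon>1) (real_of_int K + 2 * h + 2)"
  have r: "r > 0" using k \<epsilon>1 by (simp add: r_def less_max_iff_disj)
  show ?thesis
  proof (intro exI[of _ r] conjI[OF r] allI impI)
    fix s z assume s: "r \<le> s"
    define A where "A = {v \<in> V. Q s z v}"
    define L L' where "L = \<lfloor>s\<rfloor> - 2 * h - 1" and "L' = \<lfloor>s\<rfloor> + 2 * h + 2"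
    define B where "B = V \<inter> qbox (\<lceil>Re z\<rceil> + h) (\<lceil>Im z\<rceil> + h) L"
    define B' where "B' = V \<inter> qbox (\<lfloor>Re z\<rfloor> - h) (\<lfloor>Im z\<rfloor> - h) L'"
    have "B \<subseteq> A"
    proof
      fix v assume v: "v \<in> B"
      then have "\<lceil>Re z\<rceil> + h \<le> fst v" "fst v < \<lceil>Re z\<rceil> + h + L" "\<lceil>Im z\<rceil> + h \<le> snd v" "snd v < \<lceil>Im z\<rceil> + h + L"
        by (auto simp: B_def qbox_def)
      then have "Q s z v" by (intro inner; simp add: L_def; linarith)
      then show "v \<in> A" using v by (simp add: A_def B_def)
    qed
    moreover have "A \<subseteq> B'"
    proof
      fix v assume "v \<in> A"
      then have "v \<in> V" "Q s z v" by (auto simp: A_def)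
      then have "\<lfloor>Re z\<rfloor> - h \<le> fst v" "fst v < \<lfloor>Re z\<rfloor> - h + L'" "\<lfloor>Im z\<rfloor> - h \<le> snd v" "snd v < \<lfloor>Im z\<rfloor> - h + L'"
        using outer[OF \<open>Q s z v\<close>] by (simp_all add: L'_def; linarith)+
      then show "v \<in> B'" using \<open>v \<in> V\<close> by (cases v) (auto simp: B'_def qbox_def)
    qed
    moreover have "finite B'" by (simp add: B'_def)
    ultimately have fin: "finite A" and "card B \<le> card A" "card A \<le> card B'"
      by (auto intro: finite_subset card_mono)
    then have cards: "real (card B) \<le> card A" "real (card A) \<le> card B'" by simp_all
    have "real_of_int K + 2 * h + 2 \<le> s" using s by (simp add: r_def)
    then have "K \<le> L" unfolding L_def by linarith
    moreover have "L \<le> L'" using h by (simp add: L_def L'_def)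
    ultimately have KL: "K \<le> L" "K \<le> L'" by simp_all
    have K': "\<bar>real (card B) - d * (real_of_int L)\<^sup>2\<bar> \<le> d * \<epsilon>1 / 4 * (real_of_int L)\<^sup>2"
      "\<bar>real (card B') - d * (real_of_int L')\<^sup>2\<bar> \<le> d * \<epsilon>1 / 4 * (real_of_int L')\<^sup>2"
      unfolding B_def B'_def by (rule K[OF KL(1)], rule K[OF KL(2)])
    have "d * (1 - \<epsilon>1 / 4) * (real_of_int L)\<^sup>2 = d * (real_of_int L)\<^sup>2 - d * \<epsilon>1 / 4 * (real_of_int L)\<^sup>2"
      "d * (1 + \<epsilon>1 / 4) * (real_of_int L')\<^sup>2 = d * (real_of_int L')\<^sup>2 + d * \<epsilon>1 / 4 * (real_of_int L')\<^sup>2"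
      by (simp_all add: algebra_simps)
    then have N: "d * (1 - \<epsilon>1 / 4) * (real_of_int L)\<^sup>2 \<le> card A"
      "card A \<le> d * (1 + \<epsilon>1 / 4) * (real_of_int L')\<^sup>2"
      using K' cards by linarith+
    have "16 * k / \<epsilon>1 \<le> s" using s by (simp add: r_def)
    then have ks: "16 * k \<le> \<epsilon>1 * s" using \<epsilon>1 by (simp add: field_simps)
    have spos: "s > 0" using r s by simp
    define t where "t = k / s"
    have t: "0 < t" "16 * t \<le> \<epsilon>1" using ks spos k by (simp_all add: t_def field_simps)
    have Ls: "s * (1 - t) \<le> real_of_int L" "real_of_int L' \<le> s * (1 + t)"
    proof -
      have "s * (1 - t) = s - k" "s * (1 + t) = s + k" using spos by (simp_all add: t_def field_simps)
      then show "s * (1 - t) \<le> real_of_int L" "real_of_int L' \<le> s * (1 + t)"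
        unfolding L_def L'_def k_def by linarith+
    qed
    have t1: "t \<le> 1 / 16" using t \<epsilon>1 by linarith
    have "s\<^sup>2 * d * (1 - \<epsilon>) < card A"
    proof -
      have "1 - \<epsilon>1 < (1 - \<epsilon>1 / 4) * (1 - 2 * t)"
      proof -
        have "(1 - \<epsilon>1 / 4) * (1 - 2 * t) = 1 - \<epsilon>1 / 4 - 2 * t + \<epsilon>1 * t / 2"
          by (simp add: algebra_simps)
        moreover have "\<epsilon>1 * t > 0" using t \<epsilon>1 by simp
        ultimately show ?thesis using t \<epsilon>1 by linarith
      qed
      also have "\<dots> \<le> (1 - \<epsilon>1 / 4) * (1 - t)\<^sup>2"
        using \<epsilon>1 by (intro mult_left_mono) (auto simp: power2_eq_square algebra_simps)
      finally have "1 - \<epsilon> < (1 - \<epsilon>1 / 4) * (1 - t)\<^sup>2" using \<epsilon>1 by linarith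
      then have "s\<^sup>2 * d * (1 - \<epsilon>) < s\<^sup>2 * d * ((1 - \<epsilon>1 / 4) * (1 - t)\<^sup>2)"
        using d spos by (intro mult_strict_left_mono) auto
      also have "\<dots> = d * (1 - \<epsilon>1 / 4) * (s * (1 - t))\<^sup>2"
        by (simp add: power_mult_distrib)
      also have "\<dots> \<le> d * (1 - \<epsilon>1 / 4) * (real_of_int L)\<^sup>2"
        using Ls(1) d \<epsilon>1 t1 spos by (intro mult_left_mono power_mono) auto
      finally show ?thesis using N by linarith
    qed
    moreover have "card A < s\<^sup>2 * d * (1 + \<epsilon>)"
    proof -
      have "card A \<le> d * (1 + \<epsilon>1 / 4) * (real_of_int L')\<^sup>2" by (rule N)
      also have "\<dots> \<le> d * (1 + \<epsilon>1 / 4) * (s * (1 + t))\<^sup>2"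
        using Ls d \<epsilon>1 \<open>K \<le> L\<close> spos h by (intro mult_left_mono power_mono) (auto simp: L'_def)
      also have "\<dots> = s\<^sup>2 * d * ((1 + \<epsilon>1 / 4) * (1 + t)\<^sup>2)"
        by (simp add: power_mult_distrib)
      also have "\<dots> < s\<^sup>2 * d * (1 + \<epsilon>)"
      proof (rule mult_strict_left_mono)
        have "t * t \<le> t" using t t1 by (simp add: mult_left_le)
        then have "(1 + t)\<^sup>2 \<le> 1 + 3 * t" by (simp add: power2_eq_square algebra_simps)
        then have "(1 + \<epsilon>1 / 4) * (1 + t)\<^sup>2 \<le> (1 + \<epsilon>1 / 4) * (1 + 3 * t)"
          using \<epsilon>1 by (intro mult_left_mono) auto
        also have "\<dots> = 1 + \<epsilon>1 / 4 + 3 * t + 3 / 4 * (\<epsilon>1 * t)" by (simp add: algebra_simps)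
        also have "\<epsilon>1 * t \<le> t" using \<epsilon>1 t by (simp add: mult_left_le_one_le)
        finally have "(1 + \<epsilon>1 / 4) * (1 + t)\<^sup>2 \<le> 1 + \<epsilon>1 / 4 + 3 * t + 3 / 4 * t" by simp
        then show "(1 + \<epsilon>1 / 4) * (1 + t)\<^sup>2 < 1 + \<epsilon>" using t \<epsilon>1 by linarith
      qed (use d spos in simp)
      finally show ?thesis .
    qed
    ultimately show "finite {v \<in> V. Q s z v} \<and> s\<^sup>2 * d * (1 - \<epsilon>) < card {v \<in> V. Q s z v} \<and>
        card {v \<in> V. Q s z v} < s\<^sup>2 * d * (1 + \<epsilon>)"
      using fin unfolding A_def by blast
  qed
qed

section \<open>Lattice points as complex numbers, and patterns of turns\<close>

definition cvec :: "int \<times> int \<Rightarrow> complex" where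
  "cvec z = Complex (of_int (fst z)) (of_int (snd z))"

lemma cvec_add: "cvec (y + z) = cvec y + cvec z"
  by (simp add: cvec_def complex_eq_iff)

lemma cvec_uminus: "cvec (- z) = - cvec z"
  by (simp add: cvec_def complex_eq_iff)

lemma cvec_inj: "cvec y = cvec z \<longleftrightarrow> y = z"
  by (simp add: cvec_def complex_eq_iff prod_eq_iff)

lemma Re_cvec [simp]: "Re (cvec z) = of_int (fst z)" and Im_cvec [simp]: "Im (cvec z) = of_int (snd z)"
  by (simp_all add: cvec_def)

lemma cvec_turn: "a \<in> {1, -1} \<Longrightarrow> cvec (turn a d) = \<i> powi a * cvec d"
  by (auto simp: turn_def rot_def complex_eq_iff power_int_minus)

lemma turn_eq_iff:
  assumes "a \<in> {1, -1}" "b \<in> {1, -1}" "d \<in> dirs"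
  shows "turn a d = turn b d \<longleftrightarrow> a = b"
  using assms by (cases d) (auto simp: turn_def rot_def dirs_def)

lemma gauss_ints_cvec: "z \<in> gauss_ints \<longleftrightarrow> (\<exists>w. z = cvec w)"
proof
  assume "z \<in> gauss_ints"
  then obtain a b where "Re z = of_int a" "Im z = of_int b"
    by (auto simp: gauss_ints_def Ints_def)
  then have "z = cvec (a, b)" by (simp add: complex_eq_iff)
  then show "\<exists>w. z = cvec w" ..
qed (auto simp: gauss_ints_def)

text \<open>Membership of \<open>v\<close> in \<open>V\<close> depends only on the turns in the
  window \<open>W + v\<close>. Unless the window meets the exceptional coset modulo
  \<open>N\<close>, these turns have period \<open>2 * N\<close>; the exceptional \<open>v\<close>
  form a periodic set of density at most \<open>card W / N^2\<close>.\<close>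

lemma uniform_density_turning_pattern:
  assumes lp: "\<And>m. \<exists>u. \<forall>z. \<not> (2 ^ m dvd fst z - fst u \<and> 2 ^ m dvd snd z - snd u) \<longrightarrow>
      (\<forall>v. \<sigma> (fst z + 2 ^ Suc m * fst v, snd z + 2 ^ Suc m * snd v) = \<sigma> z)"
    and W: "finite W"
    and V: "\<And>v p. v \<in> V \<Longrightarrow> even_pt p \<Longrightarrow> (\<And>w. w \<in> W \<Longrightarrow> \<sigma> (w + v + p) = \<sigma> (w + v)) \<Longrightarrow> v + p \<in> V"
  shows "\<exists>d. uniform_density V d"
proof (rule uniform_density_limit_periodic)
  fix \<epsilon> :: real assume \<epsilon>: "\<epsilon> > 0"
  obtain m :: nat where "real (card W) / \<epsilon> < m" using reals_Archimedean2 by blast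
  also have "real m < 2 ^ m" by simp
  also have "(2::real) ^ m \<le> 2 ^ m * 2 ^ m" by simp
  finally have m: "real (card W) \<le> \<epsilon> * (2 ^ m * 2 ^ m)" using \<epsilon> by (simp add: field_simps)
  define N :: int where "N = 2 ^ m"
  have N: "N > 0" by (simp add: N_def)
  have N2: "2 ^ Suc m = 2 * N" by (simp add: N_def)
  obtain u where u: "\<And>z v. \<not> (N dvd fst z - fst u \<and> N dvd snd z - snd u) \<Longrightarrow>
      \<sigma> (fst z + 2 * N * fst v, snd z + 2 * N * snd v) = \<sigma> z"
    using lp[of m] unfolding N2 unfolding N_def by blast
  define P where "P = {v. \<exists>w\<in>W. N dvd fst (w + v) - fst u \<and> N dvd snd (w + v) - snd u}"
  have dvd_shift: "N dvd a + (x + N * i) - b \<longleftrightarrow> N dvd a + x - b" for a x i b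
  proof -
    have "a + (x + N * i) - b = (a + x - b) + N * i" by simp
    then show ?thesis by (simp only: dvd_add_times_triv_right_iff[of N _ i, unfolded mult.commute[of i]])
  qed
  have PN: "periodic N P"
    unfolding periodic_def P_def by (simp add: dvd_shift)
  have P2: "periodic (2 * N) P"
    unfolding periodic_def
  proof (intro allI)
    fix x y i j
    have "(x + N * (2 * i), y + N * (2 * j)) \<in> P \<longleftrightarrow> (x, y) \<in> P"
      using PN unfolding periodic_def by blast
    then show "(x + 2 * N * i, y + 2 * N * j) \<in> P \<longleftrightarrow> (x, y) \<in> P" by (simp add: mult_ac)
  qed
  have "P \<inter> qbox 0 0 N \<subseteq> (\<lambda>w. ((fst u - fst w) mod N, (snd u - snd w) mod N)) ` W"
  proof
    fix v assume "v \<in> P \<inter> qbox 0 0 N"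
    then obtain w where w: "w \<in> W" "N dvd fst w + fst v - fst u" "N dvd snd w + snd v - snd u"
      and v: "0 \<le> fst v" "fst v < N" "0 \<le> snd v" "snd v < N"
      by (auto simp: P_def qbox_def)
    have "N dvd fst v - (fst u - fst w)" "N dvd snd v - (snd u - snd w)"
      using w(2,3) by (simp_all add: algebra_simps)
    then have "fst v mod N = (fst u - fst w) mod N" "snd v mod N = (snd u - snd w) mod N"
      by (simp_all add: mod_eq_dvd_iff)
    then have "v = ((fst u - fst w) mod N, (snd u - snd w) mod N)"
      using v by (simp add: prod_eq_iff)
    then show "v \<in> (\<lambda>w. ((fst u - fst w) mod N, (snd u - snd w) mod N)) ` W" using w(1) by blast
  qed
  then have cP: "card (P \<inter> qbox 0 0 N) \<le> card W"
    using W by (meson card_image_le card_mono finite_imageI le_trans)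
  have "card (P \<inter> qbox x y N) = card (P \<inter> qbox 0 0 N)" for x y
    by (rule card_periodic_qbox[OF PN N])
  then have "card (P \<inter> qbox 0 0 (int 2 * N)) = (\<Sum>i<2::nat. \<Sum>j<2::nat. card (P \<inter> qbox 0 0 N))"
    by (subst card_qbox_tiles[OF N]) (intro sum.cong refl)
  then have "card (P \<inter> qbox 0 0 (2 * N)) \<le> 4 * card W" using cP by simp
  then have "real (card (P \<inter> qbox 0 0 (2 * N))) \<le> 4 * real (card W)" by linarith
  also have "\<dots> \<le> \<epsilon> * (real_of_int (2 * N))\<^sup>2"
    using m by (simp add: N_def power2_eq_square)
  finally have card: "real (card (P \<inter> qbox 0 0 (2 * N))) \<le> \<epsilon> * (real_of_int (2 * N))\<^sup>2" .
  have shift: "(x + 2 * N * i, y + 2 * N * j) \<in> V" if v: "(x, y) \<in> V" "(x, y) \<notin> P" for x y i j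
  proof -
    have "(x, y) + (2 * N * i, 2 * N * j) \<in> V"
    proof (rule V[OF v(1)])
      show "even_pt (2 * N * i, 2 * N * j)" by (simp add: even_pt_def)
      fix w assume "w \<in> W"
      then have "\<not> (N dvd fst (w + (x, y)) - fst u \<and> N dvd snd (w + (x, y)) - snd u)"
        using v(2) by (auto simp: P_def)
      from u[OF this, of "(i, j)"]
      show "\<sigma> (w + (x, y) + (2 * N * i, 2 * N * j)) = \<sigma> (w + (x, y))"
        by (cases w) simp
    qed
    then show ?thesis by simp
  qed
  have "periodic (2 * N) (V - P)"
    unfolding periodic_def
  proof (intro allI iffI)
    fix x y i j
    have Pij: "(x + 2 * N * i, y + 2 * N * j) \<in> P \<longleftrightarrow> (x, y) \<in> P"
      using P2 unfolding periodic_def by blast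
    show "(x + 2 * N * i, y + 2 * N * j) \<in> V - P" if "(x, y) \<in> V - P"
      using that shift[of x y i j] Pij by blast
    show "(x, y) \<in> V - P" if "(x + 2 * N * i, y + 2 * N * j) \<in> V - P"
      \<comment> \<open>The closure assumption on \<open>V\<close> goes one way only; translating
        back supplies the converse.\<close>
      using that shift[of "x + 2 * N * i" "y + 2 * N * j" "- i" "- j"] Pij by simp
  qed
  then show "\<exists>M U P. M > 0 \<and> periodic M U \<and> periodic M P \<and> U \<subseteq> V \<and> V \<subseteq> U \<union> P \<and>
      real (card (P \<inter> qbox 0 0 M)) \<le> \<epsilon> * (real_of_int M)\<^sup>2"
    using N P2 card by (intro exI[of _ "2 * N"] exI[of _ "V - P"] exI[of _ P]) auto
qed

section \<open>The turning function of a covering\<close>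

locale folding_covering =
  fixes C :: "(int \<Rightarrow> segment) set" and p :: int
  assumes cov: "covering C"
    and fold: "\<And>\<gamma>. \<gamma> \<in> C \<Longrightarrow> complete_folding_curve \<gamma>"
    and orient: "\<And>x y::int. let z = Complex (of_int x) (of_int y) in
        {s \<in> segments_of C. fst s = z \<or> snd s = z} =
          (if even (x + y + p)
           then {(z, z + 1), (z, z - 1), (z + \<i>, z), (z - \<i>, z)}
           else {(z + 1, z), (z - 1, z), (z, z + \<i>), (z, z - \<i>)})"
begin

text \<open>The shift by \<open>p\<close> normalizes the parity in the orientation convention:
  \<open>vert z\<close> is left horizontally exactly if \<open>z\<close> is even.\<close>

definition vert :: "int \<times> int \<Rightarrow> complex" where
  "vert z = cvec (z + (p, 0))"

definition seg :: "edge \<Rightarrow> segment" where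
  "seg s = (vert (fst s), vert (fst s + snd s))"

lemma vert_add: "vert (z + d) = vert z + cvec d"
  by (simp add: vert_def cvec_add add_ac)

lemma vert_gauss: "vert z \<in> gauss_ints"
  unfolding gauss_ints_cvec vert_def by blast

lemma vert_inj: "vert y = vert z \<longleftrightarrow> y = z"
  by (simp add: vert_def cvec_inj)

lemma seg_inj: "seg s = seg t \<longleftrightarrow> s = t"
  by (auto simp: seg_def vert_inj prod_eq_iff)

lemma dir_seg: "dir (seg s) = cvec (snd s)"
  by (simp add: dir_def seg_def vert_add)

lemma segments_at:
  "{s \<in> segments_of C. fst s = vert z \<or> snd s = vert z} =
    (if even_pt z then {(vert z, vert z + 1), (vert z, vert z - 1), (vert z + \<i>, vert z), (vert z - \<i>, vert z)}
     else {(vert z + 1, vert z), (vert z - 1, vert z), (vert z, vert z + \<i>), (vert z, vert z - \<i>)})"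
proof -
  have "even (fst z + p + snd z + p) \<longleftrightarrow> even_pt z" unfolding even_pt_def by presburger
  then show ?thesis using orient[of "fst z + p" "snd z"] by (simp add: vert_def cvec_def Let_def)
qed

lemma cvec_units: "cvec (1, 0) = 1" "cvec (-1, 0) = -1" "cvec (0, 1) = \<i>" "cvec (0, -1) = - \<i>"
  by (simp_all add: complex_eq_iff)

lemma validE:
  assumes "valid s"
  obtains z where "even_pt z" "s = (z, (1, 0))" | z where "even_pt z" "s = (z, (-1, 0))"
    | z where "\<not> even_pt z" "s = (z, (0, 1))" | z where "\<not> even_pt z" "s = (z, (0, -1))"
  using assms by (cases s) (auto simp: valid_def dirs_def)

lemma seg_valid_in: "valid s \<Longrightarrow> seg s \<in> segments_of C"
proof -
  assume "valid s"
  then have "seg s \<in> {t \<in> segments_of C. fst t = vert (fst s) \<or> snd t = vert (fst s)}"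
    unfolding segments_at
    by (cases rule: validE) (auto simp: seg_def vert_add cvec_units)
  then show ?thesis by blast
qed

lemma segmentE:
  assumes "\<gamma> \<in> C"
  obtains s where "valid s" "\<gamma> k = seg s"
proof -
  have "complete_curve \<gamma>" using cov assms by (simp add: covering_def)
  then have "is_segment (\<gamma> k)" by (auto simp: complete_curve_def curve_along_def)
  then obtain w where "fst (\<gamma> k) = cvec w" by (auto simp: is_segment_def gauss_ints_cvec)
  then obtain z where z: "fst (\<gamma> k) = vert z"
    by (metis diff_add_cancel vert_def)
  have "\<gamma> k \<in> {t \<in> segments_of C. fst t = vert z \<or> snd t = vert z}"
    using assms z by (auto simp: segments_of_def)
  then have "\<gamma> k \<in> seg ` (if even_pt z then {(z, (1, 0)), (z, (-1, 0))} else {(z, (0, 1)), (z, (0, -1))})"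
    unfolding segments_at using z by (auto simp: seg_def vert_add cvec_units complex_eq_iff split: if_splits)
  then obtain s where "s \<in> (if even_pt z then {(z, (1, 0)), (z, (-1, 0))} else {(z, (0, 1)), (z, (0, -1))})"
    and seg: "\<gamma> k = seg s" by blast
  then have "valid s" by (auto simp: valid_def dirs_def split: if_splits)
  then show ?thesis using that seg by blast
qed

text \<open>In \<open>covering\<close> uniqueness concerns nonoriented intervals and pairs of curve
  and index. Written from its left or lower end, each segment is such an interval, so in particular
  no curve repeats a segment.\<close>

lemma curve_unique:
  assumes "\<gamma> \<in> C" "\<gamma>' \<in> C" "\<gamma> k = \<gamma>' k'"
  shows "\<gamma> = \<gamma>' \<and> k = k'"
proof -
  obtain s where s: "valid s" "\<gamma> k = seg s" using segmentE[OF assms(1)] .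
  have "\<exists>z\<in>gauss_ints. \<exists>e\<in>{1, \<i>}. support (seg s) = closed_segment z (z + e)"
    using s(1)
  proof (cases rule: validE)
    case (1 z)
    then show ?thesis
      by (intro bexI[OF _ vert_gauss[of z]] bexI[of _ 1]) (auto simp: support_def seg_def vert_add cvec_units)
  next
    case (2 z)
    then show ?thesis
      by (intro bexI[OF _ vert_gauss[of "z + (-1, 0)"]] bexI[of _ 1])
        (auto simp: support_def seg_def vert_add cvec_units closed_segment_commute)
  next
    case (3 z)
    then show ?thesis
      by (intro bexI[OF _ vert_gauss[of z]] bexI[of _ \<i>]) (auto simp: support_def seg_def vert_add cvec_units)
  next
    case (4 z)
    then show ?thesis
      by (intro bexI[OF _ vert_gauss[of "z + (0, -1)"]] bexI[of _ \<i>])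
        (auto simp: support_def seg_def vert_add cvec_units closed_segment_commute)
  qed
  then obtain z e where "z \<in> gauss_ints" "e \<in> {1, \<i>}" "support (seg s) = closed_segment z (z + e)"
    by blast
  moreover have "\<exists>!x. case x of (\<gamma>, k) \<Rightarrow> \<gamma> \<in> C \<and> support (\<gamma> k) = closed_segment z (z + e)"
    using cov calculation unfolding covering_def by blast
  ultimately have "(\<gamma>, k) = (\<gamma>', k')"
    using assms s(2) by (elim ex1E) (metis (mono_tags, lifting) case_prod_conv)
  then show ?thesis by simp
qed

lemma curve_through:
  assumes "valid s"
  obtains \<gamma> k where "\<gamma> \<in> C" "\<gamma> k = seg s"
  using seg_valid_in[OF assms] by (auto simp: segments_of_def)

lemma curve_step:
  assumes \<gamma>: "\<gamma> \<in> C" "curve_along UNIV a \<gamma>" and s: "valid s" "\<gamma> k = seg s"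
  shows "a k \<in> {1, -1} \<and> \<gamma> (k + 1) = seg (fst s + snd s, turn (a k) (snd s))"
proof -
  have a: "a k \<in> {1, -1}" and "snd (\<gamma> k) = fst (\<gamma> (k + 1))" "dir (\<gamma> (k + 1)) = \<i> powi (a k) * dir (\<gamma> k)"
    using \<gamma>(2) by (auto simp: curve_along_def)
  then have 1: "fst (\<gamma> (k + 1)) = vert (fst s + snd s)" and
    "dir (\<gamma> (k + 1)) = cvec (turn (a k) (snd s))"
    using s(2) by (simp add: seg_def, simp add: cvec_turn[OF a] dir_seg)
  then have "snd (\<gamma> (k + 1)) = vert (fst s + snd s) + cvec (turn (a k) (snd s))"
    using 1 by (simp add: dir_def algebra_simps)
  with 1 have "\<gamma> (k + 1) = seg (fst s + snd s, turn (a k) (snd s))"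
    by (simp add: prod_eq_iff seg_def vert_add)
  then show ?thesis using a by blast
qed

definition turn_at :: "int \<times> int \<Rightarrow> int \<Rightarrow> bool" where
  "turn_at w a \<longleftrightarrow> a \<in> {1, -1} \<and> (\<exists>\<gamma>\<in>C. \<exists>k s. valid s \<and> \<gamma> k = seg s \<and> fst s + snd s = w \<and>
     \<gamma> (k + 1) = seg (w, turn a (snd s)))"

definition \<sigma> :: "int \<times> int \<Rightarrow> int" where
  "\<sigma> w = (THE a. turn_at w a)"

text \<open>If the two strands through a point turned in opposite ways, they would leave it by the same
  segment.\<close>

lemma turn_at_unique:
  assumes "turn_at w a" "turn_at w b"
  shows "a = b"
proof -
  obtain \<gamma> k s where 1: "a \<in> {1, -1}" "\<gamma> \<in> C" "valid s" "\<gamma> k = seg s" "fst s + snd s = w"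
    "\<gamma> (k + 1) = seg (w, turn a (snd s))"
    using assms(1) unfolding turn_at_def by blast
  obtain \<gamma>' k' s' where 2: "b \<in> {1, -1}" "\<gamma>' \<in> C" "valid s'" "\<gamma>' k' = seg s'" "fst s' + snd s' = w"
    "\<gamma>' (k' + 1) = seg (w, turn b (snd s'))"
    using assms(2) unfolding turn_at_def by blast
  have d: "snd s \<in> dirs" "snd s' \<in> dirs" using 1 2 by (auto simp: valid_def)
  have "even_pt (fst s) \<longleftrightarrow> \<not> even_pt w" "even_pt (fst s') \<longleftrightarrow> \<not> even_pt w"
    using even_pt_add_dir[OF d(1), of "fst s"] even_pt_add_dir[OF d(2), of "fst s'"] 1(5) 2(5) by auto
  then have "snd (snd s) = 0 \<longleftrightarrow> snd (snd s') = 0" using 1(3) 2(3) by (simp add: valid_def)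
  moreover have "snd s = (1, 0) \<or> snd s = (0, 1) \<or> snd s = (-1, 0) \<or> snd s = (0, -1)"
    "snd s' = (1, 0) \<or> snd s' = (0, 1) \<or> snd s' = (-1, 0) \<or> snd s' = (0, -1)"
    using d by (simp_all add: dirs_def)
  \<comment> \<open>By the orientation convention the segments arriving at \<open>w\<close> are all
    horizontal or all vertical.\<close>
  ultimately have "snd s' = snd s \<or> snd s' = - snd s"
    by (elim disjE; simp)
  then show ?thesis
  proof
    assume "snd s' = snd s"
    then have "s = s'" using \<open>fst s + snd s = w\<close> 2(5) by (metis add_right_cancel prod_eq_iff)
    then have "\<gamma> = \<gamma>' \<and> k = k'" using curve_unique \<open>\<gamma> \<in> C\<close> \<open>\<gamma> k = seg s\<close> 2 by metis
    then have "turn a (snd s) = turn b (snd s)"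
      using \<open>\<gamma> (k + 1) = seg (w, turn a (snd s))\<close> 2(6) \<open>s = s'\<close> by (simp add: seg_inj)
    then show ?thesis using turn_eq_iff \<open>a \<in> {1, -1}\<close> 2(1) d by blast
  next
    assume opp: "snd s' = - snd s"
    show ?thesis
    proof (rule ccontr)
      assume "a \<noteq> b"
      then have "b = - a" using 1(1) 2(1) by auto
      then have "turn b (snd s') = turn a (snd s)"
        using 1(1) by (auto simp: opp turn_def rot_def prod_eq_iff)
      then have "\<gamma> (k + 1) = \<gamma>' (k' + 1)" using 1(6) 2(6) by simp
      from curve_unique[OF 1(2) 2(2) this] have "\<gamma> = \<gamma>'" "k = k'" by simp_all
      then have "s = s'" using 1(4) 2(4) by (simp add: seg_inj)
      then show False using opp d(1) by (auto simp: dirs_def)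
    qed
  qed
qed

lemma \<sigma>_eq: "turn_at w a \<Longrightarrow> \<sigma> w = a"
  unfolding \<sigma>_def using turn_at_unique by blast

lemma \<sigma>_curve:
  assumes "\<gamma> \<in> C" "curve_along UNIV a \<gamma>" "valid s" "\<gamma> k = seg s"
  shows "\<sigma> (fst s + snd s) = a k"
  using curve_step[OF assms] assms by (intro \<sigma>_eq) (unfold turn_at_def, blast)

text \<open>From here on \<open>\<sigma>\<close> replaces the covering: one segment and the turning
  function determine the curve forwards.\<close>

lemma curve_walk:
  assumes "\<gamma> \<in> C" "valid s" "\<gamma> k = seg s"
  shows "\<gamma> (k + int n) = seg (walk \<sigma> s n)"
proof -
  obtain a where a: "curve_along UNIV a \<gamma>"
    using cov assms(1) by (auto simp: covering_def complete_curve_def)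
  show ?thesis
  proof (induction n)
    case (Suc n)
    have v: "valid (walk \<sigma> s n)" by (rule valid_walk[OF assms(2)])
    show ?case
      using curve_step[OF assms(1) a v Suc] \<sigma>_curve[OF assms(1) a v Suc]
      by (simp add: Let_def add_ac)
  qed (use assms in simp)
qed

lemma \<sigma>_range: "\<sigma> w \<in> {1, -1}"
proof -
  \<comment> \<open>A direction in which some strand enters \<open>w\<close>: even points are
    entered vertically, odd points horizontally.\<close>
  define d :: "int \<times> int" where "d = (if even_pt w then (0, 1) else (1, 0))"
  have "valid (w - d, d)"
    using even_pt_add_dir[of d "w - d"] by (auto simp: valid_def d_def dirs_def)
  then obtain \<gamma> k where \<gamma>: "\<gamma> \<in> C" "\<gamma> k = seg (w - d, d)" by (rule curve_through)
  obtain a where a: "curve_along UNIV a \<gamma>"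
    using cov \<gamma>(1) by (auto simp: covering_def complete_curve_def)
  show ?thesis
    using curve_step[OF \<gamma>(1) a \<open>valid (w - d, d)\<close> \<gamma>(2)] \<sigma>_curve[OF \<gamma>(1) a \<open>valid (w - d, d)\<close> \<gamma>(2)]
    by simp
qed

lemma folding_field_\<sigma>: "folding_field \<sigma>"
  unfolding folding_field_def
proof (intro allI impI)
  fix s assume s: "valid s"
  then obtain \<gamma> k where \<gamma>: "\<gamma> \<in> C" "\<gamma> k = seg s" by (rule curve_through)
  obtain a where a: "complete_folding_seq a" "curve_along UNIV a \<gamma>"
    using fold[OF \<gamma>(1)] by (auto simp: complete_folding_curve_def)
  have turns: "turns \<sigma> s n = a (k + int n)" for n
    using \<sigma>_curve[OF \<gamma>(1) a(2) valid_walk[OF s] curve_walk[OF \<gamma>(1) s \<gamma>(2)], of n]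
    by (simp add: turns_def Let_def)
  show "folds (turns \<sigma> s)"
    unfolding folds_def
  proof
    fix l
    \<comment> \<open>Blocks in \<open>complete_folding_seq\<close> begin one after the given index,
      so \<open>k - 1\<close> gives the block beginning with \<open>a k\<close>, the turn at the end
      of segment \<open>k\<close>.\<close>
    obtain n S where S: "folding_seq n S" "sublist (map a [k - 1 + 1..k - 1 + int l]) S"
      using a(1) unfolding complete_folding_seq_def by blast
    have "map a [k - 1 + 1..k - 1 + int l] = map (turns \<sigma> s) [0..<l]"
      by (rule nth_equalityI) (simp_all add: turns)
    then show "\<exists>n S. folding_seq n S \<and> sublist (map (turns \<sigma> s) [0..<l]) S"
      using S by metis
  qed
qed

end

section \<open>From bounded sets of curves to recurrence of the turning function\<close>

lemma translate_translate: "translate a (translate b s) = translate (b + a) s"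
  by (simp add: translate_def add_ac)

lemma translate_0: "translate 0 s = s"
  by (simp add: translate_def)

lemma finite_curve_block:
  assumes "complete_curve \<gamma>" "k \<le> l"
  shows "finite_curve (map \<gamma> [k..l])"
proof -
  obtain a where a: "curve_along UNIV a \<gamma>" using assms(1) by (auto simp: complete_curve_def)
  have nth: "map \<gamma> [k..l] ! nat (j - 1) = \<gamma> (k + j - 1)"
    if "j \<in> {1..int (length (map \<gamma> [k..l]))}" for j
  proof -
    have j: "nat (j - 1) < length [k..l]" "k + int (nat (j - 1)) \<le> l" using that assms(2) by auto
    then have "map \<gamma> [k..l] ! nat (j - 1) = \<gamma> (k + int (nat (j - 1)))"
      by (simp only: nth_map nth_upto)
    then show ?thesis using that by (simp add: add_diff_eq)
  qed
  have "curve_along {1..int (length (map \<gamma> [k..l]))} (\<lambda>j. a (k + j - 1)) (\<lambda>j. map \<gamma> [k..l] ! nat (j - 1))"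
    unfolding curve_along_def
  proof (intro conjI ballI impI)
    fix j assume j: "j \<in> {1..int (length (map \<gamma> [k..l]))}"
    show "is_segment (map \<gamma> [k..l] ! nat (j - 1))"
      unfolding nth[OF j] using a by (simp add: curve_along_def)
    assume j1: "j + 1 \<in> {1..int (length (map \<gamma> [k..l]))}"
    have eq: "k + (j + 1) - 1 = (k + j - 1) + 1" by simp
    show "a (k + j - 1) \<in> {1, - 1}"
      using a by (simp add: curve_along_def)
    show "snd (map \<gamma> [k..l] ! nat (j - 1)) = fst (map \<gamma> [k..l] ! nat (j + 1 - 1))"
      unfolding nth[OF j] nth[OF j1] eq using a by (simp only: curve_along_def) blast
    show "dir (map \<gamma> [k..l] ! nat (j + 1 - 1)) = \<i> powi a (k + j - 1) * dir (map \<gamma> [k..l] ! nat (j - 1))"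
      unfolding nth[OF j] nth[OF j1] eq using a by (simp only: curve_along_def) blast
  qed
  then show ?thesis using assms(2) unfolding finite_curve_def by auto
qed

text \<open>All blocks with segments in \<open>A\<close> are taken, not only the maximal ones;
  consecutive segments in the second clause of \<open>part_of\<close> are then themselves a
  member.\<close>

definition chains_in :: "(int \<Rightarrow> segment) set \<Rightarrow> segment set \<Rightarrow> segment list set" where
  "chains_in C A = {map \<gamma> [k..l] | \<gamma> k l. \<gamma> \<in> C \<and> k \<le> l \<and> \<gamma> ` {k..l} \<subseteq> A}"

lemma chains_in_bounded:
  assumes "\<And>\<gamma>. \<gamma> \<in> C \<Longrightarrow> complete_curve \<gamma>" "finite A"
  shows "bounded_curve_set (chains_in C A)"
  unfolding bounded_curve_set_def
proof
  show "\<forall>\<beta>\<in>chains_in C A. finite_curve \<beta>"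
    using assms(1) finite_curve_block unfolding chains_in_def by blast
  have "(\<Union>\<beta>\<in>chains_in C A. set \<beta>) \<subseteq> A" by (auto simp: chains_in_def)
  then show "finite (\<Union>\<beta>\<in>chains_in C A. set \<beta>)" using assms(2) by (rule finite_subset)
qed

lemma chains_in_part_of: "part_of (chains_in C A) C"
  unfolding part_of_def
proof (intro conjI ballI allI impI)
  fix \<beta> assume "\<beta> \<in> chains_in C A"
  then show "\<exists>\<gamma>\<in>C. subcurve \<beta> \<gamma>" unfolding chains_in_def subcurve_def by blast
next
  fix \<gamma> k l assume "\<gamma> \<in> C" and kl: "k \<le> l \<and> \<gamma> ` {k..l} \<subseteq> (\<Union>\<beta>\<in>chains_in C A. set \<beta>)"
  moreover have "(\<Union>\<beta>\<in>chains_in C A. set \<beta>) \<subseteq> A" by (auto simp: chains_in_def)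
  ultimately have "\<gamma> \<in> C" "k \<le> l" "\<gamma> ` {k..l} \<subseteq> A" by blast+
  then have "map \<gamma> [k..l] \<in> chains_in C A"
    unfolding chains_in_def by (intro CollectI exI[of _ \<gamma>] exI[of _ k] exI[of _ l] conjI refl)
  then show "\<exists>\<beta>\<in>chains_in C A. sublist (map \<gamma> [k..l]) \<beta>" by blast
qed

context folding_covering
begin

definition shift :: "int \<times> int \<Rightarrow> edge \<Rightarrow> edge" where
  "shift v s = (fst s + v, snd s)"

lemma translate_seg: "translate (cvec v) (seg s) = seg (shift v s)"
  by (simp add: translate_def seg_def shift_def vert_add)

lemma valid_shift: "even_pt v \<Longrightarrow> valid (shift v s) \<longleftrightarrow> valid s"
  by (simp add: valid_def shift_def even_pt_add)

lemma valid_shift_even: "valid s \<Longrightarrow> valid (shift v s) \<Longrightarrow> even_pt v"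
  by (auto simp: valid_def shift_def even_pt_add)

lemma walk_shift:
  assumes "\<And>i. 0 < i \<Longrightarrow> i \<le> n \<Longrightarrow> \<sigma> (fst (walk \<sigma> s i) + v) = \<sigma> (fst (walk \<sigma> s i))"
  shows "walk \<sigma> (shift v s) n = shift v (walk \<sigma> s n)"
  using assms
proof (induction n)
  case (Suc n)
  have "walk \<sigma> (shift v s) n = shift v (walk \<sigma> s n)" using Suc by simp
  moreover have "fst (walk \<sigma> s n) + v + snd (walk \<sigma> s n) = fst (walk \<sigma> s (Suc n)) + v"
    by (simp add: Let_def add_ac)
  ultimately show ?case using Suc.prems[of "Suc n"] by (simp add: shift_def Let_def add.assoc add.commute[of v])
qed simp

text \<open>Translations in \<open>translation_equiv\<close> are by arbitrary complex numbers.
  Carrying one segment of the covering to another makes the vector a lattice vector, and equal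
  orientation makes it even.\<close>

lemma translation_integral:
  assumes "valid s" "translate v (seg s) \<in> segments_of C"
  obtains w where "v = cvec w" "even_pt w"
proof -
  obtain \<gamma> k where "\<gamma> \<in> C" "\<gamma> k = translate v (seg s)"
    using assms(2) by (auto simp: segments_of_def)
  then obtain t where t: "valid t" "translate v (seg s) = seg t" using segmentE by metis
  have e: "vert (fst s) + v = vert (fst t)" "vert (fst s + snd s) + v = vert (fst t + snd t)"
    using t(2) by (auto simp: translate_def seg_def)
  define w where "w = fst t - fst s"
  have v: "v = cvec w"
    using e(1) vert_add[of "fst s" w] by (simp add: w_def)
  have "t = shift w s"
    using t(2) unfolding v translate_seg seg_inj by simp
  then have "even_pt w" using valid_shift_even assms(1) t(1) by blast
  then show ?thesis using that v by blast
qed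

text \<open>The turn at \<open>w\<close> is visible in a block of two segments through
  \<open>w\<close>. A translated copy of that block is again a block of a curve, so the turn at
  \<open>w + v\<close> is the same.\<close>

lemma recurrent_\<sigma>:
  assumes lip: "local_isomorphism_property C"
  shows "recurrent \<sigma>"
  unfolding recurrent_def
proof (intro allI impI)
  fix W :: "(int \<times> int) set" assume W: "finite W"
  \<comment> \<open>The extra edge at the origin locates the copy: its image starts at
    \<open>vert v\<close> and lies in the prescribed disc, which bounds the distance from
    \<open>v\<close> to \<open>z\<close>.\<close>
  define S where "S = insert ((0, 0), (1, 0)) (\<Union>w\<in>W. {s. valid s \<and> (fst s = w \<or> fst s + snd s = w)})"
  have dirs: "finite dirs" by (simp add: dirs_def)
  have "S \<subseteq> insert ((0, 0), (1, 0)) (\<Union>w\<in>W. {w} \<times> dirs \<union> (\<lambda>d. (w - d, d)) ` dirs)"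
    by (auto simp: S_def valid_def image_iff)
  then have "finite S" by (rule finite_subset) (use W dirs in auto)
  define B where "B = chains_in C (seg ` S)"
  have complete: "complete_curve \<gamma>" if "\<gamma> \<in> C" for \<gamma> using cov that by (simp add: covering_def)
  have "bounded_curve_set B"
    unfolding B_def using complete \<open>finite S\<close> by (intro chains_in_bounded) auto
  moreover have "part_of B C" unfolding B_def by (rule chains_in_part_of)
  ultimately obtain r where r: "\<And>z. \<exists>B'. part_of B' C \<and> translation_equiv B B' \<and> lies_in B' (cball z r)"
    using lip unfolding local_isomorphism_property_def by meson
  define s0 :: edge where "s0 = ((0, 0), (1, 0))"
  have s0: "valid s0" by (simp add: s0_def valid_def dirs_def even_pt_def)
  have single: "[seg s] \<in> B" if s: "valid s" "s \<in> S" for s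
  proof -
    obtain \<gamma> k where "\<gamma> \<in> C" "\<gamma> k = seg s" using curve_through[OF s(1)] .
    then show ?thesis
      using s(2) unfolding B_def chains_in_def
      by (intro CollectI exI[of _ \<gamma>] exI[of _ k]) auto
  qed
  show "\<exists>r. \<forall>z. \<exists>v. even_pt v \<and> \<bar>fst v - fst z\<bar> \<le> r \<and> \<bar>snd v - snd z\<bar> \<le> r \<and> (\<forall>w\<in>W. \<sigma> (w + v) = \<sigma> w)"
  proof (intro exI[of _ "\<lceil>r\<rceil>"] allI)
    fix z
    obtain B' x where B': "part_of B' C" "B' = map (translate x) ` B" "lies_in B' (cball (vert z) r)"
      using r[of "vert z"] unfolding translation_equiv_def by blast
    have in_C: "\<exists>\<gamma>\<in>C. \<exists>k l. map (translate x) \<beta> = map \<gamma> [k..l]" if "\<beta> \<in> B" for \<beta>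
      using B'(1,2) that unfolding part_of_def subcurve_def by blast
    have B0: "[seg s0] \<in> B" using single[OF s0] by (simp add: S_def s0_def)
    obtain \<gamma> k l where g0: "\<gamma> \<in> C" "map (translate x) [seg s0] = map \<gamma> [k..l]"
      using in_C[OF B0] by blast
    have "translate x (seg s0) \<in> set (map (translate x) [seg s0])" by simp
    then have "translate x (seg s0) \<in> segments_of C"
      unfolding g0(2) using g0(1) by (auto simp: segments_of_def)
    then obtain v where v: "x = cvec v" "even_pt v" by (rule translation_integral[OF s0])
    have "support (translate x (seg s0)) \<subseteq> cball (vert z) r"
      using B'(3) B0 unfolding B'(2) lies_in_def by force
    then have "vert (0, 0) + cvec v \<in> cball (vert z) r"
      by (auto simp: support_def translate_def seg_def s0_def v(1))
    then have "cmod (vert z - (vert (0, 0) + cvec v)) \<le> r" by (simp add: dist_norm)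
    then have "\<bar>real_of_int (fst z) - real_of_int (fst v)\<bar> \<le> r" "\<bar>real_of_int (snd z) - real_of_int (snd v)\<bar> \<le> r"
      using abs_Re_le_cmod[of "vert z - (vert (0, 0) + cvec v)"] abs_Im_le_cmod[of "vert z - (vert (0, 0) + cvec v)"]
      by (auto simp: vert_def)
    then have "\<bar>fst v - fst z\<bar> \<le> \<lceil>r\<rceil>" "\<bar>snd v - snd z\<bar> \<le> \<lceil>r\<rceil>" by linarith+
    moreover have "\<sigma> (w + v) = \<sigma> w" if w: "w \<in> W" for w
    proof -
      define d :: "int \<times> int" where "d = (if even_pt w then (0, 1) else (1, 0))"
      define s where "s = (w - d, d)"
      have s: "valid s"
        using even_pt_add_dir[of d "w - d"] by (auto simp: s_def valid_def d_def dirs_def)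
      define t where "t = walk \<sigma> s 1"
      have t: "t = (w, turn (\<sigma> w) d)" by (simp add: t_def s_def Let_def)
      have "valid t" unfolding t_def by (rule valid_walk[OF s])
      obtain \<gamma> k where g: "\<gamma> \<in> C" "\<gamma> k = seg s" using curve_through[OF s] .
      have g1: "\<gamma> (k + 1) = seg t" using curve_walk[OF g(1) s g(2), of 1] by (simp add: t_def)
      have "s \<in> S" "t \<in> S" using w s \<open>valid t\<close> by (auto simp: S_def s_def t)
      moreover have "[k..k + 1] = [k, k + 1]" by (simp add: upto_rec1)
      moreover have "{k..k + 1} = {k, k + 1}" by auto
      ultimately have B2: "[seg s, seg t] \<in> B"
        unfolding B_def chains_in_def using g g1
        by (intro CollectI exI[of _ \<gamma>] exI[of _ k] exI[of _ "k + 1"]) auto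
      have eq: "map (translate x) [seg s, seg t] = [seg (shift v s), seg (shift v t)]"
        by (simp add: v(1) translate_seg)
      obtain \<gamma>' k' l' where g': "\<gamma>' \<in> C"
        "[seg (shift v s), seg (shift v t)] = map \<gamma>' [k'..l']"
        using in_C[OF B2] unfolding eq by (elim bexE exE) (rule that)
      have "length [k'..l'] = 2" using arg_cong[OF g'(2), of length] by simp
      then have "l' = k' + 1" by simp
      then have e: "\<gamma>' k' = seg (shift v s)" "\<gamma>' (k' + 1) = seg (shift v t)"
        using g'(2) by (auto simp: upto_rec1)
      have vs: "valid (shift v s)" using s v(2) valid_shift by blast
      have "\<gamma>' (k' + 1) = seg (walk \<sigma> (shift v s) 1)" using curve_walk[OF g'(1) vs e(1), of 1] by simp
      then have "walk \<sigma> (shift v s) 1 = shift v t" using e(2) by (simp add: seg_inj)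
      then have "turn (\<sigma> (w + v)) d = turn (\<sigma> w) d"
        by (simp add: Let_def shift_def t s_def)
      then show ?thesis using turn_eq_iff[OF \<sigma>_range \<sigma>_range] s by (simp add: s_def valid_def)
    qed
    ultimately show "\<exists>v. even_pt v \<and> \<bar>fst v - fst z\<bar> \<le> \<lceil>r\<rceil> \<and> \<bar>snd v - snd z\<bar> \<le> \<lceil>r\<rceil> \<and> (\<forall>w\<in>W. \<sigma> (w + v) = \<sigma> w)"
      using v(2) by blast
  qed
qed

end

section \<open>Occurrences of a bounded pattern and their density\<close>

locale pattern = folding_covering +
  fixes B :: "segment list set"
  assumes bounded: "bounded_curve_set B" and nonempty: "B \<noteq> {}" and part: "part_of B C"
begin

definition move :: "int \<times> int \<Rightarrow> segment list set" where
  "move v = map (translate (cvec v)) ` B"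

definition occurrences :: "(int \<times> int) set" where
  "occurrences = {v. part_of (move v) C}"

definition segs :: "segment set" where
  "segs = (\<Union>\<beta>\<in>B. set \<beta>)"

text \<open>The window for the turns: two consecutive segments of the pattern are joined by the turn
  at the starting point of the second one.\<close>

definition vertices :: "(int \<times> int) set" where
  "vertices = {w. vert w \<in> fst ` segs}"

lemma finite_segs: "finite segs"
  using bounded by (simp add: bounded_curve_set_def segs_def)

lemma finite_vertices: "finite vertices"
proof -
  have "vertices = vert -` (fst ` segs)" by (auto simp: vertices_def)
  moreover have "inj vert" by (simp add: inj_def vert_inj)
  ultimately show ?thesis using finite_segs by (simp add: finite_vimageI)
qed

lemma segs_move: "(\<Union>\<beta>\<in>move v. set \<beta>) = translate (cvec v) ` segs"
  by (auto simp: move_def segs_def)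

lemma B_nonempty: "\<beta> \<in> B \<Longrightarrow> \<beta> \<noteq> []"
  using bounded by (auto simp: bounded_curve_set_def finite_curve_def)

lemma move_move: "move (v + w) = map (translate (cvec w)) ` move v"
  by (simp add: move_def image_image cvec_add translate_translate comp_def)

lemma vertex_move:
  assumes "seg s \<in> translate (cvec v) ` segs"
  shows "fst s - v \<in> vertices"
proof -
  obtain t where t: "t \<in> segs" "seg s = translate (cvec v) t" using assms by blast
  then have "fst t = vert (fst s) - cvec v" by (simp add: seg_def translate_def)
  also have "\<dots> = vert (fst s - v)" using vert_add[of "fst s - v" v] by simp
  finally have "vert (fst s - v) = fst t" by simp
  then show ?thesis using t(1) unfolding vertices_def by (metis (mono_tags) image_eqI mem_Collect_eq)
qed

text \<open>Equal turns at the window let blocks of curves be translated by \<open>q\<close> and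
  back. The first clause of \<open>part_of\<close> uses the translation forwards, the second one
  backwards.\<close>

lemma occurrences_local:
  assumes v: "v \<in> occurrences" and p: "even_pt q"
    and eq: "\<And>w. w \<in> vertices \<Longrightarrow> \<sigma> (w + v + q) = \<sigma> (w + v)"
  shows "v + q \<in> occurrences"
proof -
  have part_v: "part_of (move v) C" using v by (simp add: occurrences_def)
  have eq1: "\<sigma> (fst s + q) = \<sigma> (fst s)" if "seg s \<in> translate (cvec v) ` segs" for s
    using eq[OF vertex_move[OF that]] by (simp add: add_ac)
  have eq2: "\<sigma> (fst s + - q) = \<sigma> (fst s)" if "seg s \<in> translate (cvec (v + q)) ` segs" for s
  proof -
    have "fst s - (v + q) + v = fst s + - q" "fst s - (v + q) + v + q = fst s"
      by (simp_all add: algebra_simps)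
    then show ?thesis using eq[OF vertex_move[OF that]] by simp
  qed
  have block: "map \<gamma>' [k'..k' + (l - k)] = map (translate (cvec x)) (map \<gamma> [k..l])"
    if "\<And>i. 0 \<le> i \<Longrightarrow> i \<le> l - k \<Longrightarrow> \<gamma>' (k' + i) = translate (cvec x) (\<gamma> (k + i))"
    for \<gamma> \<gamma>' :: "int \<Rightarrow> segment" and k k' l x
  proof (rule nth_equalityI)
    show "length (map \<gamma>' [k'..k' + (l - k)]) = length (map (translate (cvec x)) (map \<gamma> [k..l]))" by simp
    fix i assume "i < length (map \<gamma>' [k'..k' + (l - k)])"
    then show "map \<gamma>' [k'..k' + (l - k)] ! i = map (translate (cvec x)) (map \<gamma> [k..l]) ! i"
      using that[of "int i"] by (simp add: nth_upto)
  qed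
  \<comment> \<open>The curve through the translated first segment meets the same turns and hence
    runs along the translated block.\<close>
  have copy: "\<exists>\<gamma>'\<in>C. \<exists>k'. map \<gamma>' [k'..k' + (l - k)] = map (translate (cvec x)) (map \<gamma> [k..l])"
    if \<gamma>: "\<gamma> \<in> C" and x: "even_pt x"
      and \<sigma>: "\<And>s. seg s \<in> \<gamma> ` {k..l} \<Longrightarrow> \<sigma> (fst s + x) = \<sigma> (fst s)" for \<gamma> k l x
  proof -
    obtain s where s: "valid s" "\<gamma> k = seg s" using segmentE[OF \<gamma>] .
    have "valid (shift x s)" using s(1) x valid_shift by blast
    then obtain \<gamma>' k' where g': "\<gamma>' \<in> C" "\<gamma>' k' = seg (shift x s)" by (rule curve_through)
    have "\<gamma>' (k' + i) = translate (cvec x) (\<gamma> (k + i))" if i: "0 \<le> i" "i \<le> l - k" for i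
    proof -
      define n where "n = nat i"
      have n: "i = int n" using i by (simp add: n_def)
      have "walk \<sigma> (shift x s) n = shift x (walk \<sigma> s n)"
      proof (rule walk_shift)
        fix j assume "0 < j" "j \<le> n"
        then have "k + int j \<in> {k..l}" using i n by simp
        then have "seg (walk \<sigma> s j) \<in> \<gamma> ` {k..l}" using curve_walk[OF \<gamma> s, of j] by (metis imageI)
        then show "\<sigma> (fst (walk \<sigma> s j) + x) = \<sigma> (fst (walk \<sigma> s j))" by (rule \<sigma>)
      qed
      then show ?thesis
        using curve_walk[OF \<gamma> s, of n] curve_walk[OF g'(1) \<open>valid (shift x s)\<close> g'(2), of n]
        by (simp add: n translate_seg)
    qed
    then have "map \<gamma>' [k'..k' + (l - k)] = map (translate (cvec x)) (map \<gamma> [k..l])" by (rule block)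
    then show ?thesis using g'(1) by blast
  qed
  have "part_of (move (v + q)) C"
    unfolding part_of_def
  proof (intro conjI ballI allI impI)
    fix \<beta> assume "\<beta> \<in> move (v + q)"
    then obtain \<beta>0 where \<beta>0: "\<beta>0 \<in> move v" "\<beta> = map (translate (cvec q)) \<beta>0"
      unfolding move_move by blast
    then obtain \<gamma> k l where g: "\<gamma> \<in> C" "\<beta>0 = map \<gamma> [k..l]"
      using part_v unfolding part_of_def subcurve_def by blast
    have "set \<beta>0 \<subseteq> translate (cvec v) ` segs" using \<beta>0(1) segs_move by blast
    then have "\<gamma> ` {k..l} \<subseteq> translate (cvec v) ` segs" using g(2) by simp
    then have "\<exists>\<gamma>'\<in>C. \<exists>k'. map \<gamma>' [k'..k' + (l - k)] = map (translate (cvec q)) (map \<gamma> [k..l])"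
      using eq1 by (intro copy[OF g(1) p]) blast
    then show "\<exists>\<gamma>\<in>C. subcurve \<beta> \<gamma>" unfolding subcurve_def \<beta>0(2) g(2) by metis
  next
    fix \<gamma> k l assume \<gamma>: "\<gamma> \<in> C" and kl: "k \<le> l \<and> \<gamma> ` {k..l} \<subseteq> (\<Union>\<beta>\<in>move (v + q). set \<beta>)"
    \<comment> \<open>A block of \<open>C\<close> inside the new copy is moved back by
      \<open>q\<close> into the old copy, where it is known to lie in one curve, and the result is
      moved forwards again.\<close>
    have "even_pt (- q)" using p by (simp add: even_pt_def)
    then obtain \<gamma>' k' where g': "\<gamma>' \<in> C"
      "map \<gamma>' [k'..k' + (l - k)] = map (translate (cvec (- q))) (map \<gamma> [k..l])"
      using copy[OF \<gamma>, of "- q" k l] eq2 kl unfolding segs_move by blast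
    have cancel: "map (translate (cvec q)) (map \<gamma>' [k'..k' + (l - k)]) = map \<gamma> [k..l]"
      unfolding g'(2) by (simp add: translate_translate cvec_uminus translate_0)
    have "\<gamma>' ` {k'..k' + (l - k)} = set (map \<gamma>' [k'..k' + (l - k)])" by simp
    also have "\<dots> = translate (cvec (- q)) ` \<gamma> ` {k..l}" unfolding g'(2) by (simp add: image_image)
    also have "\<dots> \<subseteq> translate (cvec (- q)) ` translate (cvec (v + q)) ` segs"
      using kl unfolding segs_move by blast
    also have "\<dots> = (\<Union>\<beta>\<in>move v. set \<beta>)"
      unfolding segs_move by (simp add: image_image translate_translate cvec_add cvec_uminus)
    finally obtain \<beta> where "\<beta> \<in> move v" "sublist (map \<gamma>' [k'..k' + (l - k)]) \<beta>"
      using part_v g'(1) kl unfolding part_of_def by (metis diff_ge_0_iff_ge le_add_same_cancel1)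
    then have "map (translate (cvec q)) \<beta> \<in> move (v + q)"
      "sublist (map (translate (cvec q)) (map \<gamma>' [k'..k' + (l - k)])) (map (translate (cvec q)) \<beta>)"
      unfolding move_move by (blast intro: map_mono_sublist)+
    then show "\<exists>\<beta>\<in>move (v + q). sublist (map \<gamma> [k..l]) \<beta>" unfolding cancel by blast
  qed
  then show ?thesis by (simp add: occurrences_def)
qed

lemma some_segment:
  obtains t where "valid t" "seg t \<in> segs"
proof -
  obtain \<beta> where \<beta>: "\<beta> \<in> B" using nonempty by blast
  obtain \<gamma> where "\<gamma> \<in> C" "subcurve \<beta> \<gamma>" using part \<beta> unfolding part_of_def by blast
  then obtain k l where g: "\<gamma> \<in> C" "\<beta> = map \<gamma> [k..l]" unfolding subcurve_def by blast
  have kl: "k \<le> l" using B_nonempty[OF \<beta>] g(2) by auto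
  obtain t where t: "valid t" "\<gamma> k = seg t" using segmentE[OF g(1)] .
  have "\<gamma> k \<in> set \<beta>" using g(2) kl by simp
  then show ?thesis using that[OF t(1)] t(2) \<beta> by (auto simp: segs_def)
qed

lemma copyE:
  assumes "part_of F C" "translation_equiv B F"
  obtains v where "v \<in> occurrences" "F = move v"
proof -
  obtain x where x: "F = map (translate x) ` B" using assms(2) by (auto simp: translation_equiv_def)
  obtain t where t: "valid t" "seg t \<in> segs" by (rule some_segment)
  then obtain \<beta> where \<beta>: "\<beta> \<in> B" "seg t \<in> set \<beta>" by (auto simp: segs_def)
  then have "map (translate x) \<beta> \<in> F" by (simp add: x)
  then obtain \<gamma> k l where "\<gamma> \<in> C" "map (translate x) \<beta> = map \<gamma> [k..l]"
    using assms(1) unfolding part_of_def subcurve_def by blast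
  moreover have "translate x (seg t) \<in> set (map (translate x) \<beta>)" using \<beta>(2) by simp
  ultimately have "translate x (seg t) \<in> segments_of C" by (auto simp: segments_of_def)
  then obtain v where "x = cvec v" by (rule translation_integral[OF t(1)])
  then have "F = move v" by (simp add: x move_def)
  then show ?thesis using that assms(1) by (simp add: occurrences_def)
qed

text \<open>Translating the finite nonempty set \<open>segs\<close> by \<open>v\<close> adds
  \<open>card segs * v\<close> to the sum of its starting points. Hence counting copies of the
  pattern is counting vectors.\<close>

lemma move_inj: "move v = move w \<Longrightarrow> v = w"
proof -
  assume "move v = move w"
  then have "translate (cvec v) ` segs = translate (cvec w) ` segs" using segs_move by metis
  then have eq: "(\<Sum>s\<in>translate (cvec v) ` segs. fst s) = (\<Sum>s\<in>translate (cvec w) ` segs. fst s)" by simp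
  have inj: "inj_on (translate x) segs" for x by (auto simp: inj_on_def translate_def prod_eq_iff)
  have "(\<Sum>s\<in>segs. fst s + cvec v) = (\<Sum>s\<in>segs. fst s + cvec w)"
    using eq unfolding sum.reindex[OF inj] by (simp add: comp_def translate_def)
  then have "of_nat (card segs) * cvec v = of_nat (card segs) * cvec w"
    by (simp add: sum.distrib)
  moreover have "card segs \<noteq> 0" using finite_segs some_segment by (metis card_0_eq empty_iff)
  ultimately show "v = w" by (simp add: cvec_inj)
qed

lemma square_iff: "c \<in> square s z \<longleftrightarrow> Re z \<le> Re c \<and> Re c \<le> Re z + s \<and> Im z \<le> Im c \<and> Im c \<le> Im z + s"
proof
  assume "Re z \<le> Re c \<and> Re c \<le> Re z + s \<and> Im z \<le> Im c \<and> Im c \<le> Im z + s"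
  then show "c \<in> square s z"
    unfolding square_def by (intro CollectI exI[of _ "Re c - Re z"] exI[of _ "Im c - Im z"]) (auto simp: complex_eq_iff)
qed (auto simp: square_def)

lemma convex_square: "convex (square s z)"
proof -
  have "square s z = cbox z (z + Complex s s)"
    by (auto simp: square_iff in_cbox_complex_iff)
  then show ?thesis by simp
qed

lemma bound:
  obtains h :: int where "h \<ge> 0" "\<And>s. s \<in> segs \<Longrightarrow>
    \<bar>Re (fst s)\<bar> \<le> h \<and> \<bar>Im (fst s)\<bar> \<le> h \<and> \<bar>Re (snd s)\<bar> \<le> h \<and> \<bar>Im (snd s)\<bar> \<le> h"
proof -
  have "finite (fst ` segs \<union> snd ` segs)" using finite_segs by simp
  then have "bounded (fst ` segs \<union> snd ` segs)" by (rule finite_imp_bounded)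
  then obtain b where b: "\<And>c. c \<in> fst ` segs \<union> snd ` segs \<Longrightarrow> cmod c \<le> b"
    unfolding bounded_iff by blast
  define h where "h = max 0 \<lceil>b\<rceil>"
  have h: "\<bar>Re c\<bar> \<le> h \<and> \<bar>Im c\<bar> \<le> h" if "c \<in> fst ` segs \<union> snd ` segs" for c
  proof -
    have "b \<le> real_of_int h" unfolding h_def by linarith
    then show ?thesis using b[OF that] abs_Re_le_cmod[of c] abs_Im_le_cmod[of c] by linarith
  qed
  show ?thesis by (rule that[of h]) (use h in \<open>auto simp: h_def\<close>)
qed

lemma lies_in_move:
  "lies_in (move v) A \<longleftrightarrow> (\<forall>s\<in>segs. support (translate (cvec v) s) \<subseteq> A)"
  by (auto simp: lies_in_def move_def segs_def)

lemma has_positive_density: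
  assumes lip: "local_isomorphism_property C"
  shows "\<exists>d>0. has_density C B d"
proof -
  obtain d where d: "uniform_density occurrences d"
    using uniform_density_turning_pattern[OF folding_field_limit_periodic[OF folding_field_\<sigma> recurrent_\<sigma>[OF lip]]
        finite_vertices occurrences_local] by blast
  obtain h :: int where h: "h \<ge> 0" and bd: "\<And>s. s \<in> segs \<Longrightarrow>
    \<bar>Re (fst s)\<bar> \<le> h \<and> \<bar>Im (fst s)\<bar> \<le> h \<and> \<bar>Re (snd s)\<bar> \<le> h \<and> \<bar>Im (snd s)\<bar> \<le> h"
    by (rule bound) blast
  obtain t where t: "valid t" "seg t \<in> segs" by (rule some_segment)
  define c where "c = fst (seg t)"
  have c: "\<bar>Re c\<bar> \<le> h" "\<bar>Im c\<bar> \<le> h" using bd[OF t(2)] by (simp_all add: c_def)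
  have c_in: "c + cvec v \<in> A" if "lies_in (move v) A" for v A
    using that t(2) unfolding lies_in_move
    by (auto simp: support_def translate_def c_def dest!: bspec[of _ _ "seg t"])
  have "d > 0"
  proof -
    obtain r where "r > 0" and r: "\<And>z. \<exists>B'. part_of B' C \<and> translation_equiv B B' \<and> lies_in B' (cball z r)"
      using lip bounded part unfolding local_isomorphism_property_def by meson
    \<comment> \<open>A copy in the disc of radius \<open>r\<close> has its reference point
      \<open>c + cvec v\<close> there, and \<open>c\<close> has coordinates at most
      \<open>h\<close>; so \<open>v\<close> lies in the box of side \<open>2 * R + 1\<close> around
      the centre.\<close>
    define R where "R = \<lceil>r\<rceil> + h"
    have R: "r + h \<le> real_of_int R" "R \<ge> 0" using h \<open>r > 0\<close> unfolding R_def by linarith+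
    show ?thesis
    proof (rule uniform_density_pos[OF d])
      show "2 * R + 1 > 0" using R by simp
      fix x y
      obtain F where F: "part_of F C" "translation_equiv B F" "lies_in F (cball (cvec (x + R, y + R)) r)"
        using r by blast
      obtain v where v: "v \<in> occurrences" "F = move v" using copyE[OF F(1,2)] .
      have "c + cvec v \<in> cball (cvec (x + R, y + R)) r" using c_in F(3) v(2) by blast
      then have "cmod (cvec (x + R, y + R) - (c + cvec v)) \<le> r" by (simp add: dist_norm)
      then have "\<bar>Re (cvec (x + R, y + R) - (c + cvec v))\<bar> \<le> r" "\<bar>Im (cvec (x + R, y + R) - (c + cvec v))\<bar> \<le> r"
        using abs_Re_le_cmod abs_Im_le_cmod by (meson order_trans)+
      then have "\<bar>real_of_int (x + R - fst v)\<bar> \<le> real_of_int R" "\<bar>real_of_int (y + R - snd v)\<bar> \<le> real_of_int R"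
        using c R(1) by (simp_all; linarith)+
      then have "v \<in> qbox x y (2 * R + 1)"
        by (cases v) (simp add: qbox_def; linarith)
      then show "occurrences \<inter> qbox x y (2 * R + 1) \<noteq> {}" using v(1) by blast
    qed
  qed
  have "has_density C B d"
    unfolding has_density_def Let_def
  proof (intro conjI allI impI)
    fix \<epsilon> :: real assume \<epsilon>: "\<epsilon> > 0"
    \<comment> \<open>For \<open>inner\<close> the bound \<open>h\<close> is applied to all
      segments, both endpoints and convexity giving the supports; for \<open>outer\<close> the
      single point \<open>c\<close> suffices.\<close>
    define Q where "Q s z v \<longleftrightarrow> lies_in (move v) (square s z)" for s z v
    have inner: "Q s z v" if "Re z \<le> real_of_int (fst v - h)" "real_of_int (fst v + h) \<le> Re z + s"
      "Im z \<le> real_of_int (snd v - h)" "real_of_int (snd v + h) \<le> Im z + s" for s z v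
      unfolding Q_def lies_in_move
    proof
      fix u assume u: "u \<in> segs"
      have "fst u + cvec v \<in> square s z" "snd u + cvec v \<in> square s z"
        using bd[OF u] that by (auto simp: square_iff)
      then show "support (translate (cvec v) u) \<subseteq> square s z"
        unfolding support_def translate_def by (simp add: closed_segment_subset convex_square)
    qed
    have outer: "Re z \<le> real_of_int (fst v + h) \<and> real_of_int (fst v - h) \<le> Re z + s \<and>
      Im z \<le> real_of_int (snd v + h) \<and> real_of_int (snd v - h) \<le> Im z + s" if "Q s z v" for s z v
      using c_in[OF that[unfolded Q_def]] c by (auto simp: square_iff)
    have card: "card {F. part_of F C \<and> translation_equiv B F \<and> lies_in F (square s z)} =
        card {v \<in> occurrences. Q s z v}" for s z
    proof -
      have "{F. part_of F C \<and> translation_equiv B F \<and> lies_in F (square s z)} =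
          move ` {v \<in> occurrences. Q s z v}"
      proof (intro equalityI subsetI)
        fix F assume "F \<in> {F. part_of F C \<and> translation_equiv B F \<and> lies_in F (square s z)}"
        then have F: "part_of F C" "translation_equiv B F" "lies_in F (square s z)" by auto
        obtain v where "v \<in> occurrences" "F = move v" using copyE[OF F(1,2)] .
        then show "F \<in> move ` {v \<in> occurrences. Q s z v}" using F(3) by (auto simp: Q_def)
      next
        fix F assume "F \<in> move ` {v \<in> occurrences. Q s z v}"
        then show "F \<in> {F. part_of F C \<and> translation_equiv B F \<and> lies_in F (square s z)}"
          by (auto simp: Q_def occurrences_def translation_equiv_def move_def)
      qed
      moreover have "inj move" using move_inj by (auto simp: inj_def)
      ultimately show ?thesis by (simp add: card_image inj_on_subset)
    qed
    show "\<exists>r>0. \<forall>s\<ge>r. \<forall>z.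
        s\<^sup>2 * d * (1 - \<epsilon>) < real (card {F. part_of F C \<and> translation_equiv B F \<and> lies_in F (square s z)}) \<and>
        real (card {F. part_of F C \<and> translation_equiv B F \<and> lies_in F (square s z)}) < s\<^sup>2 * d * (1 + \<epsilon>)"
      using uniform_density_squares[of occurrences d h Q, OF d \<open>d > 0\<close> h inner outer \<epsilon>]
      unfolding card by blast
  qed (use \<open>d > 0\<close> in simp)
  then show ?thesis using \<open>d > 0\<close> by blast
qed

end

theorem theorem3:
  fixes C :: "(int \<Rightarrow> segment) set" and B :: "segment list set"
  assumes "covering C"
    and "\<forall>\<gamma>\<in>C. complete_folding_curve \<gamma>"
    and "local_isomorphism_property C"
    and "bounded_curve_set B" and "B \<noteq> {}"
    and "part_of B C"
  shows "\<exists>d>0. has_density C B d"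
proof -
  obtain p where p: "\<forall>x y::int. let z = Complex (of_int x) (of_int y) in
        {s \<in> segments_of C. fst s = z \<or> snd s = z} =
          (if even (x + y + p)
           then {(z, z + 1), (z, z - 1), (z + \<i>, z), (z - \<i>, z)}
           else {(z + 1, z), (z - 1, z), (z, z + \<i>), (z, z - \<i>)})"
    using assms(1) unfolding covering_def orientation_convention_def by blast
  interpret pattern C p B
    using assms p by unfold_locales blast+
  show ?thesis using assms(3) by (rule has_positive_density)
qed

end
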